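(* Let $V_{\omega_1}$ be the linearly ordered Valdivia compact space with the properties (i)–(iv) listed in the context, let $\sim$ be the equivalence relation on $V_{\omega_1}$ given by: $x\sim y$ if and only if the closed interval with end-points $x,y$ is scattered, and let $K_{\omega_1}=V_{\omega_1}/{\sim}$ be endowed with the quotient topology and the quotient ordering. Then: (a) $K_{\omega_1}$ is a connected linearly ordered compact space of weight $\aleph_1$. (b) $K_{\omega_1}$ is a two-to-one increasing image of a linearly ordered Valdivia compact space (i.e. there are a linearly ordered Valdivia compact space and an increasing surjection from it onto $K_{\omega_1}$ all of whose fibers have at most two elements). (c) Every separable subspace of the Banach space $C(K_{\omega_1})$ is contained in a separable $1$-complemented subspace of $C(K_{\omega_1})$. (d) $C(K_{\omega_1})$ does not have a skeleton consisting of complemented subspaces; in particular, $C(K_{\omega_1})$ is not a Plichko space.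
   Context: All linearly ordered compact spaces carry the order topology. A map $f$ between linearly ordered spaces is increasing if $x\leqslant y$ implies $f(x)\leqslant f(y)$. $C(K)$ is the Banach space of continuous real-valued functions on the compact space $K$ with the supremum norm. Valdivia compact: a compact space $K$ for which there are a cardinal $\kappa$ and a topological embedding $j\colon K\to[0,1]^\kappa$ such that $j^{-1}[\Sigma(\kappa)]$ is dense in $K$, where $\Sigma(\kappa)=\{x\in[0,1]^\kappa\colon |\{\alpha\colon x(\alpha)\neq 0\}|\leqslant\aleph_0\}$. The space $V_{\omega_1}$ is a linearly ordered Valdivia compact space, known to exist, with the following properties: (i) every linearly ordered Valdivia compact space is an increasing image of $V_{\omega_1}$; (ii) it is $0$-dimensional, dense-in-itself (no isolated points), and has weight $\aleph_1$; (iii) every (nonempty) clopen interval of $V_{\omega_1}$ is order isomorphic to $V_{\omega_1}$; (iv) in particular, every nonempty open subset of $V_{\omega_1}$ contains both an increasing and a decreasing copy of $\omega_1$. The $\sim$-classes are closed and convex; the quotient ordering is $[x]_\sim\leqslant[y]_\sim$ iff $x\leqslant y$ (for $[x]_\sim\ne[y]_\sim$). A subspace $F$ of a Banach space $E$ is complemented if there is a bounded linear projection $P\colon E\to E$ with $F=PE$, and $k$-complemented if $P$ can be chosen with $\|P\|\leqslant k$. A skeleton in a Banach space $E$ of density $\aleph_1$ is a chain $\mathcal C$ (with respect to inclusion) of closed separable subspaces of $E$ such that $\bigcup\mathcal C=E$ and $\operatorname{cl}(\bigcup_{n\in\omega}C_n)\in\mathcal C$ whenever $C_0\subseteq C_1\subseteq\cdots$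 is a sequence in $\mathcal C$. A projectional resolution of the identity (PRI) in a Banach space $E$ of density $\aleph_1$ is a sequence $\{P_\alpha\}_{\alpha<\omega_1}$ of linear projections of $E$ onto separable subspaces such that (1) $\|P_\alpha\|=1$; (2) $\alpha\leqslant\beta$ implies $P_\alpha=P_\alpha P_\beta=P_\beta P_\alpha$; (3) $E=\bigcup_{\alpha<\omega_1}P_\alpha E$ and $P_\delta E=\operatorname{cl}(\bigcup_{\xi<\delta}P_\xi E)$ for every limit ordinal $\delta<\omega_1$. A Banach space of density $\aleph_1$ is $1$-Plichko if it has a PRI, and Plichko if it is (linearly) isomorphic to a $1$-Plichko space. *)

theory Defs
  imports "HOL-Analysis.Analysis"
begin

unbundle cardinal_syntax

section \<open>The first uncountable ordinal, weight\<close>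

text \<open>A well-order of order type $\omega_1$ on its field; also used as the cardinal $\aleph_1$.\<close>

definition omega1 :: "nat set rel" where
  "omega1 = cardSuc natLeq"

definition limit_point_of_order :: "'a rel \<Rightarrow> 'a \<Rightarrow> bool" where
  "limit_point_of_order r \<delta> \<longleftrightarrow>
     \<delta> \<in> Field r \<and> underS r \<delta> \<noteq> {} \<and> (\<forall>\<xi>\<in>underS r \<delta>. \<exists>\<eta>\<in>underS r \<delta>. \<xi> \<in> underS r \<eta>)"

definition has_weight :: "'a::topological_space itself \<Rightarrow> 'c rel \<Rightarrow> bool" where
  "has_weight _ r \<longleftrightarrow>
     (\<exists>B :: 'a set set. topological_basis B \<and> |B| =o r) \<and>
     (\<forall>B :: 'a set set. topological_basis B \<longrightarrow> r \<le>o |B| )"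


section \<open>Linearly ordered Valdivia compacta\<close>

text \<open>The product is taken over index sets \<open>I\<close> of functions \<open>'a \<Rightarrow> real\<close>. This is no restriction
  on the cardinal $\kappa$: the coordinates of an embedding $j$ are functions $K \to [0,1]$, and
  omitting repeated coordinates neither destroys injectivity nor enlarges the supports.\<close>

definition valdivia_compact :: "'a topology \<Rightarrow> bool" where
  "valdivia_compact X \<longleftrightarrow>
     compact_space X \<and>
     (\<exists>(I :: ('a \<Rightarrow> real) set) (j :: 'a \<Rightarrow> ('a \<Rightarrow> real) \<Rightarrow> real).
        embedding_map X (product_topology (\<lambda>_. top_of_set {0..1}) I) j \<and>
        X closure_of {x \<in> topspace X. countable {i \<in> I. j x i \<noteq> 0}} = topspace X)"

definition order_topology_on :: "'a set \<Rightarrow> 'a rel \<Rightarrow> 'a topology" where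
  "order_topology_on A r = topology_generated_by
     (insert A ((\<lambda>a. {x \<in> A. (x, a) \<in> r \<and> x \<noteq> a}) ` A \<union> (\<lambda>a. {x \<in> A. (a, x) \<in> r \<and> x \<noteq> a}) ` A))"

text \<open>Compact spaces are understood to be nonempty. The class of all linearly ordered Valdivia
  compacta can be captured by subsets \<open>A\<close> of a single type with at least $2^{\aleph_1}$ elements:
  such a space has weight at most $\aleph_1$, hence at most $2^{\aleph_1}$ points. In particular
  subsets of \<open>'v set\<close> suffice if \<open>'v\<close> contains a copy of $\omega_1$.\<close>

definition linearly_ordered_Valdivia :: "'a set \<Rightarrow> 'a rel \<Rightarrow> bool" where
  "linearly_ordered_Valdivia A r \<longleftrightarrow>
     A \<noteq> {} \<and> linear_order_on A r \<and> valdivia_compact (order_topology_on A r)"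

text \<open>Images are taken under continuous maps; monotonicity alone does not imply continuity.\<close>

definition increasing_surjection ::
  "'a set \<Rightarrow> 'a rel \<Rightarrow> 'b set \<Rightarrow> 'b rel \<Rightarrow> ('a \<Rightarrow> 'b) \<Rightarrow> bool" where
  "increasing_surjection A r B s f \<longleftrightarrow>
     continuous_map (order_topology_on A r) (order_topology_on B s) f \<and> f ` A = B \<and>
     (\<forall>x\<in>A. \<forall>y\<in>A. (x, y) \<in> r \<longrightarrow> (f x, f y) \<in> s)"

abbreviation le_rel :: "'a::order rel" where
  "le_rel \<equiv> {(x, y). x \<le> y}"

lemma order_topology_on_UNIV:
  "order_topology_on UNIV le_rel = (euclidean :: 'a::linorder_topology topology)"
proof -
  let ?S = "range (\<lambda>a::'a. {..<a}) \<union> range (\<lambda>a. {a<..})"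
  have eq: "(\<lambda>a::'a. {x \<in> UNIV. (x, a) \<in> le_rel \<and> x \<noteq> a}) = (\<lambda>a. {..<a})"
           "(\<lambda>a::'a. {x \<in> UNIV. (a, x) \<in> le_rel \<and> x \<noteq> a}) = (\<lambda>a. {a<..})"
    by (auto simp: fun_eq_iff)
  have 1: "generate_topology_on (insert UNIV ?S) U" if "generate_topology ?S U" for U :: "'a set"
    using that
  proof induction
    case UNIV show ?case by (rule generate_topology_on.Basis) auto
  next
    case (Int a b) then show ?case by (auto intro: generate_topology_on.Int)
  next
    case (UN K) then show ?case by (auto intro: generate_topology_on.UN)
  next
    case (Basis s) then show ?case by (intro generate_topology_on.Basis) auto
  qed
  have 2: "generate_topology ?S U" if "generate_topology_on (insert UNIV ?S) U" for U :: "'a set"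
    using that
  proof induction
    case Empty show ?case using generate_topology.UN[of "{}" ?S] by simp
  next
    case (Int a b) then show ?case by (auto intro: generate_topology.Int)
  next
    case (UN K) then show ?case by (auto intro: generate_topology.UN)
  next
    case (Basis s)
    then consider "s = UNIV" | "s \<in> ?S" by blast
    then show ?case by cases (auto intro: generate_topology.UNIV generate_topology.Basis)
  qed
  have "openin (order_topology_on UNIV le_rel) U \<longleftrightarrow> open U" for U :: "'a set"
    unfolding order_topology_on_def eq openin_topology_generated_by_iff open_generated_order
    using 1 2 by blast
  then show ?thesis by (simp add: topology_eq)
qed


section \<open>The quotient of a linearly ordered space by scattered intervals\<close>

definition scattered :: "'a::topological_space set \<Rightarrow> bool" where
  "scattered S \<longleftrightarrow> (\<forall>A\<subseteq>S. A \<noteq> {} \<longrightarrow> (\<exists>x\<in>A. x isolated_in A))"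

definition scat_equiv :: "'a::linorder_topology \<Rightarrow> 'a \<Rightarrow> bool" where
  "scat_equiv x y \<longleftrightarrow> scattered {min x y..max x y}"

lemma scattered_subset: "scattered T \<Longrightarrow> S \<subseteq> T \<Longrightarrow> scattered S"
  unfolding scattered_def by blast

lemma scattered_Un:
  assumes "scattered S" "scattered T" "closed S"
  shows "scattered (S \<union> T)"
  unfolding scattered_def
proof (intro allI impI)
  fix A assume A: "A \<subseteq> S \<union> T" "A \<noteq> {}"
  show "\<exists>x\<in>A. x isolated_in A"
  proof (cases "A \<subseteq> S")
    case True
    then show ?thesis using assms(1) A unfolding scattered_def by blast
  next
    case False
    then have "A - S \<subseteq> T" "A - S \<noteq> {}" using A by auto
    then obtain x U where x: "x \<in> A - S" "open U" "U \<inter> (A - S) = {x}"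
      using assms(2) unfolding scattered_def isolated_in_def by meson
    then have "open (U - S) \<and> (U - S) \<inter> A = {x}"
      using assms(3) by (auto simp: open_Diff)
    then show ?thesis using x unfolding isolated_in_def by blast
  qed
qed

lemma equivp_scat_equiv: "equivp (scat_equiv :: 'a::linorder_topology \<Rightarrow> 'a \<Rightarrow> bool)"
proof (rule equivpI)
  show "reflp (scat_equiv :: 'a \<Rightarrow> 'a \<Rightarrow> bool)"
  proof (rule reflpI)
    fix x :: 'a
    show "scat_equiv x x"
      unfolding scat_equiv_def scattered_def
    proof (intro allI impI)
      fix A assume "A \<subseteq> {min x x..max x x}" "A \<noteq> {}"
      then have "A = {x}" by auto
      then show "\<exists>x\<in>A. x isolated_in A"
        unfolding isolated_in_def using open_UNIV by blast
    qed
  qed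
  show "symp (scat_equiv :: 'a \<Rightarrow> 'a \<Rightarrow> bool)"
    by (rule sympI) (simp add: scat_equiv_def min.commute max.commute)
  show "transp (scat_equiv :: 'a \<Rightarrow> 'a \<Rightarrow> bool)"
  proof (rule transpI)
    fix x y z :: 'a
    assume *: "scat_equiv x y" "scat_equiv y z"
    have "scattered ({min x y..max x y} \<union> {min y z..max y z})"
      using * unfolding scat_equiv_def by (intro scattered_Un) auto
    then show "scat_equiv x z"
      unfolding scat_equiv_def
      by (rule scattered_subset) (auto simp: min_def max_def split: if_splits)
  qed
qed

quotient_type (overloaded) 'a scat_quotient = "'a::linorder_topology" / scat_equiv
  morphisms rep_class scat_class
  by (rule equivp_scat_equiv)

lemma scat_class_eq_iff: "scat_class x = scat_class y \<longleftrightarrow> scat_equiv x y"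
  by (rule scat_quotient.abs_eq_iff)

lemma scat_class_cases: obtains x where "X = scat_class x"
  by (metis Quotient3_abs_rep Quotient3_scat_quotient)

text \<open>The quotient topology; that it agrees with the order topology of the quotient ordering is not
  built in.\<close>

instantiation scat_quotient :: (linorder_topology) topological_space
begin

definition open_scat_quotient :: "'a scat_quotient set \<Rightarrow> bool" where
  "open_scat_quotient U \<longleftrightarrow> open (scat_class -` U)"

instance
proof
  show "open (UNIV :: 'a scat_quotient set)"
    by (simp add: open_scat_quotient_def)
next
  fix S T :: "'a scat_quotient set"
  show "open S \<Longrightarrow> open T \<Longrightarrow> open (S \<inter> T)"
    by (simp add: open_scat_quotient_def open_Int)
next
  fix K :: "'a scat_quotient set set"
  show "\<forall>S\<in>K. open S \<Longrightarrow> open (\<Union>K)"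
    unfolding open_scat_quotient_def vimage_Union by blast
qed

end

instantiation scat_quotient :: (linorder_topology) linorder
begin

definition less_eq_scat_quotient :: "'a scat_quotient \<Rightarrow> 'a scat_quotient \<Rightarrow> bool" where
  "less_eq_scat_quotient X Y \<longleftrightarrow>
     X = Y \<or> (\<exists>x y. X = scat_class x \<and> Y = scat_class y \<and> x \<le> y)"

definition less_scat_quotient :: "'a scat_quotient \<Rightarrow> 'a scat_quotient \<Rightarrow> bool" where
  "less_scat_quotient X Y \<longleftrightarrow> X \<le> Y \<and> \<not> Y \<le> X"

lemma scat_equiv_between:
  fixes x y z :: 'a
  assumes "scat_equiv x z" "x \<le> y" "y \<le> z"
  shows "scat_equiv x y"
  using assms unfolding scat_equiv_def
  by (elim scattered_subset) (auto simp: min_def max_def split: if_splits)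

lemma scat_class_between:
  fixes x y x' y' :: 'a
  assumes "x \<le> y" "y' \<le> x'" "scat_class x = scat_class x'" "scat_class y = scat_class y'"
  shows "scat_class x = scat_class y"
proof (cases "y \<le> x'")
  case True
  then show ?thesis using assms scat_equiv_between[of x x' y] by (simp add: scat_class_eq_iff)
next
  case False
  then have "scat_class y' = scat_class x'"
    using assms scat_equiv_between[of y' y x'] by (simp add: scat_class_eq_iff[symmetric])
  then show ?thesis using assms by simp
qed

lemma scat_class_le_iff:
  fixes x y :: 'a
  shows "scat_class x \<le> scat_class y \<longleftrightarrow> scat_class x = scat_class y \<or> x \<le> y"
proof
  assume "scat_class x \<le> scat_class y"
  then consider "scat_class x = scat_class y"
    | x' y' where "scat_class x = scat_class x'" "scat_class y = scat_class y'" "x' \<le> y'"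
    unfolding less_eq_scat_quotient_def by blast
  then show "scat_class x = scat_class y \<or> x \<le> y"
  proof cases
    case 2
    then show ?thesis
      using scat_class_between[of x' y' y x] by (metis linear)
  qed simp
qed (auto simp: less_eq_scat_quotient_def)

instance
proof
  fix X Y Z :: "'a scat_quotient"
  obtain x y z where xyz: "X = scat_class x" "Y = scat_class y" "Z = scat_class z"
    by (metis scat_class_cases)
  show "X < Y \<longleftrightarrow> X \<le> Y \<and> \<not> Y \<le> X" by (rule less_scat_quotient_def)
  show "X \<le> X" by (simp add: less_eq_scat_quotient_def)
  show "X \<le> Y \<Longrightarrow> Y \<le> Z \<Longrightarrow> X \<le> Z"
    unfolding xyz scat_class_le_iff by (metis order_trans linear scat_class_between)
  show "X \<le> Y \<Longrightarrow> Y \<le> X \<Longrightarrow> X = Y"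
    unfolding xyz scat_class_le_iff by auto
  show "X \<le> Y \<or> Y \<le> X"
    unfolding xyz scat_class_le_iff by auto
qed

end


section \<open>Banach spaces\<close>

definition separable_set :: "'a::topological_space set \<Rightarrow> bool" where
  "separable_set S \<longleftrightarrow> separable_space (top_of_set S)"

definition projection :: "('a::real_normed_vector \<Rightarrow> 'a) \<Rightarrow> bool" where
  "projection P \<longleftrightarrow> bounded_linear P \<and> P \<circ> P = P"

definition complemented :: "'a::real_normed_vector set \<Rightarrow> bool" where
  "complemented F \<longleftrightarrow> (\<exists>P. projection P \<and> range P = F)"

definition k_complemented :: "real \<Rightarrow> 'a::real_normed_vector set \<Rightarrow> bool" where
  "k_complemented k F \<longleftrightarrow> (\<exists>P. projection P \<and> range P = F \<and> onorm P \<le> k)"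

text \<open>Skeletons and projectional resolutions are considered here without requiring the density
  of the ambient space to be $\aleph_1$; on spaces of density $\aleph_1$ these are the usual notions.\<close>

definition skeleton :: "'a::real_normed_vector set set \<Rightarrow> bool" where
  "skeleton \<C> \<longleftrightarrow>
     (\<forall>C\<in>\<C>. subspace C \<and> closed C \<and> separable_set C) \<and>
     chain\<^sub>\<subseteq> \<C> \<and> \<Union>\<C> = UNIV \<and>
     (\<forall>C :: nat \<Rightarrow> 'a set. (\<forall>n. C n \<in> \<C>) \<and> (\<forall>n. C n \<subseteq> C (Suc n)) \<longrightarrow> closure (\<Union>n. C n) \<in> \<C>)"

definition projectional_resolution :: "(nat set \<Rightarrow> 'a::real_normed_vector \<Rightarrow> 'a) \<Rightarrow> bool" where
  "projectional_resolution P \<longleftrightarrow>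
     (\<forall>\<alpha>\<in>Field omega1. projection (P \<alpha>) \<and> separable_set (range (P \<alpha>)) \<and> onorm (P \<alpha>) = 1) \<and>
     (\<forall>\<alpha> \<beta>. (\<alpha>, \<beta>) \<in> omega1 \<longrightarrow> P \<alpha> \<circ> P \<beta> = P \<alpha> \<and> P \<beta> \<circ> P \<alpha> = P \<alpha>) \<and>
     (\<Union>\<alpha>\<in>Field omega1. range (P \<alpha>)) = UNIV \<and>
     (\<forall>\<delta>. limit_point_of_order omega1 \<delta> \<longrightarrow>
        range (P \<delta>) = closure (\<Union>\<xi>\<in>underS omega1 \<delta>. range (P \<xi>)))"

definition one_Plichko :: "'a::banach itself \<Rightarrow> bool" where
  "one_Plichko _ \<longleftrightarrow> (\<exists>P :: nat set \<Rightarrow> 'a \<Rightarrow> 'a. projectional_resolution P)"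

text \<open>\<open>E\<close> is Plichko iff it is linearly isomorphic to some 1-Plichko space. As types cannot be bound
  existentially in HOL, the assertion that \<open>E\<close> is not Plichko is expressed with a free, hence
  universally quantified, type \<open>'f\<close>: \<open>E\<close> is not isomorphic to \<open>'f\<close> if \<open>'f\<close> is 1-Plichko.\<close>

definition linearly_isomorphic ::
  "'a::real_normed_vector itself \<Rightarrow> 'b::real_normed_vector itself \<Rightarrow> bool" where
  "linearly_isomorphic _ _ \<longleftrightarrow>
     (\<exists>(T :: 'a \<Rightarrow> 'b) S. bounded_linear T \<and> bounded_linear S \<and> S \<circ> T = id \<and> T \<circ> S = id)"

end

theory Submission
  imports Defs "HOL-Library.Countable_Set_Type"
begin

text \<open>Write \<open>V\<close> for the given Valdivia line and \<open>K\<close> for its quotient.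

  \<^bold>\<open>Geometry.\<close> As \<open>V\<close> has no isolated points, an open interval of \<open>V\<close> is either empty or not
  scattered. Hence passing to \<open>K\<close> merely glues together the two ends of every jump of \<open>V\<close>: the
  quotient map is increasing and two-to-one, and \<open>K\<close> is compact and densely ordered, hence connected.
  An \<open>\<omega>\<^sub>1\<close>-sequence inside an interval of \<open>V\<close> yields uncountably many disjoint intervals in the
  corresponding interval of \<open>K\<close>, so no interval of \<open>K\<close> is separable; this gives the lower bound for
  the weight.

  \<^bold>\<open>Separable complementation.\<close> Countably many functions on \<open>V\<close> are determined by countably many
  clopen initial segments of \<open>V\<close>. Closing off under a choice of points of countable support in
  the Valdivia embedding produces a countable family of segments and a closed set \<open>F\<close> that meets every
  nonempty difference of two segments of the family and whose points are separated by the family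
  (\<open>determining_segments_and_net\<close>). Each of the given functions that lives on \<open>K\<close> is constant on the
  gaps of the image of \<open>F\<close> in \<open>K\<close>, so it is fixed by the operator that restricts to this image and
  interpolates over the gaps (\<open>extension_operator\<close>). This operator is a projection of norm at most one,
  and its range is separable because \<open>F\<close> is separated by countably many clopen sets.

  \<^bold>\<open>No skeletons.\<close> By closing off, a skeleton has a member \<open>C\<close> and there is a countable, densely
  ordered \<open>N \<subseteq> K\<close> such that \<open>C\<close> contains a ramp between any two points of \<open>N\<close> and its members are
  constant on intervals free of \<open>N\<close>. Maximal intervals with at most one point of \<open>N\<close> are then collapsed
  by \<open>C\<close>, and as \<open>K\<close> is nowhere separable, there are nondegenerate ones next to both ends of any of
  them. As for the functions with
  jumps at a dense set of points of \<open>[0,1]\<close>, among which the continuous functions are not complemented,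
  there is no projection \<open>P\<close> onto \<open>C\<close>: modulo \<open>C\<close>, signed sums of ramps across
  collapsed intervals can be kept in the unit ball, while \<open>I - P\<close> kills \<open>C\<close> and preserves the increment
  of each ramp, so that sums chosen along a nested sequence of intervals become unbounded under \<open>I - P\<close>
  (\<open>no_projection_onto_functions_without_jumps\<close>).

  Finally, the ranges of a projectional resolution, transported by an isomorphism, form a skeleton of
  complemented subspaces, so \<open>C(K)\<close> is not a Plichko space.\<close>

section \<open>Separability in spaces of continuous functions\<close>

text \<open>For every \<open>n\<close> the pairs on which \<open>g\<close> differs by at least \<open>1/n\<close> form a compact set, which is
  covered by finitely many of the given open sets.\<close>

lemma countably_many_separators:
  fixes g :: "'a::topological_space \<Rightarrow> real" and W :: "'i \<Rightarrow> ('a \<times> 'a) set"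
  assumes "compact (UNIV :: 'a set)" "continuous_on UNIV g"
    and opn: "\<And>i. i \<in> A \<Longrightarrow> open (W i)"
    and cover: "\<And>x y. g x \<noteq> g y \<Longrightarrow> \<exists>i\<in>A. (x, y) \<in> W i"
  shows "\<exists>B\<subseteq>A. countable B \<and> (\<forall>x y. g x \<noteq> g y \<longrightarrow> (\<exists>i\<in>B. (x, y) \<in> W i))"
proof -
  define D where "D n = {z. 1 / real (Suc n) \<le> \<bar>g (fst z) - g (snd z)\<bar>}" for n
  have "\<exists>B\<subseteq>A. finite B \<and> D n \<subseteq> (\<Union>i\<in>B. W i)" for n
  proof -
    have c1: "continuous_on UNIV (\<lambda>z::'a \<times> 'a. g (fst z))"
      by (rule continuous_on_compose2[OF assms(2)]) (auto intro: continuous_intros)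
    have c2: "continuous_on UNIV (\<lambda>z::'a \<times> 'a. g (snd z))"
      by (rule continuous_on_compose2[OF assms(2)]) (auto intro: continuous_intros)
    have "closed (D n)"
      unfolding D_def by (intro closed_Collect_le continuous_intros c1 c2)
    moreover have "compact (UNIV :: ('a \<times> 'a) set)"
      using compact_Times[OF assms(1) assms(1)] by simp
    ultimately have "compact (D n)"
      using compact_Int_closed[of UNIV "D n"] by simp
    moreover have "D n \<subseteq> (\<Union>i\<in>A. W i)"
    proof
      fix z assume "z \<in> D n"
      then have "g (fst z) \<noteq> g (snd z)" by (auto simp: D_def divide_le_0_iff)
      then show "z \<in> (\<Union>i\<in>A. W i)" using cover[of "fst z" "snd z"] by auto
    qed
    ultimately show ?thesis
      using compactE_image[of "D n" A W] opn by metis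
  qed
  then obtain B where B: "\<And>n. B n \<subseteq> A" "\<And>n. finite (B n)" "\<And>n. D n \<subseteq> (\<Union>i\<in>B n. W i)"
    by metis
  have "\<exists>i\<in>(\<Union>n. B n). (x, y) \<in> W i" if "g x \<noteq> g y" for x y
  proof -
    have "0 < \<bar>g x - g y\<bar>" using that by simp
    then obtain n where "1 / real (Suc n) < \<bar>g x - g y\<bar>" by (rule nat_approx_posE)
    then have "(x, y) \<in> D n" by (simp add: D_def)
    then show ?thesis using B(3) by blast
  qed
  moreover have "countable (\<Union>n. B n)" using B(2) by (auto intro: countable_finite)
  ultimately show ?thesis using B(1) by (intro exI[of _ "\<Union>n. B n"]) auto
qed

lemma separable_setD:
  assumes "separable_set S"
  shows "\<exists>D. countable D \<and> D \<subseteq> S \<and> S \<subseteq> closure D"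
proof -
  obtain D where D: "countable D" "D \<subseteq> S" "top_of_set S closure_of D = S"
    using assms unfolding separable_set_def separable_space_def by auto
  have "S \<inter> closure D = S"
    using D(2,3) by (simp add: closure_of_subtopology Int_absorb1)
  then show ?thesis using D by blast
qed

lemma separable_setI:
  assumes "countable D" "D \<subseteq> S" "S \<subseteq> closure D"
  shows "separable_set S"
  unfolding separable_set_def separable_space_def
  using assms by (intro exI[of _ D]) (auto simp: closure_of_subtopology Int_absorb1)

lemma bounded_linear_apply_bcontfun:
  "bounded_linear (\<lambda>f :: 'a::topological_space \<Rightarrow>\<^sub>C real. apply_bcontfun f x)"
proof (rule bounded_linear_intro[of _ 1])
  show "norm (apply_bcontfun f x) \<le> norm f * 1" for f :: "'a \<Rightarrow>\<^sub>C real"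
    using norm_bounded[of f x] by simp
qed simp_all

lemma closed_agreement:
  "closed {f :: 'a::topological_space \<Rightarrow>\<^sub>C real. apply_bcontfun f x = apply_bcontfun f y}"
  by (intro closed_Collect_eq linear_continuous_on bounded_linear_apply_bcontfun)

text \<open>A member of \<open>G\<close> is determined up to a given error by finitely many pairs
  consisting of a piece of \<open>F\<close> and a rational number, and there are only countably many such
  descriptions. The set \<open>F\<close> is norming for differences of members of \<open>G\<close>, so realising each
  description once gives a dense subset.\<close>

lemma separable_set_if_finitely_described:
  fixes G :: "('a::topological_space \<Rightarrow>\<^sub>C real) set"
  assumes \<A>: "countable \<A>"
    and fine: "\<And>g e. g \<in> G \<Longrightarrow> 0 < e \<Longrightarrow> \<exists>\<V>\<subseteq>\<A>. finite \<V> \<and> F \<subseteq> \<Union>\<V> \<and>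
          (\<forall>A\<in>\<V>. \<forall>x\<in>A \<inter> F. \<forall>y\<in>A \<inter> F. \<bar>apply_bcontfun g x - g y\<bar> < e)"
    and norming: "\<And>g h M. g \<in> G \<Longrightarrow> h \<in> G \<Longrightarrow> (\<And>x. x \<in> F \<Longrightarrow> \<bar>apply_bcontfun g x - h x\<bar> \<le> M) \<Longrightarrow> norm (g - h) \<le> M"
  shows "separable_set G"
proof -
  define desc where "desc n \<Lambda> g \<longleftrightarrow> F \<subseteq> \<Union>(fst ` \<Lambda>) \<and>
    (\<forall>(A, q)\<in>\<Lambda>. \<forall>x\<in>A \<inter> F. \<bar>apply_bcontfun g x - q\<bar> \<le> 1 / real (Suc n))"
    for n and \<Lambda> :: "('a set \<times> real) set" and g :: "'a \<Rightarrow>\<^sub>C real"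
  define \<L> where "\<L> = {\<Lambda>. finite \<Lambda> \<and> \<Lambda> \<subseteq> \<A> \<times> (\<rat> :: real set)}"
  have "countable \<L>"
    unfolding \<L>_def using \<A> countable_rat by (intro countable_Collect_finite_subset) auto
  have desc_ex: "\<exists>\<Lambda>\<in>\<L>. desc n \<Lambda> g" if g: "g \<in> G" for n g
  proof -
    define e where "e = 1 / real (Suc n) / 2"
    have e: "0 < e" by (simp add: e_def)
    obtain \<V> where \<V>: "\<V> \<subseteq> \<A>" "finite \<V>" "F \<subseteq> \<Union>\<V>"
        "\<forall>A\<in>\<V>. \<forall>x\<in>A \<inter> F. \<forall>y\<in>A \<inter> F. \<bar>g x - g y\<bar> < e"
      using fine[OF g e] by (elim exE conjE)
    have "\<exists>q\<in>\<rat>. \<forall>x\<in>A \<inter> F. \<bar>g x - q\<bar> \<le> 1 / real (Suc n)" if A: "A \<in> \<V>" for A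
    proof (cases "A \<inter> F = {}")
      case True
      then show ?thesis by (intro bexI[of _ 0]) auto
    next
      case False
      then obtain a where a: "a \<in> A \<inter> F" by blast
      obtain q where q: "q \<in> \<rat>" "g a - e < q" "q < g a + e"
        using Rats_dense_in_real[of "g a - e" "g a + e"] e by auto
      have "\<bar>g x - q\<bar> \<le> 1 / real (Suc n)" if "x \<in> A \<inter> F" for x
      proof -
        have "\<bar>g x - g a\<bar> < e" using \<V>(4) A a that by blast
        moreover have "e + e = 1 / real (Suc n)" by (simp only: e_def field_sum_of_halves)
        ultimately show ?thesis using q(2,3) by linarith
      qed
      then show ?thesis using q(1) by blast
    qed
    then obtain q where q: "\<And>A. A \<in> \<V> \<Longrightarrow> q A \<in> \<rat>"
        "\<And>A x. A \<in> \<V> \<Longrightarrow> x \<in> A \<inter> F \<Longrightarrow> \<bar>g x - q A\<bar> \<le> 1 / real (Suc n)" by metis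
    have "fst ` (\<lambda>A. (A, q A)) ` \<V> = \<V>" by (simp add: image_image)
    then have "desc n ((\<lambda>A. (A, q A)) ` \<V>) g" using \<V>(3) q(2) by (auto simp: desc_def)
    moreover have "(\<lambda>A. (A, q A)) ` \<V> \<in> \<L>" using \<V>(1,2) q(1) by (auto simp: \<L>_def)
    ultimately show ?thesis by blast
  qed
  define pick where "pick = (\<lambda>(n, \<Lambda>). SOME g. g \<in> G \<and> desc n \<Lambda> g)"
  have pick: "pick (n, \<Lambda>) \<in> G \<and> desc n \<Lambda> (pick (n, \<Lambda>))" if "g \<in> G" "desc n \<Lambda> g" for n \<Lambda> g
    unfolding pick_def using someI[of "\<lambda>g. g \<in> G \<and> desc n \<Lambda> g" g] that by simp
  define D where "D = pick ` (UNIV \<times> \<L>) \<inter> G"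
  have "G \<subseteq> closure D"
  proof
    fix g assume g: "g \<in> G"
    show "g \<in> closure D"
      unfolding closure_approachable
    proof (intro allI impI)
      fix e :: real assume "0 < e"
      then have "0 < e / 2" by simp
      then obtain n where n: "1 / real (Suc n) < e / 2" by (rule nat_approx_posE)
      obtain \<Lambda> where \<Lambda>: "\<Lambda> \<in> \<L>" "desc n \<Lambda> g" using desc_ex[OF g] by blast
      define h where "h = pick (n, \<Lambda>)"
      have h: "h \<in> G" "desc n \<Lambda> h" using pick[OF g \<Lambda>(2)] by (auto simp: h_def)
      have "norm (h - g) \<le> 1 / real (Suc n) + 1 / real (Suc n)"
      proof (rule norming[OF h(1) g])
        fix x assume x: "x \<in> F"
        then obtain A q where Aq: "(A, q) \<in> \<Lambda>" "x \<in> A" using \<Lambda>(2) unfolding desc_def by force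
        have "\<bar>g x - q\<bar> \<le> 1 / real (Suc n)" "\<bar>h x - q\<bar> \<le> 1 / real (Suc n)"
          using Aq x h(2) \<Lambda>(2) unfolding desc_def by blast+
        then show "\<bar>h x - g x\<bar> \<le> 1 / real (Suc n) + 1 / real (Suc n)" by linarith
      qed
      then have "dist h g < e" using n by (simp add: dist_norm)
      moreover have "h \<in> D" using h(1) \<Lambda>(1) by (auto simp: D_def h_def)
      ultimately show "\<exists>y\<in>D. dist y g < e" by blast
    qed
  qed
  moreover have "countable D" using \<open>countable \<L>\<close> by (auto simp: D_def)
  ultimately show ?thesis by (intro separable_setI[of D]) (auto simp: D_def)
qed

section \<open>Densely ordered compact lines\<close>

text \<open>The quotient type carries its quotient topology and is not an instance of the class of linearly
  ordered topological spaces. The locale describes compact densely ordered spaces carrying the order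
  topology; the latter is expressed by open rays and one-sided neighbourhoods, which are
  easier to verify for a quotient than a generating family.\<close>

locale order_continuum =
  fixes T :: "'k::{linorder,topological_space} itself"
  assumes open_lessThan: "open {..<a::'k}"
    and open_greaterThan: "open {a::'k<..}"
    and right_neighbourhood: "open U \<Longrightarrow> b \<in> U \<Longrightarrow> b < v \<Longrightarrow> \<exists>c>b. {b..<c::'k} \<subseteq> U"
    and left_neighbourhood: "open U \<Longrightarrow> b \<in> U \<Longrightarrow> u < b \<Longrightarrow> \<exists>c<b. {c::'k<..b} \<subseteq> U"
    and compact_UNIV: "compact (UNIV :: 'k set)"
    and between: "x < y \<Longrightarrow> \<exists>z::'k. x < z \<and> z < y"

context order_continuum
begin

lemma closed_atMost: "closed {..a::'k}"
  using open_greaterThan[of a] by (simp add: closed_def Compl_atMost)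

lemma closed_atLeast: "closed {a::'k..}"
  using open_lessThan[of a] by (simp add: closed_def Compl_atLeast)

lemma open_interval: "open {a::'k<..<b}"
  using open_Int[OF open_greaterThan[of a] open_lessThan[of b]] by (simp add: greaterThanLessThan_def)

lemma compact_closed: "closed (C :: 'k set) \<Longrightarrow> compact C"
  using compact_Int_closed[OF compact_UNIV] by simp

lemma closed_has_least:
  assumes "closed (C :: 'k set)" "C \<noteq> {}"
  shows "\<exists>m\<in>C. \<forall>x\<in>C. m \<le> x"
proof (rule ccontr)
  assume "\<not> ?thesis"
  then have *: "\<forall>m\<in>C. \<exists>x\<in>C. x < m" by (meson not_le)
  then have "C \<subseteq> (\<Union>c\<in>C. {c<..})" by auto
  then obtain D where D: "D \<subseteq> C" "finite D" "C \<subseteq> (\<Union>c\<in>D. {c<..})"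
    using compactE_image[OF compact_closed[OF assms(1)], of C greaterThan] open_greaterThan
    by metis
  then have "D \<noteq> {}" using assms(2) by auto
  then have "Min D \<in> D" using D(2) by simp
  then obtain c where "c \<in> D" "c < Min D" using D(1,3) by auto
  then show False using D(2) by (simp add: leD)
qed

lemma closed_has_greatest:
  assumes "closed (C :: 'k set)" "C \<noteq> {}"
  shows "\<exists>m\<in>C. \<forall>x\<in>C. x \<le> m"
proof (rule ccontr)
  assume "\<not> ?thesis"
  then have *: "\<forall>m\<in>C. \<exists>x\<in>C. m < x" by (meson not_le)
  then have "C \<subseteq> (\<Union>c\<in>C. {..<c})" by auto
  then obtain D where D: "D \<subseteq> C" "finite D" "C \<subseteq> (\<Union>c\<in>D. {..<c})"
    using compactE_image[OF compact_closed[OF assms(1)], of C lessThan] open_lessThan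
    by metis
  then have "D \<noteq> {}" using assms(2) by auto
  then have "Max D \<in> D" using D(2) by simp
  then obtain c where "c \<in> D" "Max D < c" using D(1,3) by auto
  then show False using D(2) by (simp add: leD)
qed

lemma least_upper_bound:
  "\<exists>s. (\<forall>x\<in>X. x \<le> s) \<and> (\<forall>z<s. \<exists>x\<in>X. z < (x::'k))"
proof -
  have "closed (\<Inter>x\<in>X. {x..})" by (auto intro: closed_atLeast)
  moreover obtain t where "\<forall>x::'k. x \<le> t" using closed_has_greatest[of UNIV] by auto
  ultimately obtain s where "s \<in> (\<Inter>x\<in>X. {x..})" "\<forall>y\<in>(\<Inter>x\<in>X. {x..}). s \<le> y"
    using closed_has_least[of "\<Inter>x\<in>X. {x..}"] by blast
  then show ?thesis by (intro exI[of _ s]) (auto simp: not_le[symmetric])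
qed

lemma greatest_lower_bound:
  "\<exists>s. (\<forall>x\<in>X. s \<le> x) \<and> (\<forall>z>s. \<exists>x\<in>X. (x::'k) < z)"
proof -
  have "closed (\<Inter>x\<in>X. {..x})" by (auto intro: closed_atMost)
  moreover obtain t where "\<forall>x::'k. t \<le> x" using closed_has_least[of UNIV] by auto
  ultimately obtain s where "s \<in> (\<Inter>x\<in>X. {..x})" "\<forall>y\<in>(\<Inter>x\<in>X. {..x}). y \<le> s"
    using closed_has_greatest[of "\<Inter>x\<in>X. {..x}"] by blast
  then show ?thesis by (intro exI[of _ s]) (auto simp: not_le[symmetric])
qed

lemma two_sided_neighbourhood:
  assumes "open (U :: 'k set)" "b \<in> U"
  shows "\<exists>L R. (L = UNIV \<or> (\<exists>c<b. L = {c<..})) \<and> (R = UNIV \<or> (\<exists>d>b. R = {..<d})) \<and> L \<inter> R \<subseteq> U"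
proof -
  have "\<exists>L. (L = UNIV \<or> (\<exists>c<b. L = {c<..})) \<and> L \<inter> {..b} \<subseteq> U"
  proof (cases "\<exists>u. u < b")
    case True
    then obtain c where "c < b" "{c<..b} \<subseteq> U" using left_neighbourhood[OF assms] by blast
    then show ?thesis by (intro exI[of _ "{c<..}"]) auto
  next
    case False
    then show ?thesis using assms(2) by (intro exI[of _ UNIV]) (auto simp: le_less)
  qed
  moreover have "\<exists>R. (R = UNIV \<or> (\<exists>c>b. R = {..<c})) \<and> R \<inter> {b..} \<subseteq> U"
  proof (cases "\<exists>u. b < u")
    case True
    then obtain c where "b < c" "{b..<c} \<subseteq> U" using right_neighbourhood[OF assms] by blast
    then show ?thesis by (intro exI[of _ "{..<c}"]) auto
  next
    case False
    then show ?thesis using assms(2) by (intro exI[of _ UNIV]) (auto simp: le_less)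
  qed
  ultimately obtain L R where "L = UNIV \<or> (\<exists>c<b. L = {c<..})" "R = UNIV \<or> (\<exists>c>b. R = {..<c})"
     "L \<inter> {..b} \<subseteq> U" "R \<inter> {b..} \<subseteq> U" by blast
  moreover have "{..b} \<union> {b..} = UNIV" by auto
  ultimately have "L \<inter> R \<subseteq> U" by blast
  then show ?thesis
    using \<open>L = UNIV \<or> (\<exists>c<b. L = {c<..})\<close> \<open>R = UNIV \<or> (\<exists>c>b. R = {..<c})\<close> by blast
qed

lemma euclidean_eq_order_topology:
  "(euclidean :: 'k topology) = order_topology_on UNIV le_rel"
proof -
  let ?S = "insert UNIV (range lessThan \<union> range (greaterThan :: 'k \<Rightarrow> _))"
  have eq: "(\<lambda>a::'k. {x \<in> UNIV. (x, a) \<in> le_rel \<and> x \<noteq> a}) = lessThan"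
           "(\<lambda>a::'k. {x \<in> UNIV. (a, x) \<in> le_rel \<and> x \<noteq> a}) = greaterThan"
    by (auto simp: fun_eq_iff)
  have gen: "order_topology_on UNIV le_rel = topology_generated_by ?S"
    unfolding order_topology_on_def eq ..
  have "generate_topology_on ?S U" if "open U" for U
  proof -
    have "\<exists>V. generate_topology_on ?S V \<and> b \<in> V \<and> V \<subseteq> U" if b: "b \<in> U" for b
    proof -
      obtain L R where "L = UNIV \<or> (\<exists>c<b. L = {c<..})" "R = UNIV \<or> (\<exists>d>b. R = {..<d})" "L \<inter> R \<subseteq> U"
        using two_sided_neighbourhood[OF \<open>open U\<close> b] by blast
      then have "L \<in> ?S" "R \<in> ?S" "b \<in> L \<inter> R"
        by auto
      then have "generate_topology_on ?S (L \<inter> R)" "b \<in> L \<inter> R"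
        by (simp_all add: generate_topology_on.Int generate_topology_on.Basis)
      then show ?thesis using \<open>L \<inter> R \<subseteq> U\<close> by blast
    qed
    then obtain V where V: "\<And>b. b \<in> U \<Longrightarrow> generate_topology_on ?S (V b) \<and> b \<in> V b \<and> V b \<subseteq> U"
      by metis
    then have "U = \<Union>(V ` U)" by blast
    moreover have "generate_topology_on ?S (\<Union>(V ` U))"
      using V by (intro generate_topology_on.UN) auto
    ultimately show ?thesis by simp
  qed
  moreover have "open U" if "generate_topology_on ?S U" for U
    using that by induction (auto intro: open_lessThan open_greaterThan)
  ultimately show ?thesis
    unfolding gen topology_eq openin_topology_generated_by_iff by auto
qed

lemma connected_UNIV: "connected (UNIV :: 'k set)"
proof (rule ccontr)
  assume "\<not> connected (UNIV :: 'k set)"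
  then obtain A B :: "'k set" where AB: "open A" "open B" "UNIV \<subseteq> A \<union> B" "A \<inter> B \<inter> UNIV = {}"
      "A \<inter> UNIV \<noteq> {}" "B \<inter> UNIV \<noteq> {}"
    unfolding connected_def by blast
  have less: False if AB: "open A" "open B" "UNIV \<subseteq> A \<union> B" "A \<inter> B = {}" "a \<in> A" "b \<in> B" "a < b"
    for A B and a b :: 'k
  proof -
    have "A = - B" using AB by blast
    then have "closed (A \<inter> {..b})"
      using \<open>open B\<close> closed_atMost by (simp add: closed_Int closed_Compl)
    moreover have "a \<in> A \<inter> {..b}" using AB by auto
    ultimately obtain s where s: "s \<in> A" "s \<le> b" "\<forall>x\<in>A \<inter> {..b}. x \<le> s"
      using closed_has_greatest[of "A \<inter> {..b}"] by blast
    have "s \<noteq> b" using AB s(1) by blast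
    then have "s < b" using s(2) by simp
    then obtain c where c: "s < c" "{s..<c} \<subseteq> A"
      using right_neighbourhood[OF AB(1) s(1)] by blast
    obtain z where z: "s < z" "z < min c b"
      using between[of s "min c b"] c \<open>s < b\<close> by auto
    then have "z \<in> A \<inter> {..b}" using c(2) by auto
    then show False using s(3) z(1) by (meson leD)
  qed
  obtain a b where ab: "a \<in> A" "b \<in> B" using AB by blast
  have "a \<noteq> b" using AB ab by blast
  then consider "a < b" | "b < a" by (rule linorder_neqE)
  then show False
  proof cases
    case 1 then show ?thesis using less[of A B a b] AB ab by simp
  next
    case 2 then show ?thesis using less[of B A b a] AB ab by (simp add: Un_commute Int_commute)
  qed
qed

lemma Hausdorff_space_euclidean: "Hausdorff_space (euclidean :: 'k topology)"
proof -
  have *: "\<exists>U V. open U \<and> open V \<and> x \<in> U \<and> y \<in> V \<and> U \<inter> V = {}" if lt: "x < y" for x y :: 'k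
  proof -
    obtain z where "x < z" "z < y" using between[OF lt] by blast
    then show ?thesis using open_lessThan open_greaterThan
      by (intro exI[of _ "{..<z}"] exI[of _ "{z<..}"]) auto
  qed
  have "\<exists>U V. open U \<and> open V \<and> x \<in> U \<and> y \<in> V \<and> U \<inter> V = {}" if ne: "x \<noteq> y" for x y :: 'k
  proof -
    consider "x < y" | "y < x" using ne by (rule linorder_neqE)
    then show ?thesis
    proof cases
      case 1 then show ?thesis by (rule *)
    next
      case 2
      from *[OF this] obtain U V where "open U \<and> open V \<and> y \<in> U \<and> x \<in> V \<and> U \<inter> V = {}"
        by (elim exE)
      then show ?thesis by (intro exI[of _ V] exI[of _ U]) (simp add: Int_commute)
    qed
  qed
  then show ?thesis
    unfolding Hausdorff_space_def disjnt_def by simp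
qed

lemma compact_imp_closed: "compact C \<Longrightarrow> closed (C :: 'k set)"
  using compactin_imp_closedin[OF Hausdorff_space_euclidean] by auto

lemma normal_space_euclidean: "normal_space (euclidean :: 'k topology)"
  using Hausdorff_space_euclidean compact_UNIV
  by (intro compact_Hausdorff_or_regular_imp_normal_space) (auto simp: compact_space_def)

lemma bcontfun_of_continuous:
  assumes "continuous_on (UNIV :: 'k set) f"
  shows "(f :: 'k \<Rightarrow> real) \<in> bcontfun"
  using compact_continuous_image[OF assms compact_UNIV]
  by (simp add: bcontfun_def assms compact_imp_bounded)

text \<open>Urysohn functions; they need not be monotone, only the values outside the interval matter.\<close>

lemma ramp_exists:
  assumes "u < v"
  shows "\<exists>\<rho> :: 'k \<Rightarrow>\<^sub>C real. (\<forall>x. 0 \<le> \<rho> x \<and> \<rho> x \<le> 1) \<and> (\<forall>x\<le>u. \<rho> x = 0) \<and> (\<forall>x\<ge>v. \<rho> x = 1)"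
proof -
  have "disjnt {..u} {v..}" using assms by (auto simp: disjnt_def)
  moreover have "closedin euclidean {..u}" "closedin euclidean {v..}"
    using closed_atMost closed_atLeast by auto
  ultimately obtain f where f: "continuous_map euclidean (top_of_set {0..1::real}) f"
      "f ` {..u} \<subseteq> {0}" "f ` {v..} \<subseteq> {1}"
    using Urysohn_lemma[OF normal_space_euclidean, of "{..u}" "{v..}" 0 1] by auto
  then have c: "continuous_on UNIV f" "range f \<subseteq> {0..1}"
    by (auto simp: continuous_map_in_subtopology)
  then have "apply_bcontfun (Bcontfun f) = f" using bcontfun_of_continuous Bcontfun_inverse by blast
  then show ?thesis using f(2,3) c(2) by (intro exI[of _ "Bcontfun f"]) (auto simp: image_subset_iff)
qed

definition ramp :: "'k \<Rightarrow> 'k \<Rightarrow> 'k \<Rightarrow>\<^sub>C real" where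
  "ramp u v = (SOME \<rho> :: 'k \<Rightarrow>\<^sub>C real. (\<forall>x. 0 \<le> \<rho> x \<and> \<rho> x \<le> 1) \<and> (\<forall>x\<le>u. \<rho> x = 0) \<and> (\<forall>x\<ge>v. \<rho> x = 1))"

lemma ramp:
  assumes "u < v"
  shows "0 \<le> ramp u v x" "ramp u v x \<le> 1" "x \<le> u \<Longrightarrow> ramp u v x = 0" "v \<le> x \<Longrightarrow> ramp u v x = 1"
  using someI_ex[OF ramp_exists[OF assms], folded ramp_def] by auto

text \<open>The function is constant on each interval whose interior misses a suitable countable set: two points
  with different values are separated by a third one, and countably many of these suffice by
  compactness.\<close>

lemma countable_set_determining_function:
  fixes h :: "'k \<Rightarrow>\<^sub>C real"
  shows "\<exists>N. countable N \<and> (\<forall>x y. x < y \<longrightarrow> h x \<noteq> h y \<longrightarrow> (\<exists>n\<in>N. x < n \<and> n < y))"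
proof -
  define W where "W n = {..<n} \<times> {n<..} \<union> {n<..} \<times> {..<n}" for n :: 'k
  have "\<exists>B\<subseteq>UNIV. countable B \<and> (\<forall>x y. h x \<noteq> h y \<longrightarrow> (\<exists>n\<in>B. (x, y) \<in> W n))"
  proof (rule countably_many_separators[OF compact_UNIV])
    show "open (W i)" for i unfolding W_def by (intro open_Un open_Times open_lessThan open_greaterThan)
    show "\<exists>i\<in>UNIV. (x, y) \<in> W i" if "h x \<noteq> h y" for x y
    proof -
      have "x \<noteq> y" using that by blast
      then obtain n where "x < n \<and> n < y \<or> y < n \<and> n < x"
        using between[of x y] between[of y x] by (metis linorder_neqE)
      then show ?thesis by (intro bexI[of _ n]) (auto simp: W_def)
    qed
  qed simp
  then obtain B where B: "countable B" "\<forall>x y. h x \<noteq> h y \<longrightarrow> (\<exists>n\<in>B. (x, y) \<in> W n)"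
    by (elim exE conjE)
  have "\<exists>n\<in>B. x < n \<and> n < y" if xy: "x < y" "h x \<noteq> h y" for x y
  proof -
    obtain n where n: "n \<in> B" "(x, y) \<in> W n" using B(2) xy(2) by metis
    then have "x < n \<and> n < y \<or> n < x \<and> y < n" by (simp add: W_def)
    then show ?thesis using n(1) xy(1) by (meson less_asym less_trans)
  qed
  then show ?thesis using B(1) by (intro exI[of _ B]) simp
qed

text \<open>Each point of \<open>S\<close> is followed by an interval up to its successor in \<open>S\<close>. These intervals are
  disjoint, and a countable set meeting all intervals picks a point from each of them.\<close>

lemma countable_if_well_ordered:
  fixes S :: "'k set"
  assumes S: "S \<subseteq> {u<..<v}"
    and least: "\<And>R. R \<subseteq> S \<Longrightarrow> R \<noteq> {} \<Longrightarrow> \<exists>m\<in>R. \<forall>x\<in>R. m \<le> x"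
    and N: "countable N" "\<And>x y. u < x \<Longrightarrow> x < y \<Longrightarrow> y < v \<Longrightarrow> {x<..<y} \<inter> N \<noteq> {}"
  shows "countable S"
proof -
  have "\<exists>n. n \<in> N \<and> s < n \<and> (\<forall>t\<in>S. s < t \<longrightarrow> n < t)" if s: "s \<in> S" for s
  proof -
    have us: "u < s" "s < v" using s S by auto
    have "\<exists>y>s. y \<le> v \<and> (\<forall>t\<in>S. s < t \<longrightarrow> y \<le> t)"
    proof (cases "{t \<in> S. s < t} = {}")
      case True
      then show ?thesis using us by (intro exI[of _ v]) auto
    next
      case False
      then obtain m where "m \<in> {t \<in> S. s < t}" "\<forall>x\<in>{t \<in> S. s < t}. m \<le> x"
        using least[of "{t \<in> S. s < t}"] by auto
      then show ?thesis using S by (intro exI[of _ m]) (auto simp: subset_iff less_imp_le)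
    qed
    then obtain y where y: "s < y" "y \<le> v" "\<forall>t\<in>S. s < t \<longrightarrow> y \<le> t" by blast
    obtain y' where y': "s < y'" "y' < y" using between[OF y(1)] by blast
    have "y' < v" using y'(2) y(2) by (rule less_le_trans)
    then have "{s<..<y'} \<inter> N \<noteq> {}" by (rule N(2)[OF us(1) y'(1)])
    then obtain n where n: "n \<in> N" "s < n" "n < y'" by auto
    have "n < y" using n(3) y'(2) by (rule less_trans)
    then show ?thesis using n y(3) by (intro exI[of _ n]) (auto intro: less_le_trans)
  qed
  then obtain h where h: "\<And>s. s \<in> S \<Longrightarrow> h s \<in> N \<and> s < h s \<and> (\<forall>t\<in>S. s < t \<longrightarrow> h s < t)"
    by metis
  have "inj_on h S"
  proof (rule inj_onI)
    fix s t assume st: "s \<in> S" "t \<in> S" "h s = h t"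
    show "s = t"
    proof (rule ccontr)
      assume "s \<noteq> t"
      then consider "s < t" | "t < s" by (metis linorder_neqE)
      then show False
      proof cases
        case 1 then have "h s < h t" using h[OF st(1)] h[OF st(2)] st(2) by (meson less_trans)
        then show False using st(3) by simp
      next
        case 2 then have "h t < h s" using h[OF st(1)] h[OF st(2)] st(1) by (meson less_trans)
        then show False using st(3) by simp
      qed
    qed
  qed
  moreover have "h ` S \<subseteq> N" using h by blast
  ultimately show ?thesis using N(1) by (meson countable_image_inj_on countable_subset)
qed

end

section \<open>Norm-one projections by interpolation over gaps\<close>

lemma convex_combination_close:
  fixes a b c e t :: real
  assumes "0 \<le> t" "t \<le> 1" "\<bar>a - c\<bar> < e" "\<bar>b - c\<bar> < e"
  shows "\<bar>(1 - t) * a + t * b - c\<bar> < e"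
proof -
  have "(1 - t) *\<^sub>R a + t *\<^sub>R b \<in> ball c e"
    using assms by (intro convexD_alt[OF convex_ball]) (auto simp: dist_real_def)
  then show ?thesis by (simp add: dist_real_def abs_minus_commute)
qed

lemma convex_combination_bounded:
  fixes a b M t :: real
  assumes "0 \<le> t" "t \<le> 1" "\<bar>a\<bar> \<le> M" "\<bar>b\<bar> \<le> M"
  shows "\<bar>(1 - t) * a + t * b\<bar> \<le> M"
proof -
  have "(1 - t) *\<^sub>R a + t *\<^sub>R b \<in> cball 0 M"
    using assms by (intro convexD_alt[OF convex_cball]) auto
  then show ?thesis by simp
qed

context order_continuum
begin

text \<open>The two sides of a point are examined separately because a point of a closed set may border a gap
  on one side and be a limit of the set on the other.\<close>

lemma continuous_if_one_sided:
  fixes g :: "'k \<Rightarrow> real"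
  assumes right: "\<And>x v e. x < v \<Longrightarrow> 0 < e \<Longrightarrow> \<exists>c>x. \<forall>z. x \<le> z \<longrightarrow> z < c \<longrightarrow> \<bar>g z - g x\<bar> < e"
    and left: "\<And>x u e. u < x \<Longrightarrow> 0 < e \<Longrightarrow> \<exists>c<x. \<forall>z. c < z \<longrightarrow> z \<le> x \<longrightarrow> \<bar>g z - g x\<bar> < e"
  shows "continuous_on UNIV g"
  unfolding continuous_on_def
proof
  fix x
  show "(g \<longlongrightarrow> g x) (at x)"
  proof (rule tendstoI)
    fix e :: real assume e: "0 < e"
    have "\<exists>R. open R \<and> x \<in> R \<and> (\<forall>z\<in>R. x \<le> z \<longrightarrow> \<bar>g z - g x\<bar> < e)"
    proof (cases "\<exists>v. x < v")
      case True
      then obtain c where "x < c" "\<forall>z. x \<le> z \<longrightarrow> z < c \<longrightarrow> \<bar>g z - g x\<bar> < e" using right e by blast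
      then show ?thesis by (intro exI[of _ "{..<c}"]) (auto simp: open_lessThan)
    next
      case False
      then have "\<bar>g z - g x\<bar> < e" if "x \<le> z" for z using that e by (cases "x = z") (auto simp: le_less)
      then show ?thesis by (intro exI[of _ UNIV]) auto
    qed
    moreover have "\<exists>L. open L \<and> x \<in> L \<and> (\<forall>z\<in>L. z \<le> x \<longrightarrow> \<bar>g z - g x\<bar> < e)"
    proof (cases "\<exists>u. u < x")
      case True
      then obtain c where "c < x" "\<forall>z. c < z \<longrightarrow> z \<le> x \<longrightarrow> \<bar>g z - g x\<bar> < e" using left e by blast
      then show ?thesis by (intro exI[of _ "{c<..}"]) (auto simp: open_greaterThan)
    next
      case False
      then have "\<bar>g z - g x\<bar> < e" if "z \<le> x" for z using that e by (cases "x = z") (auto simp: le_less)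
      then show ?thesis by (intro exI[of _ UNIV]) auto
    qed
    ultimately obtain L R where LR: "open L" "open R" "x \<in> L" "x \<in> R"
      "\<And>z. z \<in> R \<Longrightarrow> x \<le> z \<Longrightarrow> \<bar>g z - g x\<bar> < e" "\<And>z. z \<in> L \<Longrightarrow> z \<le> x \<Longrightarrow> \<bar>g z - g x\<bar> < e"
      by auto
    have "\<bar>g z - g x\<bar> < e" if "z \<in> L \<inter> R" for z
      using LR(5,6)[of z] that linear[of x z] by blast
    then show "\<forall>\<^sub>F z in at x. dist (g z) (g x) < e"
      unfolding eventually_at_topological dist_real_def using LR(1-4)
      by (intro exI[of _ "L \<inter> R"]) auto
  qed
qed

text \<open>A function on \<open>F\<close> is extended over a gap of \<open>F\<close> by the convex combination of its values at the two
  ends whose weight is the ramp across the gap. The assumptions on the position of \<open>F\<close>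
  say that it contains the end points of the line, so every point outside \<open>F\<close> lies in a
  gap with two ends. Convexity gives the bound, and functions that are constant on all gaps are
  reproduced.\<close>

lemma extension_operator:
  fixes F :: "'k set"
  assumes F: "closed F" and below: "\<And>x. \<exists>p\<in>F. p \<le> x" and above: "\<And>x. \<exists>p\<in>F. x \<le> p"
  shows "\<exists>P :: ('k \<Rightarrow>\<^sub>C real) \<Rightarrow> ('k \<Rightarrow>\<^sub>C real). bounded_linear P \<and> (\<forall>f. \<forall>x\<in>F. apply_bcontfun (P f) x = apply_bcontfun f x) \<and>
    (\<forall>f M. (\<forall>x\<in>F. \<bar>apply_bcontfun f x\<bar> \<le> M) \<longrightarrow> (\<forall>x. \<bar>apply_bcontfun (P f) x\<bar> \<le> M)) \<and>
    (\<forall>f. (\<forall>x y. x < y \<longrightarrow> {x<..<y} \<inter> F = {} \<longrightarrow> apply_bcontfun f x = f y) \<longrightarrow> P f = f)"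
proof -
  have "\<exists>p\<in>F \<inter> {..x}. \<forall>q\<in>F \<inter> {..x}. q \<le> p" for x
    using below[of x] F closed_atMost by (intro closed_has_greatest) (auto intro: closed_Int)
  then have "\<forall>x. \<exists>p. p \<in> F \<and> p \<le> x \<and> (\<forall>q\<in>F. q \<le> x \<longrightarrow> q \<le> p)" by (metis Int_iff atMost_iff)
  from choice[OF this] obtain lo where lo: "\<And>x. lo x \<in> F" "\<And>x. lo x \<le> x"
      "\<And>x q. q \<in> F \<Longrightarrow> q \<le> x \<Longrightarrow> q \<le> lo x" by blast
  have "\<exists>p\<in>F \<inter> {x..}. \<forall>q\<in>F \<inter> {x..}. p \<le> q" for x
    using above[of x] F closed_atLeast by (intro closed_has_least) (auto intro: closed_Int)
  then have "\<forall>x. \<exists>p. p \<in> F \<and> x \<le> p \<and> (\<forall>q\<in>F. x \<le> q \<longrightarrow> p \<le> q)" by (metis Int_iff atLeast_iff)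
  from choice[OF this] obtain up where up: "\<And>x. up x \<in> F" "\<And>x. x \<le> up x"
      "\<And>x q. q \<in> F \<Longrightarrow> x \<le> q \<Longrightarrow> up x \<le> q" by blast
  have lo_eq: "lo x = p" if "p \<in> F" "p \<le> x" "\<And>q. q \<in> F \<Longrightarrow> q \<le> x \<Longrightarrow> q \<le> p" for x p
    using that lo by (meson order.antisym)
  have up_eq: "up x = p" if "p \<in> F" "x \<le> p" "\<And>q. q \<in> F \<Longrightarrow> x \<le> q \<Longrightarrow> p \<le> q" for x p
    using that up by (meson order.antisym)
  have lo_F: "lo x = x" and up_F: "up x = x" if "x \<in> F" for x
    using that by (auto intro: lo_eq up_eq)
  define wt where "wt x = (if lo x < up x then ramp (lo x) (up x) x else 0)" for x
  have wt: "0 \<le> wt x" "wt x \<le> 1" for x by (auto simp: wt_def ramp)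
  define E where "E f x = (1 - wt x) * apply_bcontfun f (lo x) + wt x * apply_bcontfun f (up x)" for f x
  have E_F: "E f x = f x" if "x \<in> F" for f x
    using lo_F[OF that] up_F[OF that] by (simp add: E_def algebra_simps)
  have E_bound: "\<bar>E f x\<bar> \<le> M" if "\<forall>x\<in>F. \<bar>apply_bcontfun f x\<bar> \<le> M" for f x M
    unfolding E_def using wt lo(1) up(1) that by (intro convex_combination_bounded) auto
  define H where "H f l u z = (1 - ramp l u z) * apply_bcontfun f l + ramp l u z * apply_bcontfun f u"
    for f :: "'k \<Rightarrow>\<^sub>C real" and l u z
  have E_H: "E f z = H f l u z" if "lo z = l" "up z = u" "l < u" for f l u z
    using that by (simp add: E_def H_def wt_def)
  have H_open: "open {z. \<bar>H f l u z - c\<bar> < e}" for f l u c e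
    unfolding H_def by (intro open_Collect_less continuous_intros continuous_on_apply_bcontfun)
  have f_open: "open {z. \<bar>apply_bcontfun f z - c\<bar> < e}" for f :: "'k \<Rightarrow>\<^sub>C real" and c e
    by (intro open_Collect_less continuous_intros continuous_on_apply_bcontfun)
  have "continuous_on UNIV (E f)" for f
  proof (rule continuous_if_one_sided)
    fix x v :: 'k and e :: real assume xv: "x < v" and e: "0 < e"
    show "\<exists>c>x. \<forall>z. x \<le> z \<longrightarrow> z < c \<longrightarrow> \<bar>E f z - E f x\<bar> < e"
    proof (cases "\<exists>d>x. {x<..<d} \<inter> F = {}")
      \<comment> \<open>Immediately to the right of \<open>x\<close> there is a gap, on which the extension is the continuous
        function \<open>H f l u\<close>.\<close>
      case True
      then obtain d where d: "x < d" "{x<..<d} \<inter> F = {}" by blast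
      define l u where "l = lo x" and "u = up d"
      have lu: "l < u" using lo(2)[of x] up(2)[of d] d(1) by (simp add: l_def u_def)
      have E_eq: "E f z = H f l u z" if z: "x \<le> z" "z < d" for z
      proof (cases "z = x \<and> x \<in> F")
        case True
        then have "l = x" by (simp add: l_def lo_F)
        then show ?thesis using True E_F[of x f] ramp(3)[OF lu, of x] by (simp add: H_def)
      next
        case False
        have gap: "q \<le> x \<or> d \<le> q" if "q \<in> F" for q
        proof (rule ccontr)
          assume "\<not> ?thesis"
          then have "q \<in> {x<..<d} \<inter> F" using that by auto
          then show False using d(2) by blast
        qed
        have "lo z = l"
        proof (rule lo_eq)
          show "l \<in> F" "l \<le> z" using lo(1,2)[of x] z by (auto simp: l_def)
          show "q \<le> l" if "q \<in> F" "q \<le> z" for q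
            using gap[OF that(1)] that z lo(3)[of q x] by (auto simp: l_def)
        qed
        moreover have "up z = u"
        proof (rule up_eq)
          show "u \<in> F" "z \<le> u" using up(1,2)[of d] z by (auto simp: u_def)
          show "u \<le> q" if q: "q \<in> F" "z \<le> q" for q
          proof -
            have "d \<le> q"
            proof (rule ccontr)
              assume "\<not> d \<le> q"
              then have "q \<le> x" using gap[OF q(1)] by simp
              then have "q = x" "z = x" using q z by auto
              then show False using False q by simp
            qed
            then show ?thesis using up(3)[OF q(1), of d] by (simp add: u_def)
          qed
        qed
        ultimately show ?thesis using E_H lu by simp
      qed
      obtain c where c: "x < c" "{x..<c} \<subseteq> {z. \<bar>H f l u z - H f l u x\<bar> < e}"
        using right_neighbourhood[OF H_open, where b = x] xv e by force
      have "\<bar>E f z - E f x\<bar> < e" if "x \<le> z" "z < min c d" for z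
        using c(2) E_eq[of z] E_eq[of x] that d(1) by auto
      then show ?thesis using c(1) d(1) by (intro exI[of _ "min c d"]) auto
    next
      \<comment> \<open>Points of \<open>F\<close> accumulate at \<open>x\<close> from the right, so the ends of the gaps near \<open>x\<close> are near \<open>x\<close>.\<close>
      case False
      have "x \<in> F"
      proof (rule ccontr)
        assume "x \<notin> F"
        then obtain c where c: "x < c" "{x..<c} \<subseteq> - F"
          using right_neighbourhood[of "- F" x v] F xv by (auto simp: open_Compl)
        then have "{x<..<c} \<inter> F = {}" by (auto simp: subset_iff less_imp_le)
        then show False using False c(1) by blast
      qed
      obtain c where c: "x < c" "{x..<c} \<subseteq> {z. \<bar>f z - f x\<bar> < e}"
        using right_neighbourhood[OF f_open, where b = x] xv e by force
      obtain p where p: "p \<in> F" "x < p" "p < c" using False c(1) by fastforce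
      have "\<bar>E f z - E f x\<bar> < e" if z: "x \<le> z" "z < p" for z
      proof -
        have "x \<le> lo z" "lo z < c" using lo(2)[of z] lo(3)[OF \<open>x \<in> F\<close>, of z] z p by (auto intro: le_less_trans)
        moreover have "x \<le> up z" "up z < c"
          using up(2)[of z] up(3)[OF p(1) less_imp_le[OF z(2)]] z p by (auto intro: le_less_trans)
        ultimately show ?thesis
          using c(2) unfolding E_F[OF \<open>x \<in> F\<close>] unfolding E_def
          by (intro convex_combination_close wt) auto
      qed
      then show ?thesis using p(2) by blast
    qed
  next
    fix x v :: 'k and e :: real assume xv: "v < x" and e: "0 < e"
    show "\<exists>c<x. \<forall>z. c < z \<longrightarrow> z \<le> x \<longrightarrow> \<bar>E f z - E f x\<bar> < e"
    proof (cases "\<exists>d<x. {d<..<x} \<inter> F = {}")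
      case True
      then obtain d where d: "d < x" "{d<..<x} \<inter> F = {}" by blast
      define l u where "l = lo d" and "u = up x"
      have lu: "l < u" using lo(2)[of d] up(2)[of x] d(1) by (simp add: l_def u_def)
      have E_eq: "E f z = H f l u z" if z: "d < z" "z \<le> x" for z
      proof (cases "z = x \<and> x \<in> F")
        case True
        then have "u = x" by (simp add: u_def up_F)
        then show ?thesis using True E_F[of x f] ramp(4)[OF lu, of x] by (simp add: H_def)
      next
        case False
        have gap: "q \<le> d \<or> x \<le> q" if "q \<in> F" for q
        proof (rule ccontr)
          assume "\<not> ?thesis"
          then have "q \<in> {d<..<x} \<inter> F" using that by auto
          then show False using d(2) by blast
        qed
        have "up z = u"
        proof (rule up_eq)
          show "u \<in> F" "z \<le> u" using up(1,2)[of x] z by (auto simp: u_def)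
          show "u \<le> q" if "q \<in> F" "z \<le> q" for q
            using gap[OF that(1)] that z up(3)[of q x] by (auto simp: u_def)
        qed
        moreover have "lo z = l"
        proof (rule lo_eq)
          show "l \<in> F" "l \<le> z" using lo(1,2)[of d] z by (auto simp: l_def)
          show "q \<le> l" if q: "q \<in> F" "q \<le> z" for q
          proof -
            have "q \<le> d"
            proof (rule ccontr)
              assume "\<not> q \<le> d"
              then have "x \<le> q" using gap[OF q(1)] by simp
              then have "q = x" "z = x" using q z by auto
              then show False using False q by simp
            qed
            then show ?thesis using lo(3)[OF q(1), of d] by (simp add: l_def)
          qed
        qed
        ultimately show ?thesis using E_H lu by simp
      qed
      obtain c where c: "c < x" "{c<..x} \<subseteq> {z. \<bar>H f l u z - H f l u x\<bar> < e}"
        using left_neighbourhood[OF H_open, where b = x] xv e by force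
      have "\<bar>E f z - E f x\<bar> < e" if "max c d < z" "z \<le> x" for z
        using c(2) E_eq[of z] E_eq[of x] that d(1) by auto
      then show ?thesis using c(1) d(1) by (intro exI[of _ "max c d"]) auto
    next
      case False
      have "x \<in> F"
      proof (rule ccontr)
        assume "x \<notin> F"
        then obtain c where c: "c < x" "{c<..x} \<subseteq> - F"
          using left_neighbourhood[of "- F" x v] F xv by (auto simp: open_Compl)
        then have "{c<..<x} \<inter> F = {}" by (auto simp: subset_iff less_imp_le)
        then show False using False c(1) by blast
      qed
      obtain c where c: "c < x" "{c<..x} \<subseteq> {z. \<bar>f z - f x\<bar> < e}"
        using left_neighbourhood[OF f_open, where b = x] xv e by force
      obtain p where p: "p \<in> F" "c < p" "p < x" using False c(1) by fastforce
      have "\<bar>E f z - E f x\<bar> < e" if z: "p < z" "z \<le> x" for z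
      proof -
        have "c < lo z" "lo z \<le> x"
          using lo(2)[of z] lo(3)[OF p(1) less_imp_le[OF z(1)]] z p by (auto intro: less_le_trans)
        moreover have "c < up z" "up z \<le> x"
          using up(2)[of z] up(3)[OF \<open>x \<in> F\<close>, of z] z p by (auto intro: less_le_trans)
        ultimately show ?thesis
          using c(2) unfolding E_F[OF \<open>x \<in> F\<close>] unfolding E_def
          by (intro convex_combination_close wt) auto
      qed
      then show ?thesis using p(3) by blast
    qed
  qed
  then have "E f \<in> bcontfun" for f by (rule bcontfun_of_continuous)
  then have P: "apply_bcontfun (Bcontfun (E f)) = E f" for f by (rule Bcontfun_inverse)
  define P where "P f = Bcontfun (E f)" for f
  have P_E: "P f x = E f x" for f x by (simp add: P_def P)
  have "bounded_linear P"
  proof (rule bounded_linear_intro[of _ 1])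
    show "P (f + g) = P f + P g" for f g by (rule bcontfun_eqI) (simp add: P_E E_def algebra_simps)
    show "P (r *\<^sub>R f) = r *\<^sub>R P f" for r f by (rule bcontfun_eqI) (simp add: P_E E_def algebra_simps)
    have "\<bar>P f x\<bar> \<le> norm f" for f x
      unfolding P_E using norm_bounded[of f] by (intro E_bound) auto
    then show "norm (P f) \<le> norm f * 1" for f by (simp add: norm_bound)
  qed
  moreover have "P f = f" if const: "\<forall>x y. x < y \<longrightarrow> {x<..<y} \<inter> F = {} \<longrightarrow> apply_bcontfun f x = f y" for f
  proof (rule bcontfun_eqI)
    fix x
    have gap: "{lo x<..<up x} \<inter> F = {}" using lo(3)[of _ x] up(3)[of _ x] by (auto, meson leD linear)
    have "f (lo x) = f x"
    proof (cases "lo x = x")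
      case False
      have "{lo x<..<x} \<subseteq> {lo x<..<up x}" by (auto intro: less_le_trans[OF _ up(2)])
      then have "{lo x<..<x} \<inter> F = {}" using gap by blast
      then show ?thesis using const False lo(2)[of x] by (meson order.not_eq_order_implies_strict)
    qed simp
    moreover have "f (up x) = f x"
    proof (cases "up x = x")
      case False
      have "{x<..<up x} \<subseteq> {lo x<..<up x}" by (auto intro: le_less_trans[OF lo(2)])
      then have "{x<..<up x} \<inter> F = {}" using gap by blast
      then show ?thesis using const False up(2)[of x] by (metis order.not_eq_order_implies_strict)
    qed simp
    ultimately show "P f x = f x" by (simp add: P_E E_def algebra_simps)
  qed
  ultimately show ?thesis using E_F E_bound
    by (intro exI[of _ P]) (simp add: P_E)
qed

text \<open>The range of the interpolation operator is the required space: it contains \<open>S\<close> as the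
  functions in a dense subset are constant on the gaps of \<open>F\<close>, and it is separable as its members
  attain their norms on \<open>F\<close> and are described there by the countable family \<open>\<A>\<close>.\<close>

lemma complemented_overspace:
  fixes S :: "('k \<Rightarrow>\<^sub>C real) set"
  assumes F: "closed F" "\<And>x. \<exists>p\<in>F. p \<le> x" "\<And>x. \<exists>p\<in>F. x \<le> (p::'k)"
    and \<A>: "countable \<A>"
    and fine: "\<And>(g :: 'k \<Rightarrow>\<^sub>C real) e. 0 < e \<Longrightarrow> \<exists>\<V>\<subseteq>\<A>. finite \<V> \<and> F \<subseteq> \<Union>\<V> \<and>
          (\<forall>A\<in>\<V>. \<forall>x\<in>A \<inter> F. \<forall>y\<in>A \<inter> F. \<bar>g x - g y\<bar> < e)"
    and S: "S \<subseteq> closure D"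
    and const: "\<And>f x y. f \<in> D \<Longrightarrow> x < y \<Longrightarrow> {x<..<y} \<inter> F = {} \<Longrightarrow> apply_bcontfun f x = f y"
  shows "\<exists>G. S \<subseteq> G \<and> separable_set G \<and> k_complemented 1 G"
proof -
  obtain P :: "('k \<Rightarrow>\<^sub>C real) \<Rightarrow> ('k \<Rightarrow>\<^sub>C real)" where P: "bounded_linear P"
    and P_F: "\<forall>f. \<forall>x\<in>F. apply_bcontfun (P f) x = f x"
    and P_bound: "\<forall>f M. (\<forall>x\<in>F. \<bar>apply_bcontfun f x\<bar> \<le> M) \<longrightarrow> (\<forall>x. \<bar>apply_bcontfun (P f) x\<bar> \<le> M)"
    and P_const: "\<forall>f. (\<forall>x y. x < y \<longrightarrow> {x<..<y} \<inter> F = {} \<longrightarrow> apply_bcontfun f x = f y) \<longrightarrow> P f = f"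
    using extension_operator[OF F] by (elim exE conjE)
  interpret P: bounded_linear P by (rule P)
  have P_norm: "norm (P f) \<le> M" if "\<And>x. x \<in> F \<Longrightarrow> \<bar>apply_bcontfun f x\<bar> \<le> M" for f M
    using P_bound that by (intro norm_bound) auto
  have PP: "P (P f) = P f" for f
  proof -
    have "norm (P (P f - f)) \<le> 0" using P_F by (intro P_norm) simp
    then show ?thesis by (simp add: P.diff)
  qed
  have "onorm P \<le> 1"
  proof (rule onorm_bound)
    show "norm (P f) \<le> 1 * norm f" for f
      using norm_bounded[of f] by (intro P_norm) simp
  qed simp
  then have "k_complemented 1 (range P)"
    unfolding k_complemented_def projection_def using P PP by (intro exI[of _ P]) (auto simp: fun_eq_iff)
  moreover have "separable_set (range P)"
  proof (rule separable_set_if_finitely_described[OF \<A> fine])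
    show "norm (g - h) \<le> M" if gh: "g \<in> range P" "h \<in> range P"
        "\<And>x. x \<in> F \<Longrightarrow> \<bar>apply_bcontfun g x - h x\<bar> \<le> M" for g h M
    proof -
      have "P (g - h) = g - h" using gh(1,2) PP by (auto simp: P.diff)
      then show ?thesis using P_norm[of "g - h" M] gh(3) by simp
    qed
  qed
  moreover have "S \<subseteq> range P"
  proof
    fix f assume "f \<in> S"
    then have "f \<in> closure D" using S by blast
    have "apply_bcontfun f x = f y" if xy: "x < y" "{x<..<y} \<inter> F = {}" for x y
    proof -
      have "D \<subseteq> {f. apply_bcontfun f x = f y}" using const xy by blast
      then have "closure D \<subseteq> {f. apply_bcontfun f x = f y}" using closed_agreement by (rule closure_minimal)
      then show ?thesis using \<open>f \<in> closure D\<close> by blast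
    qed
    then have "P f = f" using P_const by blast
    then show "f \<in> range P" by (metis rangeI)
  qed
  ultimately show ?thesis by blast
qed

end

section \<open>Uncomplemented spaces of functions without jumps\<close>

context order_continuum
begin

text \<open>The pairs in \<open>Q\<close> are the end points of intervals collapsed by \<open>C\<close>. With \<open>R = I - P\<close>, which vanishes
  on \<open>C\<close>, the image under \<open>R\<close> of a ramp across such an interval still increases by one there, so it is
  at least \<open>1/2\<close> at the right end or at most \<open>-1/2\<close> at the left end, and keeps this sign
  with modulus above \<open>1/4\<close> on an interval adjacent to that end. Subtracting from the ramp a second
  ramp that belongs to \<open>C\<close> does not change its image, but gives it support in a prescribed
  neighbourhood. Adding such
  differences with suitable signs, each inside the interval obtained from the previous step on which
  the earlier summands vanish, keeps the norm at most one, while the image is at least \<open>n/4\<close> somewhere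
  after \<open>n\<close> steps.\<close>

lemma no_projection_onto_functions_without_jumps:
  fixes C :: "('k \<Rightarrow>\<^sub>C real) set" and Q :: "('k \<times> 'k) set"
  assumes P: "bounded_linear P" "\<And>f. P f \<in> C" "\<And>f. f \<in> C \<Longrightarrow> P f = f"
    and Q_less: "\<And>a b. (a, b) \<in> Q \<Longrightarrow> a < b"
    and no_jump: "\<And>h a b. h \<in> C \<Longrightarrow> (a, b) \<in> Q \<Longrightarrow> apply_bcontfun h a = h b"
    and ramps: "\<And>a b c. (a, b) \<in> Q \<Longrightarrow> b < c \<Longrightarrow>
          \<exists>\<psi>\<in>C. (\<forall>x. 0 \<le> \<psi> x \<and> \<psi> x \<le> 1) \<and> (\<forall>x\<le>b. \<psi> x = 0) \<and> (\<forall>x\<ge>c. \<psi> x = 1)"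
    and right: "\<And>a b c. (a, b) \<in> Q \<Longrightarrow> b < c \<Longrightarrow> \<exists>a' b'. (a', b') \<in> Q \<and> b < a' \<and> b' < c"
    and left: "\<And>a b c. (a, b) \<in> Q \<Longrightarrow> c < a \<Longrightarrow> \<exists>a' b'. (a', b') \<in> Q \<and> c < a' \<and> b' < a"
    and start: "(a0, b0) \<in> Q" "u0 < a0" "b0 < v0"
  shows False
proof -
  interpret P: bounded_linear P by (rule P(1))
  define R where "R f = f - P f" for f
  have R_diff: "R (f - g) = R f - R g" and R_add: "R (f + g) = R f + R g" for f g
    by (simp_all add: R_def P.diff P.add)
  have R_C: "R f = 0" if "f \<in> C" for f by (simp add: R_def P(3) that)
  obtain B where B: "\<And>f. norm (P f) \<le> norm f * B" using P.bounded by auto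
  have R_bound: "\<bar>R g x\<bar> \<le> 1 + \<bar>B\<bar>" if "\<And>x. \<bar>g x\<bar> \<le> 1" for g :: "'k \<Rightarrow>\<^sub>C real" and x
  proof -
    have ng: "norm g \<le> 1" using norm_bound[of g 1] that by simp
    have "norm (P g) \<le> norm g * \<bar>B\<bar>" using B[of g] by (meson abs_ge_self mult_left_mono norm_ge_zero order_trans)
    also have "\<dots> \<le> \<bar>B\<bar>" using ng by (simp add: mult_left_le_one_le)
    finally have "norm (R g) \<le> 1 + \<bar>B\<bar>"
      using norm_triangle_ineq4[of g "P g"] ng unfolding R_def by linarith
    then show ?thesis using norm_bounded[of "R g" x] by simp
  qed
  have "\<exists>g u v a b. (\<forall>x. \<bar>apply_bcontfun g x\<bar> \<le> 1) \<and> (\<forall>x. u < x \<longrightarrow> x < v \<longrightarrow> g x = 0) \<and>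
      (\<forall>x. u < x \<longrightarrow> x < v \<longrightarrow> real n / 4 \<le> R g x) \<and> (a, b) \<in> Q \<and> u < a \<and> b < v" for n
  proof (induction n)
    case 0
    have "R 0 = 0" by (simp add: R_def P.zero)
    then show ?case using start by (intro exI[of _ 0] exI[of _ u0] exI[of _ v0] exI[of _ a0] exI[of _ b0]) auto
  next
    case (Suc n)
    then obtain g u v a b where g: "\<And>x. \<bar>apply_bcontfun g x\<bar> \<le> 1" "\<And>x. u < x \<Longrightarrow> x < v \<Longrightarrow> g x = 0"
        "\<And>x. u < x \<Longrightarrow> x < v \<Longrightarrow> real n / 4 \<le> R g x" and ab: "(a, b) \<in> Q" "u < a" "b < v"
      by blast
    have "a < b" by (rule Q_less[OF ab(1)])
    define \<phi> where "\<phi> = ramp a b"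
    note \<phi> = ramp[OF \<open>a < b\<close>, folded \<phi>_def]
    define f where "f = R \<phi>"
    have "P \<phi> a = P \<phi> b" by (rule no_jump[OF P(2) ab(1)])
    then have jump: "f b - f a = 1" using \<phi>(3)[of a] \<phi>(4)[of b] by (simp add: f_def R_def)
    have cont: "continuous_on UNIV (apply_bcontfun f)" by simp
    consider "1/2 \<le> f b" | "f a \<le> -1/2" using jump by linarith
    then show ?case
    proof cases
      case 1
      have "open {x. 1/4 < f x}" by (intro open_Collect_less continuous_on_const cont)
      then obtain c where c: "b < c" "{b..<c} \<subseteq> {x. 1/4 < f x}"
        using right_neighbourhood[of "{x. 1/4 < f x}" b v] 1 ab(3) by auto
      define v' where "v' = min c v"
      have "b < v'" "v' \<le> c" "v' \<le> v" using c ab by (auto simp: v'_def)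
      then obtain a1 b1 where 1: "(a1, b1) \<in> Q" "b < a1" "b1 < v'" using right[OF ab(1)] by blast
      \<comment> \<open>A second interval closer to \<open>b\<close>: the cut-off happens before \<open>b2\<close>, which leaves the first
        one in the part where the new function vanishes.\<close>
      obtain a2 b2 where 2: "(a2, b2) \<in> Q" "b < a2" "b2 < a1" using right[OF ab(1) 1(2)] by blast
      have "a1 < b1" "a2 < b2" using 1 2 Q_less by auto
      then have "b < b2" using 2 by simp
      then obtain \<psi> where \<psi>: "\<psi> \<in> C" "\<And>x. 0 \<le> \<psi> x \<and> \<psi> x \<le> 1" "\<And>x. x \<le> b \<Longrightarrow> \<psi> x = 0" "\<And>x. b2 \<le> x \<Longrightarrow> \<psi> x = 1"
        using ramps[OF ab(1)] by blast
      have in_uv: "u < x \<and> x < v" if "b2 < x" "x < v'" for x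
        using that \<open>v' \<le> v\<close> \<open>b < b2\<close> \<open>a < b\<close> ab(2) by auto
      have A: "\<bar>(g + (\<phi> - \<psi>)) x\<bar> \<le> 1" for x
      proof -
        consider "x \<le> u" | "u < x" "x < v" | "v \<le> x" by force
        then show ?thesis
        proof cases
          case 1
          then have "\<phi> x = 0" "\<psi> x = 0" using \<phi>(3) \<psi>(3) \<open>a < b\<close> ab(2) by auto
          then show ?thesis using g(1) by simp
        next
          case 2
          then show ?thesis using g(2)[OF 2] \<phi>(1,2)[of x] \<psi>(2)[of x] by (simp add: abs_le_iff)
        next
          case 3
          then have "b \<le> x" "b2 \<le> x" using ab \<open>b2 < a1\<close> \<open>a1 < b1\<close> 1 \<open>v' \<le> v\<close> by auto
          then have "\<phi> x = 1" "\<psi> x = 1" using \<phi>(4) \<psi>(4) by auto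
          then show ?thesis using g(1) by simp
        qed
      qed
      have B: "(g + (\<phi> - \<psi>)) x = 0" if x: "b2 < x" "x < v'" for x
        using g(2)[of x] in_uv[OF x] \<phi>(4)[of x] \<psi>(4)[of x] x \<open>b < b2\<close> by simp
      have D: "real (Suc n) / 4 \<le> R (g + (\<phi> - \<psi>)) x" if x: "b2 < x" "x < v'" for x
      proof -
        have "x \<in> {b..<c}" using x \<open>b < b2\<close> \<open>v' \<le> c\<close> by auto
        then have "1/4 < f x" using c(2) by auto
        then show ?thesis using g(3)[of x] in_uv[OF x]
          by (simp add: R_add R_diff R_C[OF \<psi>(1)] f_def[symmetric] add_divide_distrib)
      qed
      show ?thesis
        by (intro exI[of _ "g + (\<phi> - \<psi>)"] exI[of _ b2] exI[of _ v'] exI[of _ a1] exI[of _ b1]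
            conjI allI impI A B D 1(1) 1(3) 2(3))
    next
      case 2
      have "open {x. f x < -1/4}" by (intro open_Collect_less continuous_on_const cont)
      then obtain c where c: "c < a" "{c<..a} \<subseteq> {x. f x < -1/4}"
        using left_neighbourhood[of "{x. f x < -1/4}" a u] 2 ab(2) by auto
      \<comment> \<open>Left of \<open>a\<close> both ramps vanish, so here it does not matter how far the cut-off reaches.\<close>
      define u' where "u' = max c u"
      have u': "u' < a" "c \<le> u'" "u \<le> u'" using c ab by (auto simp: u'_def)
      then obtain a1 b1 where 1: "(a1, b1) \<in> Q" "u' < a1" "b1 < a" using left[OF ab(1)] by blast
      obtain \<psi> where \<psi>: "\<psi> \<in> C" "\<And>x. 0 \<le> \<psi> x \<and> \<psi> x \<le> 1" "\<And>x. x \<le> b \<Longrightarrow> \<psi> x = 0" "\<And>x. v \<le> x \<Longrightarrow> \<psi> x = 1"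
        using ramps[OF ab(1) ab(3)] by blast
      have in_uv: "u < x \<and> x < v" if "u' < x" "x < a" for x
        using that u' \<open>a < b\<close> ab by auto
      have A: "\<bar>(g - (\<phi> - \<psi>)) x\<bar> \<le> 1" for x
      proof -
        consider "x \<le> u" | "u < x" "x < v" | "v \<le> x" by force
        then show ?thesis
        proof cases
          case 1
          then have "\<phi> x = 0" "\<psi> x = 0" using \<phi>(3) \<psi>(3) \<open>a < b\<close> ab(2) by auto
          then show ?thesis using g(1) by simp
        next
          case 2
          then show ?thesis using g(2)[OF 2] \<phi>(1,2)[of x] \<psi>(2)[of x] by (simp add: abs_le_iff)
        next
          case 3
          then have "b \<le> x" using ab by auto
          then have "\<phi> x = 1" "\<psi> x = 1" using \<phi>(4) \<psi>(4)[OF 3] by auto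
          then show ?thesis using g(1) by simp
        qed
      qed
      have B: "(g - (\<phi> - \<psi>)) x = 0" if x: "u' < x" "x < a" for x
        using g(2)[of x] in_uv[OF x] \<phi>(3)[of x] \<psi>(3)[of x] x \<open>a < b\<close> by simp
      have D: "real (Suc n) / 4 \<le> R (g - (\<phi> - \<psi>)) x" if x: "u' < x" "x < a" for x
      proof -
        have "x \<in> {c<..a}" using x u' by auto
        then have "f x < -1/4" using c(2) by auto
        then show ?thesis using g(3)[of x] in_uv[OF x]
          by (simp add: R_diff R_C[OF \<psi>(1)] f_def[symmetric] add_divide_distrib)
      qed
      show ?thesis
        by (intro exI[of _ "g - (\<phi> - \<psi>)"] exI[of _ u'] exI[of _ a] exI[of _ a1] exI[of _ b1]
            conjI allI impI A B D 1)
    qed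
  qed
  note step = this
  obtain n where "4 * (1 + \<bar>B\<bar>) < real n" using reals_Archimedean2 by blast
  then have n: "1 + \<bar>B\<bar> < real n / 4" by simp
  obtain g u v a b where g: "\<forall>x. \<bar>apply_bcontfun g x\<bar> \<le> 1"
      "\<forall>x. u < x \<longrightarrow> x < v \<longrightarrow> real n / 4 \<le> R g x" and ab: "(a, b) \<in> Q" "u < a" "b < v"
    using step[of n] by (elim exE conjE)
  have "a < v" using Q_less[OF ab(1)] ab(3) by simp
  then have "real n / 4 \<le> R g a" using g(2) ab(2) by simp
  moreover have "\<bar>R g a\<bar> \<le> 1 + \<bar>B\<bar>" using g(1) by (intro R_bound) simp
  ultimately show False using n by linarith
qed

text \<open>The interval is enlarged first to the right and then to the left as far as possible without catching
  two points of \<open>N\<close>. Density of the order of \<open>N\<close> makes these extrema attained: two points caught only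
  in the limit would have a third one between them. By maximality, points of \<open>N\<close> accumulate at
  the ends from outside. One point of \<open>N\<close> has to be allowed inside the interval: a point of \<open>N\<close> that
  is not a limit of a sequence from either side borders two intervals free of \<open>N\<close>.\<close>

lemma maximal_gap_exists:
  assumes dense: "\<forall>m\<in>N. \<forall>n\<in>N. m < n \<longrightarrow> (\<exists>k\<in>N. m < k \<and> k < (n::'k))"
    and xy: "x < y" "\<forall>m\<in>N. \<forall>n\<in>N. m < n \<longrightarrow> x \<le> m \<longrightarrow> n \<le> y \<longrightarrow> False"
  shows "\<exists>a b. a \<le> x \<and> y \<le> b \<and> (\<forall>m\<in>N. \<forall>n\<in>N. m < n \<longrightarrow> a \<le> m \<longrightarrow> n \<le> b \<longrightarrow> False) \<and>
    (\<forall>c>b. \<exists>m\<in>N. \<exists>n\<in>N. b \<le> m \<and> m < n \<and> n \<le> c) \<and> (\<forall>c<a. \<exists>m\<in>N. \<exists>n\<in>N. c \<le> m \<and> m < n \<and> n \<le> a)"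
proof -
  define free where "free x y \<longleftrightarrow> (\<forall>m\<in>N. \<forall>n\<in>N. m < n \<longrightarrow> x \<le> m \<longrightarrow> n \<le> y \<longrightarrow> False)" for x y
  have free_xy: "free x y" using xy(2) by (auto simp: free_def)
  obtain b where b: "\<forall>z\<in>{z. y \<le> z \<and> free x z}. z \<le> b" "\<forall>z<b. \<exists>w\<in>{z. y \<le> z \<and> free x z}. z < w"
    using least_upper_bound[of "{z. y \<le> z \<and> free x z}"] by (elim exE conjE)
  have yb: "y \<le> b" using b(1) free_xy by auto
  have free_xb: "free x b"
    unfolding free_def
  proof (intro ballI impI)
    fix m n assume mn: "m \<in> N" "n \<in> N" "m < n" "x \<le> m" "n \<le> b"
    then obtain k where k: "k \<in> N" "m < k" "k < n" using dense by blast
    then have "k < b" using mn by simp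
    then obtain w where w: "free x w" "k < w" using b(2) by auto
    then show False using k mn unfolding free_def by (meson less_imp_le)
  qed
  obtain a where a: "\<forall>z\<in>{z. z \<le> x \<and> free z b}. a \<le> z" "\<forall>z>a. \<exists>w\<in>{z. z \<le> x \<and> free z b}. w < z"
    using greatest_lower_bound[of "{z. z \<le> x \<and> free z b}"] by (elim exE conjE)
  have ax: "a \<le> x" using a(1) free_xb by auto
  have free_ab: "free a b"
    unfolding free_def
  proof (intro ballI impI)
    fix m n assume mn: "m \<in> N" "n \<in> N" "m < n" "a \<le> m" "n \<le> b"
    then obtain k where k: "k \<in> N" "m < k" "k < n" using dense by blast
    then have "a < k" using mn by simp
    then obtain w where w: "free w b" "w < k" using a(2) by auto
    then show False using k mn unfolding free_def by (meson less_imp_le)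
  qed
  have r1: "\<exists>n\<in>N. b < n \<and> n \<le> c" if c: "b < c" for c
  proof -
    have "\<not> free x c" using b(1) c yb by (metis (mono_tags, lifting) leD less_imp_le mem_Collect_eq order_trans)
    then obtain m n where "m \<in> N" "n \<in> N" "m < n" "x \<le> m" "n \<le> c" unfolding free_def by blast
    moreover from this have "b < n" using free_xb unfolding free_def by (meson not_le)
    ultimately show ?thesis by blast
  qed
  have l1: "\<exists>n\<in>N. c \<le> n \<and> n < a" if c: "c < a" for c
  proof -
    have "\<not> free c b" using a(1) c ax by (metis (mono_tags, lifting) leD less_imp_le mem_Collect_eq order_trans)
    then obtain m n where "m \<in> N" "n \<in> N" "m < n" "c \<le> m" "n \<le> b" unfolding free_def by blast
    moreover from this have "m < a" using free_ab unfolding free_def by (meson not_le)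
    ultimately show ?thesis by blast
  qed
  have "\<exists>m\<in>N. \<exists>n\<in>N. b \<le> m \<and> m < n \<and> n \<le> c" if c: "b < c" for c
  proof -
    obtain n where n: "n \<in> N" "b < n" "n \<le> c" using r1[OF c] by blast
    obtain d where d: "b < d" "d < n" using between[OF n(2)] by blast
    obtain m where m: "m \<in> N" "b < m" "m \<le> d" using r1[OF d(1)] by blast
    show ?thesis using n m d by (intro bexI[of _ m] bexI[of _ n]) auto
  qed
  moreover have "\<exists>m\<in>N. \<exists>n\<in>N. c \<le> m \<and> m < n \<and> n \<le> a" if c: "c < a" for c
  proof -
    obtain n where n: "n \<in> N" "c \<le> n" "n < a" using l1[OF c] by blast
    obtain d where d: "n < d" "d < a" using between[OF n(3)] by blast
    obtain m where m: "m \<in> N" "d \<le> m" "m < a" using l1[OF d(2)] by blast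
    show ?thesis using n m d by (intro bexI[of _ n] bexI[of _ m]) auto
  qed
  ultimately show ?thesis using ax yb free_ab unfolding free_def by (intro exI[of _ a] exI[of _ b]) simp
qed

text \<open>The collapsed intervals are the maximal ones with at most one point of \<open>N\<close>. A function in \<open>C\<close> is
  constant on the two halves cut out by that point and so agrees at both ends. As no interval is
  separable, there are nondegenerate collapsed intervals between any two points of \<open>N\<close>.\<close>

lemma not_complemented_if_countably_determined:
  fixes C :: "('k \<Rightarrow>\<^sub>C real) set"
  assumes P: "bounded_linear P" "\<And>f. P f \<in> C" "\<And>f. f \<in> C \<Longrightarrow> P f = f"
    and N: "countable N" "m0 \<in> N" "n0 \<in> N" "m0 < n0"
    and dense: "\<forall>m\<in>N. \<forall>n\<in>N. m < n \<longrightarrow> (\<exists>k\<in>N. m < k \<and> k < n)"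
    and ramps: "\<And>m n. m \<in> N \<Longrightarrow> n \<in> N \<Longrightarrow> m < n \<Longrightarrow> ramp m n \<in> C"
    and determined: "\<And>h x y. h \<in> C \<Longrightarrow> x < y \<Longrightarrow> {x<..<y} \<inter> N = {} \<Longrightarrow> apply_bcontfun h x = h y"
    and nonseparable: "\<And>u v N. u < v \<Longrightarrow> countable N \<Longrightarrow> \<exists>x y::'k. u < x \<and> x < y \<and> y < v \<and> {x<..<y} \<inter> N = {}"
  shows False
proof -
  define Q where "Q = {(a, b). a < b \<and> (\<forall>m\<in>N. \<forall>n\<in>N. m < n \<longrightarrow> a \<le> m \<longrightarrow> n \<le> b \<longrightarrow> False) \<and>
    (\<forall>c>b. \<exists>m\<in>N. \<exists>n\<in>N. b \<le> m \<and> m < n \<and> n \<le> c) \<and> (\<forall>c<a. \<exists>m\<in>N. \<exists>n\<in>N. c \<le> m \<and> m < n \<and> n \<le> a)}"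
  have gap_within: "\<exists>a b. (a, b) \<in> Q \<and> u < a \<and> b < v" if uv: "u \<in> N" "v \<in> N" "u < v" for u v
  proof -
    obtain u' where u': "u' \<in> N" "u < u'" "u' < v" using dense uv by blast
    obtain v' where v': "v' \<in> N" "u' < v'" "v' < v" using dense u'(1) uv(2) u'(3) by blast
    obtain x y where xy: "u' < x" "x < y" "y < v'" "{x<..<y} \<inter> N = {}"
      using nonseparable[OF v'(2) N(1)] by blast
    \<comment> \<open>Shrinking the gap excludes its end points, which may belong to \<open>N\<close>.\<close>
    obtain x' where x': "x < x'" "x' < y" using between[OF xy(2)] by blast
    obtain y' where y': "x' < y'" "y' < y" using between[OF x'(2)] by blast
    have no_two: "\<forall>m\<in>N. \<forall>n\<in>N. m < n \<longrightarrow> x' \<le> m \<longrightarrow> n \<le> y' \<longrightarrow> False"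
    proof (intro ballI impI)
      fix m n assume mn: "m \<in> N" "n \<in> N" "m < n" "x' \<le> m" "n \<le> y'"
      have "m \<in> {x<..<y} \<inter> N" using mn x' y' by auto
      then show False using xy(4) by blast
    qed
    obtain a b where ab: "a \<le> x'" "y' \<le> b" and free: "\<forall>m\<in>N. \<forall>n\<in>N. m < n \<longrightarrow> a \<le> m \<longrightarrow> n \<le> b \<longrightarrow> False"
      and lim: "\<forall>c>b. \<exists>m\<in>N. \<exists>n\<in>N. b \<le> m \<and> m < n \<and> n \<le> c" "\<forall>c<a. \<exists>m\<in>N. \<exists>n\<in>N. c \<le> m \<and> m < n \<and> n \<le> a"
      using maximal_gap_exists[of N x' y', OF dense y'(1) no_two] by (elim exE conjE)
    have "a < b" using ab y'(1) by simp
    then have "(a, b) \<in> Q" unfolding Q_def using free lim by blast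
    moreover have "u < a"
    proof (rule ccontr)
      assume "\<not> u < a"
      then have "a \<le> u" "u' \<le> b" using ab xy x' y' by auto
      then show False using free uv(1) u' by blast
    qed
    moreover have "b < v"
    proof (rule ccontr)
      assume "\<not> b < v"
      then have "a \<le> v'" "v \<le> b" using ab xy x' y' by auto
      then show False using free uv(2) v' by blast
    qed
    ultimately show ?thesis by blast
  qed
  obtain a0 b0 where Q0: "(a0, b0) \<in> Q" "m0 < a0" "b0 < n0" using gap_within[OF N(2-4)] by blast
  show False
  proof (rule no_projection_onto_functions_without_jumps[OF P, where Q = Q])
    show "a < b" if "(a, b) \<in> Q" for a b using that by (simp add: Q_def)
    show "apply_bcontfun h a = h b" if h: "h \<in> C" and ab: "(a, b) \<in> Q" for h a b
    proof (cases "{a<..<b} \<inter> N = {}")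
      case True
      then show ?thesis using determined h ab by (simp add: Q_def)
    next
      case False
      then obtain n where n: "n \<in> N" "a < n" "n < b" by auto
      have free: "\<And>m n. m \<in> N \<Longrightarrow> n \<in> N \<Longrightarrow> m < n \<Longrightarrow> a \<le> m \<Longrightarrow> n \<le> b \<Longrightarrow> False"
        using ab by (auto simp: Q_def)
      have "{a<..<n} \<inter> N = {}"
      proof (rule ccontr)
        assume "{a<..<n} \<inter> N \<noteq> {}"
        then obtain k where "k \<in> N" "a < k" "k < n" by auto
        then show False using free[of k n] n by (simp add: less_imp_le)
      qed
      moreover have "{n<..<b} \<inter> N = {}"
      proof (rule ccontr)
        assume "{n<..<b} \<inter> N \<noteq> {}"
        then obtain k where "k \<in> N" "n < k" "k < b" by auto
        then show False using free[of n k] n by (simp add: less_imp_le)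
      qed
      ultimately show ?thesis using determined[OF h n(2)] determined[OF h n(3)] by simp
    qed
    show "\<exists>\<psi>\<in>C. (\<forall>x. 0 \<le> \<psi> x \<and> \<psi> x \<le> 1) \<and> (\<forall>x\<le>b. \<psi> x = 0) \<and> (\<forall>x\<ge>c. \<psi> x = 1)"
      if ab: "(a, b) \<in> Q" "b < c" for a b c
    proof -
      obtain m n where mn: "m \<in> N" "n \<in> N" "b \<le> m" "m < n" "n \<le> c" using ab by (auto simp: Q_def)
      show ?thesis
        using ramp[OF mn(4)] mn by (intro bexI[of _ "ramp m n"] ramps conjI allI impI) (auto intro: order_trans)
    qed
    show "\<exists>a' b'. (a', b') \<in> Q \<and> b < a' \<and> b' < c" if ab: "(a, b) \<in> Q" "b < c" for a b c
    proof -
      obtain m n where mn: "m \<in> N" "n \<in> N" "b \<le> m" "m < n" "n \<le> c" using ab by (auto simp: Q_def)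
      then obtain a' b' where "(a', b') \<in> Q" "m < a'" "b' < n" using gap_within by blast
      then show ?thesis using mn by (intro exI[of _ a'] exI[of _ b']) auto
    qed
    show "\<exists>a' b'. (a', b') \<in> Q \<and> c < a' \<and> b' < a" if ab: "(a, b) \<in> Q" "c < a" for a b c
    proof -
      obtain m n where mn: "m \<in> N" "n \<in> N" "c \<le> m" "m < n" "n \<le> a" using ab by (auto simp: Q_def)
      then obtain a' b' where "(a', b') \<in> Q" "m < a'" "b' < n" using gap_within by blast
      then show ?thesis using mn by (intro exI[of _ a'] exI[of _ b']) auto
    qed
  qed (assumption | rule Q0)+
qed

end

section \<open>Skeletons of complemented subspaces\<close>

text \<open>Each of the countably many vectors lies in some member of the chain, so an increasing sequence of
  members picks them up one after the other, and the closure of its union is a member again.\<close>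

lemma skeleton_absorbs_countable:
  fixes \<C> :: "'a::real_normed_vector set set"
  assumes sk: "skeleton \<C>" and C0: "C0 \<in> \<C>" and A: "countable A"
  shows "\<exists>C\<in>\<C>. C0 \<subseteq> C \<and> A \<subseteq> C"
proof -
  obtain a :: "nat \<Rightarrow> 'a" where a: "insert 0 A = range a"
    using A uncountable_def[of "insert 0 A"] by auto
  have "\<forall>n. \<exists>D\<in>\<C>. a n \<in> D" using sk unfolding skeleton_def by blast
  then obtain D where D: "\<And>n. D n \<in> \<C>" "\<And>n. a n \<in> D n" by metis
  define E where "E = rec_nat C0 (\<lambda>n X. if X \<subseteq> D n then D n else X)"
  have E_Suc: "E (Suc n) = (if E n \<subseteq> D n then D n else E n)" for n by (simp add: E_def)
  have E_in: "E n \<in> \<C>" for n by (induction n) (auto simp: E_Suc C0 D(1), simp add: E_def C0)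
  have "E n \<subseteq> E (Suc n)" for n by (simp add: E_Suc)
  then have "closure (\<Union>n. E n) \<in> \<C>" using sk E_in unfolding skeleton_def by blast
  moreover have aE: "a n \<in> E (Suc n)" for n
  proof -
    have "D n \<subseteq> E n \<or> E n \<subseteq> D n"
      using sk E_in[of n] D(1)[of n] unfolding skeleton_def chain_subset_def by blast
    then show ?thesis using D(2)[of n] by (auto simp: E_Suc)
  qed
  have "A \<subseteq> (\<Union>n. E n)"
  proof
    fix z assume "z \<in> A"
    then obtain n where "z = a n" using a by (metis insertI2 rangeE)
    then show "z \<in> (\<Union>n. E n)" using aE by blast
  qed
  moreover have "C0 \<subseteq> (\<Union>n. E n)" using UN_upper[of 0 UNIV E] by (simp add: E_def)
  ultimately show ?thesis using closure_subset by (meson order_trans)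
qed

context order_continuum
begin

text \<open>Closing off: a member \<open>C\<close> and a countable set \<open>N\<close> are enlarged alternately. The next member contains the
  ramps between points of \<open>N\<close>, the next countable set contains points between any two points of \<open>N\<close> and
  determines a countable dense subset of \<open>C\<close>. The limits of the two sequences have all
  properties at once.\<close>

lemma skeleton_has_countably_determined_member:
  fixes \<C> :: "('k \<Rightarrow>\<^sub>C real) set set"
  assumes sk: "skeleton \<C>" and "m0 < (n0::'k)"
  shows "\<exists>C\<in>\<C>. \<exists>N. countable N \<and> m0 \<in> N \<and> n0 \<in> N \<and>
    (\<forall>m\<in>N. \<forall>n\<in>N. m < n \<longrightarrow> (\<exists>k\<in>N. m < k \<and> k < n)) \<and>
    (\<forall>m\<in>N. \<forall>n\<in>N. m < n \<longrightarrow> ramp m n \<in> C) \<and>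
    (\<forall>h\<in>C. \<forall>x y. x < y \<longrightarrow> {x<..<y} \<inter> N = {} \<longrightarrow> apply_bcontfun h x = h y)"
proof -
  define good where "good = (\<lambda>(C, N). C \<in> \<C> \<and> countable N \<and> m0 \<in> N \<and> n0 \<in> N)"
  define ext where "ext = (\<lambda>(C :: ('k \<Rightarrow>\<^sub>C real) set, N) (C', N').
    C \<subseteq> C' \<and> N \<subseteq> N' \<and> (\<forall>m\<in>N. \<forall>n\<in>N. m < n \<longrightarrow> ramp m n \<in> C') \<and>
    (\<forall>m\<in>N. \<forall>n\<in>N. m < n \<longrightarrow> (\<exists>k\<in>N'. m < k \<and> k < n)) \<and>
    (\<forall>h\<in>C. \<forall>x y. x < y \<longrightarrow> {x<..<y} \<inter> N' = {} \<longrightarrow> apply_bcontfun h x = h y))"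
  have step: "\<exists>C' N'. good (C', N') \<and> ext (C, N) (C', N')" if "good (C, N)" for C N
  proof -
    have C: "C \<in> \<C>" and N: "countable N" "m0 \<in> N" "n0 \<in> N" using that by (auto simp: good_def)
    have "countable ((\<lambda>(m, n). ramp m n) ` (N \<times> N))" using N by auto
    then obtain C' where C': "C' \<in> \<C>" "C \<subseteq> C'" "(\<lambda>(m, n). ramp m n) ` (N \<times> N) \<subseteq> C'"
      using skeleton_absorbs_countable[OF sk C] by blast
    have "separable_set C" using sk C by (auto simp: skeleton_def)
    then obtain D where D: "countable D" "C \<subseteq> closure D" using separable_setD by blast
    have "\<forall>h :: 'k \<Rightarrow>\<^sub>C real. \<exists>N. countable N \<and>
        (\<forall>x y. x < y \<longrightarrow> apply_bcontfun h x \<noteq> h y \<longrightarrow> (\<exists>n\<in>N. x < n \<and> n < (y::'k)))"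
      by (rule allI, rule countable_set_determining_function)
    from choice[OF this] obtain F where "\<forall>h :: 'k \<Rightarrow>\<^sub>C real. countable (F h) \<and>
        (\<forall>x y. x < y \<longrightarrow> apply_bcontfun h x \<noteq> h y \<longrightarrow> (\<exists>n\<in>F h. x < n \<and> n < (y::'k)))"
      by (elim exE)
    then have F: "\<And>h. countable (F h)"
        "\<And>(h :: 'k \<Rightarrow>\<^sub>C real) x y. x < y \<Longrightarrow> apply_bcontfun h x \<noteq> h y \<Longrightarrow> \<exists>n\<in>F h. x < n \<and> n < y"
      by simp_all
    define mid where "mid = (\<lambda>(m::'k, n). SOME k. m < k \<and> k < n)"
    have mid: "m < mid (m, n) \<and> mid (m, n) < n" if "m < n" for m n
      using someI_ex[OF between[OF that]] by (simp add: mid_def)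
    define N' where "N' = N \<union> mid ` (N \<times> N) \<union> (\<Union>h\<in>D. F h)"
    have "countable N'" using N D F by (auto simp: N'_def)
    moreover have "apply_bcontfun h x = h y" if h: "h \<in> C" and xy: "x < y" "{x<..<y} \<inter> N' = {}" for h x y
    proof -
      have "D \<subseteq> {f. apply_bcontfun f x = f y}"
      proof
        fix f assume "f \<in> D"
        then have "{x<..<y} \<inter> F f = {}" using xy by (auto simp: N'_def)
        then have "\<not> (\<exists>n\<in>F f. x < n \<and> n < y)" by auto
        then show "f \<in> {f. apply_bcontfun f x = f y}" using F(2)[OF xy(1), of f] by blast
      qed
      then have "closure D \<subseteq> {f. apply_bcontfun f x = f y}" using closed_agreement by (rule closure_minimal)
      then show ?thesis using D(2) h by auto
    qed
    moreover have "\<exists>k\<in>N'. m < k \<and> k < n" if "m \<in> N" "n \<in> N" "m < n" for m n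
      using mid[OF that(3)] that by (intro bexI[of _ "mid (m, n)"]) (auto simp: N'_def)
    moreover have "N \<subseteq> N'" by (auto simp: N'_def)
    ultimately have "good (C', N')" "ext (C, N) (C', N')"
      using C' N by (auto simp: good_def ext_def)
    then show ?thesis by blast
  qed
  obtain C0 where "C0 \<in> \<C>" using sk by (auto simp: skeleton_def)
  then have "good (C0, {m0, n0})" by (simp add: good_def)
  then have "\<exists>f. \<forall>n. good (f n) \<and> ext (f n) (f (Suc n))"
    using step by (intro dependent_nat_choice) auto
  then obtain f where f: "\<And>n. good (f n)" "\<And>n. ext (f n) (f (Suc n))" by blast
  define C N where "C i = fst (f i)" and "N i = snd (f i)" for i
  have g: "C i \<in> \<C>" "countable (N i)" "m0 \<in> N i" "n0 \<in> N i" for i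
    using f(1)[of i] by (auto simp: good_def C_def N_def split: prod.splits)
  have s: "C i \<subseteq> C (Suc i)" "N i \<subseteq> N (Suc i)"
      "\<And>m n. m \<in> N i \<Longrightarrow> n \<in> N i \<Longrightarrow> m < n \<Longrightarrow> ramp m n \<in> C (Suc i)"
      "\<And>m n. m \<in> N i \<Longrightarrow> n \<in> N i \<Longrightarrow> m < n \<Longrightarrow> \<exists>k\<in>N (Suc i). m < k \<and> k < n"
      "\<And>h x y. h \<in> C i \<Longrightarrow> x < y \<Longrightarrow> {x<..<y} \<inter> N (Suc i) = {} \<Longrightarrow> apply_bcontfun h x = h y" for i
    using f(2)[of i] by (auto simp: ext_def C_def N_def split: prod.splits)
  have N_mono: "N i \<subseteq> N j" if "i \<le> j" for i j using lift_Suc_mono_le[of N, OF s(2) that] .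
  have common: "\<exists>i. m \<in> N i \<and> n \<in> N i" if "m \<in> (\<Union>i. N i)" "n \<in> (\<Union>i. N i)" for m n
  proof -
    obtain i j where "m \<in> N i" "n \<in> N j" using \<open>m \<in> _\<close> \<open>n \<in> _\<close> by blast
    then show ?thesis using N_mono[of i "max i j"] N_mono[of j "max i j"] by (intro exI[of _ "max i j"]) auto
  qed
  define Cw where "Cw = closure (\<Union>i. C i)"
  have "Cw \<in> \<C>" using sk g(1) s(1) unfolding skeleton_def Cw_def by blast
  moreover have "countable (\<Union>i. N i)" using g(2) by auto
  moreover have "m0 \<in> (\<Union>i. N i)" "n0 \<in> (\<Union>i. N i)" using g by auto
  moreover have "\<exists>k\<in>(\<Union>i. N i). m < k \<and> k < n" if mn: "m \<in> (\<Union>i. N i)" "n \<in> (\<Union>i. N i)" "m < n" for m n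
  proof -
    obtain i where "m \<in> N i" "n \<in> N i" using common[OF mn(1,2)] by blast
    then show ?thesis using s(4)[of m i n] mn(3) by blast
  qed
  moreover have "ramp m n \<in> Cw" if mn: "m \<in> (\<Union>i. N i)" "n \<in> (\<Union>i. N i)" "m < n" for m n
  proof -
    obtain i where "m \<in> N i" "n \<in> N i" using common[OF mn(1,2)] by blast
    then have "ramp m n \<in> C (Suc i)" using s(3)[of m i n] mn(3) by blast
    then show ?thesis unfolding Cw_def by (intro subsetD[OF closure_subset] UN_I[of "Suc i"]) simp_all
  qed
  moreover have "apply_bcontfun h x = h y" if h: "h \<in> Cw" and xy: "x < y" "{x<..<y} \<inter> (\<Union>i. N i) = {}" for h x y
  proof -
    have "(\<Union>i. C i) \<subseteq> {f. apply_bcontfun f x = f y}"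
    proof
      fix f assume "f \<in> (\<Union>i. C i)"
      then obtain i where "f \<in> C i" by blast
      moreover have "{x<..<y} \<inter> N (Suc i) = {}" using xy(2) by blast
      ultimately show "f \<in> {f. apply_bcontfun f x = f y}" using s(5) xy(1) by blast
    qed
    then have "Cw \<subseteq> {f. apply_bcontfun f x = f y}"
      unfolding Cw_def using closed_agreement by (rule closure_minimal)
    then show ?thesis using h by auto
  qed
  ultimately show ?thesis by (intro bexI[of _ Cw] exI[of _ "\<Union>i. N i"] conjI ballI impI allI)
qed

lemma no_skeleton_of_complemented_subspaces:
  assumes nonseparable: "\<And>u v N. u < v \<Longrightarrow> countable N \<Longrightarrow> \<exists>x y::'k. u < x \<and> x < y \<and> y < v \<and> {x<..<y} \<inter> N = {}"
    and nontrivial: "m0 < (n0::'k)"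
    and sk: "skeleton \<C>" and compl: "\<forall>C\<in>\<C>. complemented (C :: ('k \<Rightarrow>\<^sub>C real) set)"
  shows False
proof -
  obtain C N where C: "C \<in> \<C>" and N: "countable N" "m0 \<in> N" "n0 \<in> N"
    and d: "\<forall>m\<in>N. \<forall>n\<in>N. m < n \<longrightarrow> (\<exists>k\<in>N. m < k \<and> k < n)"
    and r: "\<forall>m\<in>N. \<forall>n\<in>N. m < n \<longrightarrow> ramp m n \<in> C"
    and c: "\<forall>h\<in>C. \<forall>x y. x < y \<longrightarrow> {x<..<y} \<inter> N = {} \<longrightarrow> apply_bcontfun h x = h y"
    using skeleton_has_countably_determined_member[OF sk nontrivial] by (elim bexE exE conjE)
  obtain P where P: "bounded_linear P" "P \<circ> P = P" "range P = C"
    using compl C unfolding complemented_def projection_def by blast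
  have "P f \<in> C" for f using P(3) by blast
  moreover have "P f = f" if "f \<in> C" for f using P(2,3) that by (auto simp: fun_eq_iff)
  ultimately show False
    by (rule not_complemented_if_countably_determined[OF P(1) _ _ N nontrivial d])
      (use r c nonseparable in blast)+
qed

end

section \<open>The first uncountable ordinal and projectional resolutions\<close>

lemma Card_order_omega1: "Card_order omega1"
  unfolding omega1_def by (intro cardSuc_Card_order natLeq_Card_order)

lemma Well_order_omega1: "Well_order omega1"
  using Card_order_omega1 by (simp add: card_order_on_def)

lemma wo_rel_omega1: "wo_rel omega1"
  using Well_order_omega1 by (simp add: wo_rel_def)

lemma countable_iff_less_omega1: "countable A \<longleftrightarrow> |A| <o omega1"
  unfolding omega1_def countable_card_le_natLeq
  by (rule cardSuc_ordLeq_ordLess[OF natLeq_Card_order card_of_Card_order, symmetric])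

lemma uncountable_iff_omega1_le: "uncountable A \<longleftrightarrow> omega1 \<le>o |A|"
  unfolding countable_iff_less_omega1
  by (rule not_ordLess_iff_ordLeq[OF Well_order_omega1 card_of_Well_order])

lemma uncountable_Field_omega1: "uncountable (Field omega1)"
  unfolding uncountable_iff_omega1_le
  by (rule ordIso_imp_ordLeq[OF ordIso_symmetric[OF card_of_Field_ordIso[OF Card_order_omega1]]])

lemma omega1_linear: "\<alpha> \<in> Field omega1 \<Longrightarrow> \<beta> \<in> Field omega1 \<Longrightarrow> (\<alpha>, \<beta>) \<in> omega1 \<or> \<beta> \<in> underS omega1 \<alpha>"
  using wo_rel.TOTALS[OF wo_rel_omega1] by (auto simp: underS_def)

lemma omega1_trans: "(\<alpha>, \<beta>) \<in> omega1 \<Longrightarrow> (\<beta>, \<gamma>) \<in> omega1 \<Longrightarrow> (\<alpha>, \<gamma>) \<in> omega1"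
  using wo_rel.TRANS[OF wo_rel_omega1] by (meson transD)

lemma omega1_antisym: "(\<alpha>, \<beta>) \<in> omega1 \<Longrightarrow> (\<beta>, \<alpha>) \<in> omega1 \<Longrightarrow> \<alpha> = \<beta>"
  using wo_rel.ANTISYM[OF wo_rel_omega1] by (meson antisymD)

lemma omega1_least:
  assumes "B \<subseteq> Field omega1" "B \<noteq> {}"
  shows "\<exists>\<delta>\<in>B. \<forall>\<beta>\<in>B. (\<delta>, \<beta>) \<in> omega1"
  using wo_rel.minim_in[OF wo_rel_omega1 assms] wo_rel.minim_least[OF wo_rel_omega1 assms(1)] by blast

lemma omega1_countable_bounded:
  assumes "countable A" "A \<subseteq> Field omega1"
  shows "\<exists>\<delta>\<in>Field omega1. A \<subseteq> underS omega1 \<delta>"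
proof -
  have "countable (underS omega1 \<alpha>)" if "\<alpha> \<in> A" for \<alpha>
    unfolding countable_iff_less_omega1 using that assms(2) by (intro card_of_underS[OF Card_order_omega1]) auto
  then have "countable (A \<union> (\<Union>\<alpha>\<in>A. underS omega1 \<alpha>))" using assms(1) by auto
  then obtain \<delta> where \<delta>: "\<delta> \<in> Field omega1" "\<delta> \<notin> A \<union> (\<Union>\<alpha>\<in>A. underS omega1 \<alpha>)"
    using uncountable_Field_omega1 by (metis countable_subset subsetI)
  have "\<alpha> \<in> underS omega1 \<delta>" if "\<alpha> \<in> A" for \<alpha>
  proof -
    have "\<alpha> \<in> Field omega1" "\<delta> \<notin> underS omega1 \<alpha>" "\<delta> \<noteq> \<alpha>" using that \<delta>(2) assms(2) by auto
    then show ?thesis using omega1_linear[OF \<delta>(1), of \<alpha>] by (auto simp: underS_def)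
  qed
  then show ?thesis using \<delta>(1) by blast
qed

text \<open>Countable sets are bounded in \<open>\<omega>\<^sub>1\<close>, and the least strict upper bound of a sequence without maximum
  is a limit.\<close>

lemma omega1_supremum:
  fixes \<alpha> :: "nat \<Rightarrow> nat set"
  assumes \<alpha>: "\<And>n. \<alpha> n \<in> Field omega1" and no_max: "\<And>m. \<exists>n. (\<alpha> n, \<alpha> m) \<notin> omega1"
  shows "\<exists>\<delta>. limit_point_of_order omega1 \<delta> \<and> (\<forall>n. \<alpha> n \<in> underS omega1 \<delta>) \<and>
    (\<forall>\<xi>\<in>underS omega1 \<delta>. \<exists>n. (\<xi>, \<alpha> n) \<in> omega1)"
proof -
  define B where "B = {\<delta>\<in>Field omega1. \<forall>n. \<alpha> n \<in> underS omega1 \<delta>}"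
  have "\<exists>\<delta>\<in>Field omega1. range \<alpha> \<subseteq> underS omega1 \<delta>"
    using \<alpha> by (intro omega1_countable_bounded) auto
  then have "B \<noteq> {}" "B \<subseteq> Field omega1" unfolding B_def by auto
  then obtain \<delta> where \<delta>: "\<delta> \<in> B" "\<forall>\<beta>\<in>B. (\<delta>, \<beta>) \<in> omega1" using omega1_least by metis
  have cofinal: "\<exists>n. (\<xi>, \<alpha> n) \<in> omega1" if \<xi>: "\<xi> \<in> underS omega1 \<delta>" for \<xi>
  proof (rule ccontr)
    assume "\<nexists>n. (\<xi>, \<alpha> n) \<in> omega1"
    moreover have F: "\<xi> \<in> Field omega1" using \<xi> by (auto simp: underS_def Field_def)
    ultimately have "\<xi> \<in> B" using omega1_linear[OF F \<alpha>] by (auto simp: B_def)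
    then show False using \<delta>(2) \<xi> omega1_antisym by (auto simp: underS_def)
  qed
  have "limit_point_of_order omega1 \<delta>"
    unfolding limit_point_of_order_def
  proof (intro conjI ballI)
    show "\<delta> \<in> Field omega1" "underS omega1 \<delta> \<noteq> {}" using \<delta>(1) by (auto simp: B_def)
    fix \<xi> assume "\<xi> \<in> underS omega1 \<delta>"
    then obtain n where n: "(\<xi>, \<alpha> n) \<in> omega1" using cofinal by blast
    obtain m where "(\<alpha> m, \<alpha> n) \<notin> omega1" using no_max by blast
    then have m: "\<alpha> n \<in> underS omega1 (\<alpha> m)" using omega1_linear[OF \<alpha> \<alpha>] by blast
    then have nm: "(\<alpha> n, \<alpha> m) \<in> omega1" "\<alpha> n \<noteq> \<alpha> m" by (auto simp: underS_def)
    then have "(\<xi>, \<alpha> m) \<in> omega1" "\<xi> \<noteq> \<alpha> m"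
      using omega1_trans[OF n nm(1)] omega1_antisym[OF nm(1)] n by blast+
    then show "\<exists>\<eta>\<in>underS omega1 \<delta>. \<xi> \<in> underS omega1 \<eta>"
      using \<delta>(1) by (intro bexI[of _ "\<alpha> m"]) (auto simp: underS_def B_def)
  qed
  then show ?thesis using \<delta>(1) cofinal by (intro exI[of _ \<delta>]) (auto simp: B_def)
qed

text \<open>The index sequence belonging to an increasing sequence of ranges need not be increasing. Either
  it has a maximum, whose range is the union, or its supremum is a limit ordinal and continuity of the
  resolution applies.\<close>

lemma skeleton_of_projectional_resolution:
  fixes P :: "nat set \<Rightarrow> 'f::real_normed_vector \<Rightarrow> 'f" and F :: "'e::real_normed_vector \<Rightarrow> 'f"
  assumes P: "projectional_resolution P"
    and FG: "bounded_linear F" "bounded_linear G" "G \<circ> F = id" "F \<circ> G = id"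
  shows "\<exists>\<C> :: 'e set set. skeleton \<C> \<and> (\<forall>C\<in>\<C>. complemented C)"
proof -
  interpret F: bounded_linear F by (rule FG(1))
  interpret G: bounded_linear G by (rule FG(2))
  have GF: "G (F x) = x" and FGx: "F (G y) = y" for x y using FG(3,4) by (auto simp: fun_eq_iff)
  define Q where "Q \<alpha> = G \<circ> P \<alpha> \<circ> F" for \<alpha>
  have P1: "bounded_linear (P \<alpha>)" "P \<alpha> (P \<alpha> x) = P \<alpha> x" "separable_set (range (P \<alpha>))"
    if "\<alpha> \<in> Field omega1" for \<alpha> x
    using P that unfolding projectional_resolution_def projection_def by (auto simp: fun_eq_iff)
  have range_Q: "range (Q \<alpha>) = G ` range (P \<alpha>)" for \<alpha>
  proof -
    have "range F = UNIV" using FGx by (metis surjI)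
    then have "range (Q \<alpha>) = G ` P \<alpha> ` UNIV" unfolding Q_def by (metis image_comp)
    then show ?thesis .
  qed
  have projection_Q: "projection (Q \<alpha>)" if "\<alpha> \<in> Field omega1" for \<alpha>
  proof -
    have "bounded_linear (Q \<alpha>)" unfolding Q_def comp_def
      by (intro bounded_linear_compose[OF FG(2)] bounded_linear_compose[OF P1(1)[OF that]] FG(1))
    then show ?thesis by (auto simp: projection_def Q_def fun_eq_iff FGx P1(2)[OF that])
  qed
  have mono_Q: "range (Q \<alpha>) \<subseteq> range (Q \<beta>)" if "(\<alpha>, \<beta>) \<in> omega1" for \<alpha> \<beta>
  proof -
    have "P \<beta> \<circ> P \<alpha> = P \<alpha>" using P that unfolding projectional_resolution_def by blast
    then have "range (P \<alpha>) \<subseteq> range (P \<beta>)" by (metis comp_apply image_subsetI rangeI)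
    then show ?thesis unfolding range_Q by blast
  qed
  have closed_Q: "closed (range (Q \<alpha>))" if "\<alpha> \<in> Field omega1" for \<alpha>
  proof -
    have Q: "bounded_linear (Q \<alpha>)" "\<And>x. Q \<alpha> (Q \<alpha> x) = Q \<alpha> x"
      using projection_Q[OF that] by (auto simp: projection_def fun_eq_iff)
    have "range (Q \<alpha>) = {x. Q \<alpha> x = x}" using Q(2) by (auto, metis rangeI)
    moreover have "closed {x. Q \<alpha> x = x}"
      by (intro closed_Collect_eq linear_continuous_on Q(1) continuous_on_id)
    ultimately show ?thesis by simp
  qed
  have G_closure: "G ` closure X = closure (G ` X)" for X
  proof
    show "G ` closure X \<subseteq> closure (G ` X)" by (rule closure_bounded_linear_image_subset[OF FG(2)])
    have "F ` closure (G ` X) \<subseteq> closure (F ` G ` X)" by (rule closure_bounded_linear_image_subset[OF FG(1)])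
    then have "F ` closure (G ` X) \<subseteq> closure X" by (simp add: image_image FGx)
    then show "closure (G ` X) \<subseteq> G ` closure X" using GF by (metis imageI image_subset_iff subsetI)
  qed
  define \<C> where "\<C> = (\<lambda>\<alpha>. range (Q \<alpha>)) ` Field omega1"
  have "skeleton \<C>"
    unfolding skeleton_def
  proof (intro conjI allI impI)
    show "\<forall>C\<in>\<C>. subspace C \<and> closed C \<and> separable_set C"
    proof
      fix C assume "C \<in> \<C>"
      then obtain \<alpha> where \<alpha>: "\<alpha> \<in> Field omega1" "C = range (Q \<alpha>)" by (auto simp: \<C>_def)
      have "linear (Q \<alpha>)" using projection_Q[OF \<alpha>(1)] by (simp add: projection_def bounded_linear.linear)
      then have "subspace C" unfolding \<alpha>(2) by (intro linear_subspace_image) auto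
      moreover have "separable_set C"
      proof -
        obtain D where D: "countable D" "D \<subseteq> range (P \<alpha>)" "range (P \<alpha>) \<subseteq> closure D"
          using separable_setD[OF P1(3)[OF \<alpha>(1)]] by blast
        show ?thesis
          using D G_closure[of D] unfolding \<alpha>(2) range_Q
          by (intro separable_setI[of "G ` D"]) auto
      qed
      ultimately show "subspace C \<and> closed C \<and> separable_set C" using closed_Q \<alpha> by simp
    qed
    show "chain\<^sub>\<subseteq> \<C>"
      unfolding chain_subset_def \<C>_def using wo_rel.TOTALS[OF wo_rel_omega1] mono_Q by blast
    have "(\<Union>\<alpha>\<in>Field omega1. range (P \<alpha>)) = UNIV" using P by (simp add: projectional_resolution_def)
    then have "\<Union>\<C> = G ` UNIV" unfolding \<C>_def range_Q by blast
    then show "\<Union>\<C> = UNIV" using GF by (metis surjI)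
  next
    fix C :: "nat \<Rightarrow> 'e set"
    assume C: "(\<forall>n. C n \<in> \<C>) \<and> (\<forall>n. C n \<subseteq> C (Suc n))"
    then have "\<forall>n. \<exists>\<alpha>. \<alpha> \<in> Field omega1 \<and> C n = range (Q \<alpha>)" unfolding \<C>_def image_iff by blast
    from choice[OF this] obtain \<alpha> where \<alpha>: "\<And>n. \<alpha> n \<in> Field omega1" "\<And>n. C n = range (Q (\<alpha> n))" by blast
    show "closure (\<Union>n. C n) \<in> \<C>"
    proof (cases "\<exists>m. \<forall>n. (\<alpha> n, \<alpha> m) \<in> omega1")
      case True
      then obtain m where m: "\<And>n. (\<alpha> n, \<alpha> m) \<in> omega1" by blast
      then have "(\<Union>n. C n) = range (Q (\<alpha> m))" using mono_Q[OF m] \<alpha>(2) by blast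
      then show ?thesis using closed_Q[OF \<alpha>(1)] \<alpha>(1) by (auto simp: \<C>_def)
    next
      case False
      then obtain \<delta> where \<delta>: "limit_point_of_order omega1 \<delta>" "\<And>n. \<alpha> n \<in> underS omega1 \<delta>"
          "\<And>\<xi>. \<xi> \<in> underS omega1 \<delta> \<Longrightarrow> \<exists>n. (\<xi>, \<alpha> n) \<in> omega1"
        using omega1_supremum[of \<alpha>, OF \<alpha>(1)] by metis
      have "range (P \<delta>) = closure (\<Union>\<xi>\<in>underS omega1 \<delta>. range (P \<xi>))"
        using P \<delta>(1) by (simp add: projectional_resolution_def)
      then have "range (Q \<delta>) = closure (\<Union>\<xi>\<in>underS omega1 \<delta>. range (Q \<xi>))"
        unfolding range_Q by (simp add: G_closure image_UN)
      also have "(\<Union>\<xi>\<in>underS omega1 \<delta>. range (Q \<xi>)) = (\<Union>n. C n)"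
      proof
        show "(\<Union>\<xi>\<in>underS omega1 \<delta>. range (Q \<xi>)) \<subseteq> (\<Union>n. C n)"
        proof (rule UN_least)
          fix \<xi> assume "\<xi> \<in> underS omega1 \<delta>"
          then obtain n where "(\<xi>, \<alpha> n) \<in> omega1" using \<delta>(3) by blast
          then have "range (Q \<xi>) \<subseteq> C n" using mono_Q \<alpha>(2) by simp
          then show "range (Q \<xi>) \<subseteq> (\<Union>n. C n)" by blast
        qed
        show "(\<Union>n. C n) \<subseteq> (\<Union>\<xi>\<in>underS omega1 \<delta>. range (Q \<xi>))" using \<alpha>(2) \<delta>(2) by blast
      qed
      finally have "closure (\<Union>n. C n) = range (Q \<delta>)" by (rule sym)
      moreover have "\<delta> \<in> Field omega1" using \<delta>(1) unfolding limit_point_of_order_def by blast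
      ultimately show ?thesis unfolding \<C>_def by blast
    qed
  qed
  moreover have "\<forall>C\<in>\<C>. complemented C"
    unfolding \<C>_def complemented_def using projection_Q by blast
  ultimately show ?thesis by blast
qed

section \<open>Weight of a densely ordered compact line\<close>

context order_continuum
begin

lemma topological_basis_from_dense:
  fixes D :: "'k set"
  assumes D: "\<And>x y. x < y \<Longrightarrow> \<exists>d\<in>D. x < d \<and> d < y"
  defines "R \<equiv> insert UNIV (lessThan ` D \<union> greaterThan ` D)"
  shows "topological_basis ((\<lambda>(A, B). A \<inter> B) ` (R \<times> R))"
proof (rule topological_basisI)
  show "open B" if "B \<in> (\<lambda>(A, B). A \<inter> B) ` (R \<times> R)" for B
    using that by (auto simp: R_def intro!: open_Int open_lessThan open_greaterThan)
  fix O' and x :: 'k assume "open O'" "x \<in> O'"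
  then obtain A B where AB: "A = UNIV \<or> (\<exists>c<x. A = {c<..})" "B = UNIV \<or> (\<exists>d>x. B = {..<d})" "A \<inter> B \<subseteq> O'"
    using two_sided_neighbourhood[OF \<open>open O'\<close> \<open>x \<in> O'\<close>] by (elim exE conjE)
  have "\<exists>A'\<in>R. x \<in> A' \<and> A' \<subseteq> A"
  proof (cases "A = UNIV")
    case False
    then obtain c where c: "c < x" "A = {c<..}" using AB by blast
    then obtain d where "d \<in> D" "c < d" "d < x" using D by blast
    then show ?thesis using c by (intro bexI[of _ "{d<..}"]) (auto simp: R_def)
  qed (auto simp: R_def)
  moreover have "\<exists>B'\<in>R. x \<in> B' \<and> B' \<subseteq> B"
  proof (cases "B = UNIV")
    case False
    then obtain c where c: "x < c" "B = {..<c}" using AB by blast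
    then obtain d where "d \<in> D" "x < d" "d < c" using D by blast
    then show ?thesis using c by (intro bexI[of _ "{..<d}"]) (auto simp: R_def)
  qed (auto simp: R_def)
  ultimately obtain A' B' where "A' \<in> R" "B' \<in> R" "x \<in> A' \<inter> B'" "A' \<inter> B' \<subseteq> O'"
    using AB(3) by blast
  then show "\<exists>B\<in>(\<lambda>(A, B). A \<inter> B) ` (R \<times> R). x \<in> B \<and> B \<subseteq> O'" by auto
qed

text \<open>Intervals with end points in a dense set form a basis, which bounds the weight from above; a countable
  basis would give a countable dense subset.\<close>

lemma has_weight_omega1:
  assumes D: "|D| \<le>o omega1" "\<And>x y. x < y \<Longrightarrow> \<exists>d\<in>D. x < d \<and> d < (y::'k)"
    and nonseparable: "\<And>u v N. u < v \<Longrightarrow> countable N \<Longrightarrow> \<exists>x y::'k. u < x \<and> x < y \<and> y < v \<and> {x<..<y} \<inter> N = {}"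
    and nontrivial: "m0 < (n0::'k)"
  shows "has_weight TYPE('k) omega1"
proof -
  have lower: "omega1 \<le>o |B|" if B: "topological_basis B" for B :: "'k set set"
    unfolding uncountable_iff_omega1_le[symmetric]
  proof
    assume "countable B"
    then have N: "countable ((\<lambda>U. SOME x. x \<in> U) ` B)" by simp
    obtain x y where xy: "x < y" "{x<..<y} \<inter> (\<lambda>U. SOME x. x \<in> U) ` B = {}"
      using nonseparable[OF nontrivial N] by blast
    obtain z where z: "x < z" "z < y" using between[OF xy(1)] by blast
    then have "z \<in> {x<..<y}" by simp
    then obtain U where U: "U \<in> B" "z \<in> U" "U \<subseteq> {x<..<y}"
      by (rule topological_basisE[OF B open_interval])
    then have "(SOME x. x \<in> U) \<in> U" by (metis someI)
    then show False using U xy(2) by blast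
  qed
  define R where "R = insert UNIV (lessThan ` D \<union> greaterThan ` D)"
  have inf: "\<not> finite (Field omega1)" using uncountable_Field_omega1 countable_finite by blast
  have small: "|lessThan ` D| \<le>o omega1" "|greaterThan ` D| \<le>o omega1"
    using ordLeq_transitive[OF card_of_image D(1)] by blast+
  have "|{UNIV :: 'k set}| \<le>o omega1"
    using countable_iff_less_omega1[of "{UNIV :: 'k set}"] by (simp add: ordLess_imp_ordLeq)
  moreover have "|lessThan ` D \<union> greaterThan ` D| \<le>o omega1"
    by (rule card_of_Un_ordLeq_infinite_Field[OF inf small Card_order_omega1])
  ultimately have "|{UNIV} \<union> (lessThan ` D \<union> greaterThan ` D)| \<le>o omega1"
    by (rule card_of_Un_ordLeq_infinite_Field[OF inf _ _ Card_order_omega1])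
  moreover have "R = {UNIV} \<union> (lessThan ` D \<union> greaterThan ` D)" by (simp add: R_def)
  ultimately have R: "|R| \<le>o omega1" by (simp only:)
  have "|R \<times> R| \<le>o omega1"
    by (rule card_of_Times_ordLeq_infinite_Field[OF inf R R Card_order_omega1])
  then have upper: "|(\<lambda>(A, B). A \<inter> B) ` (R \<times> R)| \<le>o omega1"
    by (rule ordLeq_transitive[OF card_of_image])
  have basis: "topological_basis ((\<lambda>(A, B). A \<inter> B) ` (R \<times> R))"
    unfolding R_def by (rule topological_basis_from_dense[OF D(2)])
  have "|(\<lambda>(A, B). A \<inter> B) ` (R \<times> R)| =o omega1"
    using upper lower[OF basis] by (simp add: ordIso_iff_ordLeq)
  then show ?thesis unfolding has_weight_def using basis lower by blast
qed

end

section \<open>Collapsing the jumps of a compact line without isolated points\<close>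

locale perfect_compact_line =
  fixes T :: "'v::linorder_topology itself"
  assumes no_isolated: "\<not> open {x :: 'v}"
    and compact_line: "compact (UNIV :: 'v set)"

context perfect_compact_line
begin

text \<open>An isolated point of a nonempty open interval would be isolated in the whole line, so a scattered
  interval has empty interior.\<close>

lemma scat_class_eq_iff_jump:
  assumes "x < (y :: 'v)"
  shows "scat_class x = scat_class y \<longleftrightarrow> {x<..<y} = {}"
proof -
  have mm: "{min x y..max x y} = {x..y}" using assms by (simp add: min_absorb1 max_absorb2 less_imp_le)
  show ?thesis
    unfolding scat_class_eq_iff scat_equiv_def mm
  proof
    assume scat: "scattered {x..y}"
    show "{x<..<y} = {}"
    proof (rule ccontr)
      assume "{x<..<y} \<noteq> {}"
      moreover have "{x<..<y} \<subseteq> {x..y}" by auto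
      ultimately obtain z where "z isolated_in {x<..<y}" using scat unfolding scattered_def by blast
      then obtain U where "open U" "U \<inter> {x<..<y} = {z}" unfolding isolated_in_def by blast
      then have "open {z}" by (metis open_Int open_greaterThanLessThan)
      then show False using no_isolated by blast
    qed
  next
    assume "{x<..<y} = {}"
    have xy: "{x..y} = {x, y}"
    proof (intro equalityI subsetI)
      fix z assume z: "z \<in> {x..y}"
      have "z \<notin> {x<..<y}" using \<open>{x<..<y} = {}\<close> by simp
      then show "z \<in> {x, y}" using z by auto
    qed (use assms in auto)
    show "scattered {x..y}"
      unfolding scattered_def xy
    proof (intro allI impI)
      fix A assume A: "A \<subseteq> {x, y}" "A \<noteq> {}"
      then obtain a where a: "a \<in> A" by blast
      have "finite A" using A(1) by (rule finite_subset) simp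
      then have "open (- (A - {a}))" by (intro open_Compl finite_imp_closed) simp
      moreover have "- (A - {a}) \<inter> A = {a}" using a by blast
      ultimately show "\<exists>x\<in>A. x isolated_in A"
        using a unfolding isolated_in_def by blast
    qed
  qed
qed

lemma scat_class_less_iff: "scat_class x < scat_class y \<longleftrightarrow> (\<exists>z. x < z \<and> z < (y :: 'v))"
proof -
  have "scat_class x < scat_class y \<longleftrightarrow> \<not> scat_class y \<le> scat_class x" by (simp add: not_le)
  also have "\<dots> \<longleftrightarrow> x < y \<and> scat_class x \<noteq> scat_class y" unfolding scat_class_le_iff by auto
  also have "\<dots> \<longleftrightarrow> x < y \<and> {x<..<y} \<noteq> {}" using scat_class_eq_iff_jump by blast
  also have "\<dots> \<longleftrightarrow> (\<exists>z. x < z \<and> z < y)" by auto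
  finally show ?thesis .
qed

lemma scat_class_mono: "x \<le> y \<Longrightarrow> scat_class x \<le> scat_class (y :: 'v)"
  by (simp add: scat_class_le_iff)

lemma scat_class_less_imp_less: "scat_class x < scat_class y \<Longrightarrow> x < (y :: 'v)"
  using scat_class_less_iff by fastforce

text \<open>A third point of a class would lie strictly between two equivalent points, so an equivalent
  point above a given one is already the greatest.\<close>

lemma greatest_representative:
  "\<exists>x :: 'v. scat_class x = k \<and> (\<forall>y>x. scat_class x < scat_class y)"
proof -
  obtain x0 :: 'v where x0: "k = scat_class x0" by (rule scat_class_cases)
  have greater: "scat_class x < scat_class y" if "x < y" "scat_class x \<noteq> scat_class y" for x y :: 'v
    using scat_class_mono[OF less_imp_le[OF that(1)]] that(2) by (simp add: less_le)
  show ?thesis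
  proof (cases "\<exists>y>x0. scat_class y = k")
    case True
    then obtain y where y: "x0 < y" "scat_class y = k" by blast
    have "scat_class y < scat_class z" if "y < z" for z
      using y that unfolding y(2) x0 scat_class_less_iff by blast
    then show ?thesis using y(2) by blast
  next
    case False
    then show ?thesis using greater x0 by (intro exI[of _ x0]) metis
  qed
qed

lemma least_representative:
  "\<exists>x :: 'v. scat_class x = k \<and> (\<forall>y<x. scat_class y < scat_class x)"
proof -
  obtain x0 :: 'v where x0: "k = scat_class x0" by (rule scat_class_cases)
  have less: "scat_class y < scat_class x" if "y < x" "scat_class y \<noteq> scat_class x" for x y :: 'v
    using scat_class_mono[OF less_imp_le[OF that(1)]] that(2) by (simp add: less_le)
  show ?thesis
  proof (cases "\<exists>y<x0. scat_class y = k")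
    case True
    then obtain y where y: "y < x0" "scat_class y = k" by blast
    have "scat_class z < scat_class y" if "z < y" for z
      using y that unfolding y(2) x0 scat_class_less_iff by blast
    then show ?thesis using y(2) by blast
  next
    case False
    then show ?thesis using less x0 by (intro exI[of _ x0]) metis
  qed
qed

lemma fibre_card: "finite {x :: 'v. scat_class x = k} \<and> card {x :: 'v. scat_class x = k} \<le> 2"
proof -
  obtain x :: 'v where x: "scat_class x = k" "\<forall>y>x. scat_class x < scat_class y"
    using greatest_representative by blast
  have "\<exists>y. {x. scat_class x = k} \<subseteq> {x, y}"
  proof (cases "\<exists>y<x. scat_class y = k")
    case True
    then obtain y where y: "y < x" "scat_class y = k" by blast
    have "z = x \<or> z = y" if z: "scat_class z = k" for z
    proof (rule ccontr)
      assume ne: "\<not> ?thesis"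
      have "\<not> x < z" using x z by force
      moreover have "z \<noteq> x" using ne by simp
      ultimately have "z < x" by (metis linorder_neqE)
      consider "z < y" | "y < z" using ne by (metis linorder_neqE)
      then show False
      proof cases
        case 1
        then have "scat_class z < scat_class x" using y(1) scat_class_less_iff by blast
        then show False using z x(1) by simp
      next
        case 2
        then have "scat_class y < scat_class x" using \<open>z < x\<close> scat_class_less_iff by blast
        then show False using y(2) x(1) by simp
      qed
    qed
    then show ?thesis by blast
  next
    case False
    then have "{y. scat_class y = k} \<subseteq> {x, x}" using x by (auto, metis linorder_neqE order.irrefl)
    then show ?thesis by blast
  qed
  then obtain y where y: "{x. scat_class x = k} \<subseteq> {x, y}" by blast
  have "finite {x, y}" by simp
  then show ?thesis using y finite_subset card_mono[OF _ y] card_insert_le_m1[of 2 "{y}" x]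
    by (auto simp: card_insert_if intro: order_trans)
qed

lemma continuous_scat_class: "continuous_on UNIV (scat_class :: 'v \<Rightarrow> 'v scat_quotient)"
  by (simp add: continuous_on_open_vimage open_scat_quotient_def)

lemma continuous_vimage: "open U \<Longrightarrow> open (scat_class -` U :: 'v set)"
  by (simp add: open_scat_quotient_def)

text \<open>A finite nonempty open set would consist of isolated points, so two points with one point between them
  have at least three points between them. The middle one of three stays strictly between after jumps
  are collapsed.\<close>

lemma three_between:
  assumes "x < z" "z < (y :: 'v)"
  shows "\<exists>p w q. x < p \<and> p < w \<and> w < q \<and> q < y"
proof -
  have z: "z \<in> {x<..<y}" using assms by simp
  have "{x<..<y} \<noteq> {z}" using no_isolated[of z] by (metis open_greaterThanLessThan)
  then obtain w where w: "w \<in> {x<..<y}" "w \<noteq> z" using z by blast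
  have "open ({x<..<y} - {w})" by (intro open_Diff) auto
  then have "{x<..<y} - {w} \<noteq> {z}" using no_isolated[of z] by metis
  then obtain t where t: "t \<in> {x<..<y}" "t \<noteq> w" "t \<noteq> z" using z w by blast
  have b: "x < z" "x < w" "x < t" "z < y" "w < y" "t < y" using z w t by auto
  consider "z < w" | "w < z" using w(2) by (metis linorder_neqE)
  then show ?thesis
  proof cases
    case 1
    consider "t < z" | "z < t" "t < w" | "w < t" using t by (metis linorder_neqE)
    then show ?thesis using 1 b by cases blast+
  next
    case 2
    consider "t < w" | "w < t" "t < z" | "z < t" using t by (metis linorder_neqE)
    then show ?thesis using 2 b by cases blast+
  qed
qed

end

text \<open>One-sided neighbourhoods are transported from the line by means of the greatest and the least
  representative of a class: beyond such a representative, all points are mapped to different classes.\<close>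

sublocale perfect_compact_line \<subseteq> quotient: order_continuum "TYPE('v scat_quotient)"
proof
  fix a b u v x y :: "'v scat_quotient" and U :: "'v scat_quotient set"
  obtain a' where a': "a = scat_class a'" by (rule scat_class_cases)
  have "scat_class -` {..<a} = (\<Union>z\<in>{..<a'}. {..<z})"
    unfolding a' by (auto simp: scat_class_less_iff)
  then show "open {..<a}" by (simp add: open_scat_quotient_def open_UN)
  have "scat_class -` {a<..} = (\<Union>z\<in>{a'<..}. {z<..})"
    unfolding a' by (auto simp: scat_class_less_iff)
  then show "open {a<..}" by (simp add: open_scat_quotient_def open_UN)
  show "compact (UNIV :: 'v scat_quotient set)"
  proof -
    have "k \<in> range (scat_class :: 'v \<Rightarrow> _)" for k by (rule scat_class_cases[of k]) simp
    then have "range (scat_class :: 'v \<Rightarrow> _) = UNIV" by blast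
    then show ?thesis using compact_continuous_image[OF continuous_scat_class compact_line] by simp
  qed
  show "\<exists>z. x < z \<and> z < y" if "x < y"
  proof -
    obtain x' where x': "x = scat_class x'" by (rule scat_class_cases)
    obtain y' where y': "y = scat_class y'" by (rule scat_class_cases)
    note xy = x' y'
    have "scat_class x' < scat_class y'" using that unfolding xy .
    then obtain z where z: "x' < z" "z < y'" unfolding scat_class_less_iff by (elim exE conjE)
    obtain p w q where "x' < p" "p < w" "w < q" "q < y'"
      using three_between[OF z] by (elim exE conjE)
    then have "scat_class x' < scat_class w" "scat_class w < scat_class y'"
      unfolding scat_class_less_iff by auto
    then show ?thesis unfolding xy by (intro exI conjI)
  qed
  show "\<exists>c>b. {b..<c} \<subseteq> U" if U: "open U" "b \<in> U" "b < v"
  proof -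
    obtain x where x: "scat_class x = b" "\<forall>y>x. scat_class x < scat_class y"
      using greatest_representative by blast
    obtain y where y: "v = scat_class y" by (rule scat_class_cases)
    have "x < y" using U(3) x(1) y scat_class_less_imp_less by simp
    then obtain z where z: "x < z" "{x..<z} \<subseteq> scat_class -` U"
      using open_right[OF continuous_vimage[OF U(1)], of x y] U(2) x(1) by auto
    have "w \<in> U" if w: "b \<le> w" "w < scat_class z" for w
    proof (cases "w = b")
      case False
      obtain t where t: "w = scat_class t" by (rule scat_class_cases)
      have "x < t" using False w(1) scat_class_less_imp_less[of x t] x(1) t by simp
      moreover have "t < z" using w(2) t scat_class_less_imp_less by simp
      ultimately show ?thesis using z(2) t by (auto simp: subset_iff less_imp_le)
    qed (use U in simp)
    then show ?thesis using x z(1) by (intro exI[of _ "scat_class z"]) auto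
  qed
  show "\<exists>c<b. {c<..b} \<subseteq> U" if U: "open U" "b \<in> U" "u < b"
  proof -
    obtain x where x: "scat_class x = b" "\<forall>y<x. scat_class y < scat_class x"
      using least_representative by blast
    obtain y where y: "u = scat_class y" by (rule scat_class_cases)
    have "y < x" using U(3) x(1) y scat_class_less_imp_less by simp
    then obtain z where z: "z < x" "{z<..x} \<subseteq> scat_class -` U"
      using open_left[OF continuous_vimage[OF U(1)], of x y] U(2) x(1) by auto
    have "w \<in> U" if w: "w \<le> b" "scat_class z < w" for w
    proof (cases "w = b")
      case False
      obtain t where t: "w = scat_class t" by (rule scat_class_cases)
      have "t < x" using False w(1) scat_class_less_imp_less[of t x] x(1) t by simp
      moreover have "z < t" using w(2) t scat_class_less_imp_less by simp
      ultimately show ?thesis using z(2) t by (auto simp: subset_iff less_imp_le)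
    qed (use U in simp)
    then show ?thesis using x z(1) by (intro exI[of _ "scat_class z"]) auto
  qed
qed

context perfect_compact_line
begin

text \<open>The image of a copy of \<open>\<omega>\<^sub>1\<close> is well-ordered and, since fibres are finite, uncountable.\<close>

lemma nonseparable_quotient:
  fixes u v :: "'v scat_quotient"
  assumes copies: "\<And>U :: 'v set. open U \<Longrightarrow> U \<noteq> {} \<Longrightarrow>
      \<exists>f :: nat set \<Rightarrow> 'v. f ` Field omega1 \<subseteq> U \<and> (\<forall>\<alpha> \<beta>. (\<alpha>, \<beta>) \<in> omega1 \<and> \<alpha> \<noteq> \<beta> \<longrightarrow> f \<alpha> < f \<beta>)"
    and uv: "u < v" and N: "countable N"
  shows "\<exists>x y. u < x \<and> x < y \<and> y < v \<and> {x<..<y} \<inter> N = {}"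
proof (rule ccontr)
  assume contra: "\<not> ?thesis"
  have ne: "scat_class -` {u<..<v} \<noteq> ({} :: 'v set)"
  proof -
    obtain z where z: "u < z" "z < v" using quotient.between[OF uv] by blast
    obtain z' where "z = scat_class z'" by (rule scat_class_cases)
    then show ?thesis using z by auto
  qed
  obtain f where f: "f ` Field omega1 \<subseteq> (scat_class -` {u<..<v} :: 'v set)"
      "\<forall>\<alpha> \<beta>. (\<alpha>, \<beta>) \<in> omega1 \<and> \<alpha> \<noteq> \<beta> \<longrightarrow> f \<alpha> < f \<beta>"
    using copies[OF continuous_vimage[OF quotient.open_interval] ne] by (elim exE conjE)
  define S where "S = scat_class ` f ` Field omega1"
  have "countable S"
  proof (rule quotient.countable_if_well_ordered[OF _ _ N])
    show "S \<subseteq> {u<..<v}" using f(1) by (auto simp: S_def)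
    show "\<exists>m\<in>R. \<forall>x\<in>R. m \<le> x" if R: "R \<subseteq> S" "R \<noteq> {}" for R
    proof -
      have "{\<alpha> \<in> Field omega1. scat_class (f \<alpha>) \<in> R} \<noteq> {}" using R by (auto simp: S_def)
      then obtain \<delta> where \<delta>: "\<delta> \<in> {\<alpha> \<in> Field omega1. scat_class (f \<alpha>) \<in> R}"
          "\<forall>\<beta>\<in>{\<alpha> \<in> Field omega1. scat_class (f \<alpha>) \<in> R}. (\<delta>, \<beta>) \<in> omega1"
        using omega1_least[of "{\<alpha> \<in> Field omega1. scat_class (f \<alpha>) \<in> R}"] by auto
      have "scat_class (f \<delta>) \<le> x" if "x \<in> R" for x
      proof -
        obtain \<beta> where \<beta>: "\<beta> \<in> Field omega1" "x = scat_class (f \<beta>)" using R(1) \<open>x \<in> R\<close> by (auto simp: S_def)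
        then have "(\<delta>, \<beta>) \<in> omega1" using \<delta>(2) \<open>x \<in> R\<close> by blast
        then have "f \<delta> \<le> f \<beta>" using f(2) by (cases "\<delta> = \<beta>") (auto intro: less_imp_le)
        then show ?thesis using \<beta>(2) scat_class_mono by blast
      qed
      then show ?thesis using \<delta>(1) by blast
    qed
    show "{x<..<y} \<inter> N \<noteq> {}" if "u < x" "x < y" "y < v" for x y using contra that by blast
  qed
  then have "countable (\<Union>k\<in>S. {x :: 'v. scat_class x = k})"
    using fibre_card by (intro countable_UN) (auto intro: countable_finite)
  moreover have "f ` Field omega1 \<subseteq> (\<Union>k\<in>S. {x. scat_class x = k})" by (auto simp: S_def)
  ultimately have "countable (f ` Field omega1)" by (rule countable_subset[rotated])
  moreover have "inj_on f (Field omega1)"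
  proof (rule inj_onI)
    fix \<alpha> \<beta> assume *: "\<alpha> \<in> Field omega1" "\<beta> \<in> Field omega1" "f \<alpha> = f \<beta>"
    show "\<alpha> = \<beta>"
    proof (rule ccontr)
      assume ne: "\<alpha> \<noteq> \<beta>"
      then have "(\<alpha>, \<beta>) \<in> omega1 \<or> (\<beta>, \<alpha>) \<in> omega1"
        using omega1_linear[OF *(1,2)] by (auto simp: underS_def)
      then have "f \<alpha> < f \<beta> \<or> f \<beta> < f \<alpha>" using f(2) ne by metis
      then show False using *(3) by simp
    qed
  qed
  ultimately show False using uncountable_Field_omega1 countable_image_inj_on by blast
qed

lemma quotient_nontrivial: "\<exists>m n :: 'v scat_quotient. m < n"
proof -
  obtain z :: 'v where True by simp
  have "UNIV \<noteq> {z}" using no_isolated[of z] by (metis open_UNIV)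
  then obtain w where w: "w \<noteq> z" by blast
  have "open (UNIV - {w})" by (intro open_Diff) auto
  then have "UNIV - {w} \<noteq> {z}" using no_isolated[of z] by metis
  then obtain t where t: "t \<noteq> w" "t \<noteq> z" using w by blast
  then have "\<exists>x y z :: 'v. x < y \<and> y < z" using w by (metis linorder_neqE)
  then show ?thesis using scat_class_less_iff by blast
qed

lemma quotient_weight:
  assumes weight: "has_weight TYPE('v) omega1"
    and nonseparable: "\<And>u v N. u < v \<Longrightarrow> countable N \<Longrightarrow>
      \<exists>x y::'v scat_quotient. u < x \<and> x < y \<and> y < v \<and> {x<..<y} \<inter> N = {}"
  shows "has_weight TYPE('v scat_quotient) omega1"
proof -
  obtain B :: "'v set set" where B: "topological_basis B" "|B| =o omega1"
    using weight unfolding has_weight_def by blast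
  define D where "D = (\<lambda>U. scat_class (SOME x :: 'v. x \<in> U)) ` B"
  have small: "|D| \<le>o omega1"
    unfolding D_def by (rule ordLeq_ordIso_trans[OF card_of_image B(2)])
  have dense: "\<exists>d\<in>D. x < d \<and> d < y" if xy: "x < y" for x y
  proof -
    obtain z where z: "x < z" "z < y" using quotient.between[OF xy] by blast
    obtain z' where z': "z = scat_class z'" by (rule scat_class_cases)
    have "z' \<in> scat_class -` {x<..<y}" using z z' by simp
    then obtain U where U: "U \<in> B" "z' \<in> U" "U \<subseteq> scat_class -` {x<..<y}"
      by (rule topological_basisE[OF B(1) continuous_vimage[OF quotient.open_interval]])
    then have "(SOME x. x \<in> U) \<in> U" by (metis someI)
    then have "scat_class (SOME x. x \<in> U) \<in> {x<..<y}" using U(3) by blast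
    then show ?thesis using U(1) unfolding D_def by auto
  qed
  obtain m n :: "'v scat_quotient" where mn: "m < n" using quotient_nontrivial by blast
  show ?thesis by (rule quotient.has_weight_omega1[OF small dense nonseparable mn]) assumption+
qed

end

section \<open>Countable families of clopen initial segments\<close>

lemma countable_binary_closure:
  fixes \<phi> :: "'a \<Rightarrow> 'a \<Rightarrow> 'a set"
  assumes "countable A0" and \<phi>: "\<And>a b. a \<in> Z \<Longrightarrow> b \<in> Z \<Longrightarrow> countable (\<phi> a b) \<and> \<phi> a b \<subseteq> Z" and "A0 \<subseteq> Z"
  shows "\<exists>A. A0 \<subseteq> A \<and> countable A \<and> A \<subseteq> Z \<and> (\<forall>a\<in>A. \<forall>b\<in>A. \<phi> a b \<subseteq> A)"
proof -
  define E where "E = rec_nat A0 (\<lambda>_ A. A \<union> (\<Union>a\<in>A. \<Union>b\<in>A. \<phi> a b))"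
  have E0: "E 0 = A0" and E_Suc: "E (Suc n) = E n \<union> (\<Union>a\<in>E n. \<Union>b\<in>E n. \<phi> a b)" for n
    by (simp_all add: E_def)
  have E_Z: "countable (E n) \<and> E n \<subseteq> Z" for n
  proof (induction n)
    case 0
    then show ?case using assms by (simp add: E0)
  next
    case (Suc n)
    have "countable (\<Union>a\<in>E n. \<Union>b\<in>E n. \<phi> a b)"
      using Suc \<phi> by (intro countable_UN) auto
    moreover have "(\<Union>a\<in>E n. \<Union>b\<in>E n. \<phi> a b) \<subseteq> Z" using Suc \<phi> by blast
    ultimately show ?case using Suc by (simp add: E_Suc)
  qed
  have E_mono: "E m \<subseteq> E n" if "m \<le> n" for m n
    by (rule lift_Suc_mono_le[OF _ that]) (auto simp: E_Suc)
  have "\<phi> a b \<subseteq> (\<Union>n. E n)" if ab: "a \<in> (\<Union>n. E n)" "b \<in> (\<Union>n. E n)" for a b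
  proof -
    obtain m n where "a \<in> E m" "b \<in> E n" using ab by blast
    then have "a \<in> E (max m n)" "b \<in> E (max m n)"
      using E_mono[of m "max m n"] E_mono[of n "max m n"] by auto
    then have "\<phi> a b \<subseteq> E (Suc (max m n))" unfolding E_Suc by blast
    then show ?thesis by blast
  qed
  moreover have "A0 \<subseteq> (\<Union>n. E n)" using E0 by blast
  moreover have "countable (\<Union>n. E n)" "(\<Union>n. E n) \<subseteq> Z" using E_Z by auto
  ultimately show ?thesis by (intro exI[of _ "\<Union>n. E n"]) blast
qed

definition clopen_initial_segments :: "'v::linorder_topology set set" where
  "clopen_initial_segments = {U. open U \<and> closed U \<and> (\<forall>a b. a \<le> b \<longrightarrow> b \<in> U \<longrightarrow> a \<in> U)}"

context perfect_compact_line
begin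

text \<open>Let \<open>d\<close> be the first point after \<open>x\<close> outside a clopen neighbourhood of \<open>x\<close> that does not reach
  \<open>y\<close>. As the complement of the neighbourhood is open, \<open>d\<close> has an immediate predecessor, and the segment
  below \<open>d\<close> is clopen.\<close>

lemma clopen_initial_segment_between:
  fixes x y :: 'v
  assumes zd: "(euclidean :: 'v topology) dim_le 0" and xy: "x < y"
  shows "\<exists>U\<in>clopen_initial_segments. x \<in> U \<and> y \<notin> U"
proof -
  have "neighbourhood_base_of (\<lambda>U. closedin euclidean U \<and> openin euclidean U) (euclidean :: 'v topology)"
    using zd by (simp add: dimension_le_0_neighbourhood_base_of_clopen)
  then have "\<exists>U V. openin euclidean U \<and> (closedin euclidean V \<and> openin euclidean V) \<and> x \<in> U \<and> U \<subseteq> V \<and> V \<subseteq> {..<y}"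
    using xy unfolding neighbourhood_base_of by simp
  then obtain V where V: "closed V" "open V" "x \<in> V" "V \<subseteq> {..<y}" by auto
  have "compact (UNIV \<inter> ({x..} \<inter> - V))"
    using V(2) by (intro compact_Int_closed[OF compact_line] closed_Int closed_atLeast) (simp add: closed_Compl)
  moreover have "y \<in> {x..} \<inter> - V" using V(4) xy by auto
  ultimately obtain d where d: "d \<in> {x..} \<inter> - V" "\<forall>z\<in>{x..} \<inter> - V. d \<le> z"
    using compact_attains_inf[of "{x..} \<inter> - V"] by auto
  have "x < d" using d(1) V(3) by (auto simp: le_less)
  have "open (- V)" "d \<in> - V" using V(1) d(1) by (auto simp: open_Compl)
  then obtain e where e: "e < d" "{e<..d} \<subseteq> - V" using open_left[of "- V" d x] \<open>x < d\<close> by blast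
  have "{..<d} = {..max e x}"
  proof (intro equalityI subsetI)
    fix z assume z: "z \<in> {..<d}"
    show "z \<in> {..max e x}"
    proof (rule ccontr)
      assume "z \<notin> {..max e x}"
      then have "e < z" "x < z" by (auto simp: not_le)
      then have "z \<in> {x..} \<inter> - V" using e(2) z by (auto simp: subset_iff less_imp_le)
      then have "d \<le> z" using d(2) by blast
      then show False using z by (simp add: leD)
    qed
  next
    fix z assume "z \<in> {..max e x}"
    moreover have "max e x < d" using e(1) \<open>x < d\<close> by simp
    ultimately show "z \<in> {..<d}" by (auto intro: le_less_trans)
  qed
  then have "closed {..<d}" by (metis closed_atMost)
  then have "{..<d} \<in> clopen_initial_segments" by (auto simp: clopen_initial_segments_def)
  moreover have "y \<notin> {..<d}" using d(2) \<open>y \<in> {x..} \<inter> - V\<close> by (auto simp: not_less)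
  ultimately show ?thesis using \<open>x < d\<close> by blast
qed

definition split_set :: "'v set \<Rightarrow> ('v \<times> 'v) set" where
  "split_set U = U \<times> (- U) \<union> (- U) \<times> U"

lemma mem_split_set: "(x, y) \<in> split_set U \<longleftrightarrow> (x \<in> U) \<noteq> (y \<in> U)"
  by (auto simp: split_set_def)

lemma open_split_set: "U \<in> clopen_initial_segments \<Longrightarrow> open (split_set U)"
  unfolding split_set_def clopen_initial_segments_def by (auto intro!: open_Un open_Times open_Compl)

lemma split_by_segment:
  assumes zd: "(euclidean :: 'v topology) dim_le 0" and "x \<noteq> y"
  shows "\<exists>U\<in>clopen_initial_segments. (x, y) \<in> split_set U"
proof -
  consider "x < y" | "y < x" using assms(2) by (rule linorder_neqE)
  then show ?thesis
    using clopen_initial_segment_between[OF zd, of x y] clopen_initial_segment_between[OF zd, of y x]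
    unfolding mem_split_set by cases blast+
qed

lemma countably_many_segments:
  fixes g :: "'v \<Rightarrow> real"
  assumes zd: "(euclidean :: 'v topology) dim_le 0" and g: "continuous_on UNIV g"
  shows "\<exists>B\<subseteq>clopen_initial_segments. countable B \<and> (\<forall>x y. g x \<noteq> g y \<longrightarrow> (\<exists>U\<in>B. (x, y) \<in> split_set U))"
proof (rule countably_many_separators[OF compact_line g])
  show "open (split_set U)" if "U \<in> clopen_initial_segments" for U by (rule open_split_set[OF that])
  show "\<exists>U\<in>clopen_initial_segments. (x, y) \<in> split_set U" if "g x \<noteq> g y" for x y
    using split_by_segment[OF zd] that by metis
qed

text \<open>This is the only place where the Valdivia embedding is used. Points of countable support are dense, so
  one can be picked in every nonempty difference of two clopen segments; the countable family \<open>\<U>\<close>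
  is closed under the requirement that it determines every coordinate in the support of a point picked
  for it. The closure \<open>F\<close> of the set of all picked points then works: two points of \<open>F\<close> differ in some
  coordinate, which cannot vanish at all picked points and is therefore determined by \<open>\<U>\<close>.\<close>

lemma determining_segments_and_net:
  assumes zd: "(euclidean :: 'v topology) dim_le 0" and vc: "valdivia_compact (euclidean :: 'v topology)"
    and countable: "countable D" and continuous: "\<forall>f\<in>D. continuous_on UNIV (f :: 'v \<Rightarrow> real)"
  shows "\<exists>\<U> F. \<U> \<subseteq> clopen_initial_segments \<and> countable \<U> \<and> closed F \<and>
    (\<forall>f\<in>D. \<forall>x y. f x \<noteq> f y \<longrightarrow> (\<exists>U\<in>\<U>. (x, y) \<in> split_set U)) \<and>
    (\<forall>U\<in>\<U>. \<forall>U'\<in>\<U>. U' - U \<noteq> {} \<longrightarrow> F \<inter> (U' - U) \<noteq> {}) \<and>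
    (\<forall>x\<in>F. \<forall>y\<in>F. x \<noteq> y \<longrightarrow> (\<exists>U\<in>\<U>. (x, y) \<in> split_set U))"
proof -
  note D = countable continuous[THEN bspec]
  let ?Seg = "clopen_initial_segments :: 'v set set"
  obtain I :: "('v \<Rightarrow> real) set" and j :: "'v \<Rightarrow> ('v \<Rightarrow> real) \<Rightarrow> real"
    where emb: "embedding_map euclidean (product_topology (\<lambda>_. top_of_set {0..1}) I) j"
      and dense: "closure {x. countable {i \<in> I. j x i \<noteq> 0}} = UNIV"
    using vc unfolding valdivia_compact_def by auto
  have hom: "homeomorphic_map euclidean (subtopology (product_topology (\<lambda>_. top_of_set {0..1}) I) (range j)) j"
    using emb by (simp add: embedding_map_def)
  have "continuous_map euclidean (product_topology (\<lambda>_. top_of_set {0..1::real}) I) j"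
    using homeomorphic_imp_continuous_map[OF hom] by (simp add: continuous_map_in_subtopology)
  then have j: "range j \<subseteq> extensional I" "\<And>i. i \<in> I \<Longrightarrow> continuous_on UNIV (\<lambda>x. j x i)"
    by (auto simp: continuous_map_componentwise continuous_map_in_subtopology)
  have inj_j: "inj j" using homeomorphic_imp_injective_map[OF hom] by simp
  have separated: "\<exists>i\<in>I. j x i \<noteq> j y i" if "x \<noteq> y" for x y
  proof (rule ccontr)
    assume "\<not> ?thesis"
    moreover have "j x \<in> extensional I" "j y \<in> extensional I" using j(1) by auto
    ultimately have "j x = j y" by (intro extensionalityI) auto
    then show False using inj_j that by (simp add: inj_eq)
  qed
  define supp where "supp x = {i \<in> I. j x i \<noteq> 0}" for x
  define segs where "segs g = (SOME B. B \<subseteq> ?Seg \<and> countable B \<and> (\<forall>x y. g x \<noteq> g y \<longrightarrow> (\<exists>U\<in>B. (x, y) \<in> split_set U)))"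
    for g :: "'v \<Rightarrow> real"
  have segs_props: "segs g \<subseteq> ?Seg \<and> countable (segs g) \<and> (\<forall>x y. g x \<noteq> g y \<longrightarrow> (\<exists>U\<in>segs g. (x, y) \<in> split_set U))"
    if "continuous_on UNIV g" for g
    unfolding segs_def by (rule someI_ex[OF countably_many_segments[OF zd that]])
  note segs = segs_props[THEN conjunct1] segs_props[THEN conjunct2, THEN conjunct1]
    segs_props[THEN conjunct2, THEN conjunct2]
  define pick where "pick U U' = (SOME x. x \<in> U' - U \<and> countable (supp x))" for U U'
  have pick: "pick U U' \<in> U' - U \<and> countable (supp (pick U U'))"
    if "U \<in> ?Seg" "U' \<in> ?Seg" "U' - U \<noteq> {}" for U U'
  proof -
    have "open (U' - U)" using that by (auto simp: clopen_initial_segments_def)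
    then have "(U' - U) \<inter> {x. countable {i \<in> I. j x i \<noteq> 0}} \<noteq> {}"
      using open_Int_closure_eq_empty[of "U' - U" "{x. countable {i \<in> I. j x i \<noteq> 0}}"] dense that(3) by simp
    then have "\<exists>x. x \<in> U' - U \<and> countable (supp x)" by (auto simp: supp_def)
    then show ?thesis unfolding pick_def by (rule someI_ex)
  qed
  define \<phi> where "\<phi> U U' = (if U' - U = {} then {} else \<Union>i\<in>supp (pick U U'). segs (\<lambda>x. j x i))" for U U'
  have \<phi>_Seg: "countable (\<phi> U U') \<and> \<phi> U U' \<subseteq> ?Seg" if "U \<in> ?Seg" "U' \<in> ?Seg" for U U'
  proof (cases "U' - U = {}")
    case False
    have "countable (\<Union>i\<in>supp (pick U U'). segs (\<lambda>x. j x i))"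
      using pick[OF that False] segs(2)[OF j(2)] by (intro countable_UN) (auto simp: supp_def)
    moreover have "(\<Union>i\<in>supp (pick U U'). segs (\<lambda>x. j x i)) \<subseteq> ?Seg"
      using segs(1)[OF j(2)] by (auto simp: supp_def)
    ultimately show ?thesis using False by (simp add: \<phi>_def)
  qed (simp add: \<phi>_def)
  have c0: "countable (\<Union>f\<in>D. segs f)" using D segs(2) by (intro countable_UN) auto
  have s0: "(\<Union>f\<in>D. segs f) \<subseteq> ?Seg" using segs(1)[OF D(2)] by blast
  have "\<exists>\<U>. (\<Union>f\<in>D. segs f) \<subseteq> \<U> \<and> countable \<U> \<and> \<U> \<subseteq> ?Seg \<and>
      (\<forall>U\<in>\<U>. \<forall>U'\<in>\<U>. \<phi> U U' \<subseteq> \<U>)"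
    by (rule countable_binary_closure[OF c0 \<phi>_Seg s0]) assumption+
  then obtain \<U> where \<U>: "(\<Union>f\<in>D. segs f) \<subseteq> \<U>" "countable \<U>" "\<U> \<subseteq> ?Seg"
      "\<forall>U\<in>\<U>. \<forall>U'\<in>\<U>. \<phi> U U' \<subseteq> \<U>"
    by (elim exE conjE)
  define N where "N = {pick U U' |U U'. U \<in> \<U> \<and> U' \<in> \<U> \<and> U' - U \<noteq> {}}"
  define F where "F = closure N"
  have "\<exists>U\<in>\<U>. (x, y) \<in> split_set U" if f: "f \<in> D" "f x \<noteq> f y" for f x y
    using segs(3)[OF D(2)[OF f(1)]] \<U>(1) f by blast
  moreover have "F \<inter> (U' - U) \<noteq> {}" if U: "U \<in> \<U>" "U' \<in> \<U>" "U' - U \<noteq> {}" for U U'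
  proof -
    have "pick U U' \<in> N" using U by (auto simp: N_def)
    then have "pick U U' \<in> F" unfolding F_def using closure_subset by blast
    then show ?thesis using pick[of U U'] U \<U>(3) by blast
  qed
  moreover have "\<exists>U\<in>\<U>. (x, y) \<in> split_set U" if xy: "x \<in> F" "y \<in> F" "x \<noteq> y" for x y
  proof -
    obtain i where i: "i \<in> I" "j x i \<noteq> j y i" using separated[OF xy(3)] by blast
    have "\<exists>n\<in>N. i \<in> supp n"
    proof (rule ccontr)
      assume "\<not> ?thesis"
      then have "N \<subseteq> {z. j z i = 0}" using i(1) by (auto simp: supp_def)
      moreover have "closed {z. j z i = 0}" by (intro closed_Collect_eq j(2)[OF i(1)] continuous_on_const)
      ultimately have "F \<subseteq> {z. j z i = 0}" unfolding F_def by (rule closure_minimal)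
      then have "j x i = 0" "j y i = 0" using xy(1,2) by blast+
      then show False using i(2) by simp
    qed
    then obtain U U' where U: "U \<in> \<U>" "U' \<in> \<U>" "U' - U \<noteq> {}" "i \<in> supp (pick U U')"
      by (auto simp: N_def)
    then have "segs (\<lambda>x. j x i) \<subseteq> \<phi> U U'" by (auto simp: \<phi>_def)
    then have "segs (\<lambda>x. j x i) \<subseteq> \<U>" using \<U>(4) U(1,2) by blast
    then show ?thesis using segs(3)[OF j(2)[OF i(1)]] i(2) by blast
  qed
  moreover have "closed F" by (simp add: F_def)
  ultimately show ?thesis using \<U>(2,3) by (intro exI[of _ \<U>] exI[of _ F]) blast
qed

text \<open>By compactness, finitely many segments suffice to separate all pairs of points of \<open>F\<close> on which \<open>g\<close>
  differs by at least \<open>e\<close>.\<close>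

lemma finite_cells:
  fixes g :: "'v \<Rightarrow> real"
  assumes \<U>: "\<U> \<subseteq> clopen_initial_segments" and F: "closed F"
    and sep: "\<forall>x\<in>F. \<forall>y\<in>F. x \<noteq> y \<longrightarrow> (\<exists>U\<in>\<U>. (x, y) \<in> split_set U)"
    and g: "continuous_on UNIV g" and e: "0 < e"
  shows "\<exists>\<V>\<subseteq>\<U>. finite \<V> \<and>
    (\<forall>x\<in>F. \<forall>y\<in>F. (\<forall>U\<in>\<V>. x \<in> U \<longleftrightarrow> y \<in> U) \<longrightarrow> \<bar>g x - g y\<bar> < e)"
proof -
  define D where "D = (F \<times> F) \<inter> {z. e \<le> \<bar>g (fst z) - g (snd z)\<bar>}"
  have c1: "continuous_on UNIV (\<lambda>z::'v \<times> 'v. g (fst z))"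
    by (rule continuous_on_compose2[OF g]) (auto intro: continuous_intros)
  have c2: "continuous_on UNIV (\<lambda>z::'v \<times> 'v. g (snd z))"
    by (rule continuous_on_compose2[OF g]) (auto intro: continuous_intros)
  have "closed D"
    unfolding D_def by (intro closed_Int closed_Times F closed_Collect_le continuous_intros c1 c2)
  moreover have "compact (UNIV :: ('v \<times> 'v) set)"
    using compact_Times[OF compact_line compact_line] by simp
  ultimately have "compact D" using compact_Int_closed[of UNIV D] by simp
  moreover have "D \<subseteq> (\<Union>U\<in>\<U>. split_set U)"
  proof
    fix z assume z: "z \<in> D"
    then have "fst z \<noteq> snd z" using e by (auto simp: D_def)
    then have "\<exists>U\<in>\<U>. (fst z, snd z) \<in> split_set U" using sep z by (auto simp: D_def)
    then show "z \<in> (\<Union>U\<in>\<U>. split_set U)" by simp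
  qed
  moreover have "open (split_set U)" if "U \<in> \<U>" for U using \<U> that open_split_set by blast
  ultimately obtain \<V> where \<V>: "\<V> \<subseteq> \<U>" "finite \<V>" "D \<subseteq> (\<Union>U\<in>\<V>. split_set U)"
    using compactE_image[of D \<U> split_set] by metis
  have "\<bar>g x - g y\<bar> < e" if xy: "x \<in> F" "y \<in> F" "\<forall>U\<in>\<V>. x \<in> U \<longleftrightarrow> y \<in> U" for x y
  proof (rule ccontr)
    assume "\<not> ?thesis"
    then have "(x, y) \<in> D" using xy by (simp add: D_def)
    then obtain U where "U \<in> \<V>" "(x, y) \<in> split_set U" using \<V>(3) by blast
    then show False using xy(3) by (simp add: mem_split_set)
  qed
  then show ?thesis using \<V>(1,2) by blast
qed

text \<open>Let \<open>a\<close> be the last representative of \<open>x\<close> and \<open>b\<close> the first one of \<open>y\<close>. Two different segments of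
  \<open>\<U>\<close> containing \<open>a\<close> but not \<open>b\<close> would have a point of \<open>F\<close> in their difference, which would be mapped
  into the gap. So at most one segment \<open>U\<close> separates points between \<open>a\<close> and \<open>b\<close>, and \<open>f\<close> takes at most
  two values there, one on \<open>U\<close> and one outside. These agree because the last point of \<open>U\<close> and the
  first point outside form a jump and are identified in the quotient.\<close>

lemma constant_across_gap:
  fixes f :: "'v scat_quotient \<Rightarrow> real"
  assumes \<U>: "\<U> \<subseteq> clopen_initial_segments"
    and det: "\<And>x y. f (scat_class x) \<noteq> f (scat_class y) \<Longrightarrow> \<exists>U\<in>\<U>. (x, y) \<in> split_set U"
    and meets: "\<forall>U\<in>\<U>. \<forall>U'\<in>\<U>. U' - U \<noteq> {} \<longrightarrow> F \<inter> (U' - U) \<noteq> {}"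
    and xy: "x < y" and gap: "{x<..<y} \<inter> scat_class ` F = {}"
  shows "f x = f y"
proof (rule ccontr)
  assume ne: "f x \<noteq> f y"
  obtain a where a: "scat_class a = x" "\<forall>z>a. scat_class a < scat_class z"
    using greatest_representative by blast
  obtain b where b: "scat_class b = y" "\<forall>z<b. scat_class z < scat_class b"
    using least_representative by blast
  have "a < b" using xy a(1) b(1) scat_class_less_imp_less by blast
  have seg: "open U" "closed U" "\<And>p q. p \<le> q \<Longrightarrow> q \<in> U \<Longrightarrow> p \<in> U" if "U \<in> \<U>" for U
    using \<U> that by (auto simp: clopen_initial_segments_def)
  have no_between: "False" if U: "U \<in> \<U>" "U' \<in> \<U>" "a \<in> U" "b \<notin> U'" "p \<in> U'" "p \<notin> U" for U U' p
  proof -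
    have "F \<inter> (U' - U) \<noteq> {}" using meets U by blast
    then obtain q where q: "q \<in> F" "q \<in> U'" "q \<notin> U" by blast
    have "a < q" using seg(3)[OF U(1), of q a] U(3) q(3) by (meson not_le)
    moreover have "q < b" using seg(3)[OF U(2), of b q] U(4) q(2) by (meson not_le)
    ultimately have "scat_class q \<in> {x<..<y}" using a b by auto
    then show False using gap q(1) by blast
  qed
  have "f (scat_class a) \<noteq> f (scat_class b)" using ne a(1) b(1) by simp
  then obtain U where U: "U \<in> \<U>" "(a, b) \<in> split_set U" using det by blast
  then have aU: "a \<in> U" "b \<notin> U"
    using seg(3)[OF U(1) less_imp_le[OF \<open>a < b\<close>]] by (auto simp: mem_split_set)
  have unique: "p \<in> U' \<longleftrightarrow> p \<in> U" if "U' \<in> \<U>" "a \<in> U'" "b \<notin> U'" for U' p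
    using no_between[OF U(1) that(1) aU(1) that(3)] no_between[OF that(1) U(1) that(2) aU(2)] by blast
  have "compact (UNIV \<inter> ({a..b} \<inter> U))"
    by (intro compact_Int_closed[OF compact_line] closed_Int closed_atLeastAtMost seg(2)[OF U(1)])
  then have "compact ({a..b} \<inter> U)" by simp
  moreover have "a \<in> {a..b} \<inter> U" using aU \<open>a < b\<close> by simp
  then have "{a..b} \<inter> U \<noteq> {}" by blast
  ultimately obtain c where c: "c \<in> {a..b} \<inter> U" "\<forall>z\<in>{a..b} \<inter> U. z \<le> c"
    using compact_attains_sup by metis
  have "closed (- U)" using seg(1)[OF U(1)] by (simp add: closed_Compl)
  then have "compact (UNIV \<inter> ({a..b} \<inter> - U))"
    by (intro compact_Int_closed[OF compact_line] closed_Int closed_atLeastAtMost)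
  then have "compact ({a..b} \<inter> - U)" by simp
  moreover have "b \<in> {a..b} \<inter> - U" using aU \<open>a < b\<close> by simp
  then have "{a..b} \<inter> - U \<noteq> {}" by blast
  ultimately obtain d where d: "d \<in> {a..b} \<inter> - U" "\<forall>z\<in>{a..b} \<inter> - U. d \<le> z"
    using compact_attains_inf by metis
  have "c < d" using seg(3)[OF U(1), of d c] c(1) d(1) by (meson ComplD IntD2 not_le)
  have "{c<..<d} = {}"
  proof (rule ccontr)
    assume "{c<..<d} \<noteq> {}"
    then obtain z where z: "c < z" "z < d" by auto
    have "z \<in> {a..b}" using z c(1) d(1) by auto
    then show False using c(2) d(2) z by (cases "z \<in> U") (auto dest: leD)
  qed
  then have cd: "scat_class c = scat_class d" using scat_class_eq_iff_jump[OF \<open>c < d\<close>] by blast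
  have "f (scat_class a) = f (scat_class c)"
  proof (rule ccontr)
    assume "f (scat_class a) \<noteq> f (scat_class c)"
    then obtain U' where U': "U' \<in> \<U>" "(a, c) \<in> split_set U'" using det by blast
    then have "a \<in> U'" "c \<notin> U'" using seg(3)[OF U'(1), of a c] c(1) by (auto simp: mem_split_set)
    moreover from this have "b \<notin> U'" using seg(3)[OF U'(1), of c b] c(1) by auto
    ultimately show False using unique[OF U'(1), of c] c(1) by blast
  qed
  moreover have "f (scat_class d) = f (scat_class b)"
  proof (rule ccontr)
    assume "f (scat_class d) \<noteq> f (scat_class b)"
    then obtain U' where U': "U' \<in> \<U>" "(d, b) \<in> split_set U'" using det by blast
    then have "d \<in> U'" "b \<notin> U'" using seg(3)[OF U'(1), of d b] d(1) by (auto simp: mem_split_set)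
    moreover from this have "a \<in> U'" using seg(3)[OF U'(1), of a d] d(1) by auto
    ultimately show False using unique[OF U'(1), of d] d(1) by blast
  qed
  ultimately show False using ne a(1) b(1) cd by simp
qed

text \<open>The two end points of the quotient are added to the image of \<open>F\<close> so that the interpolation operator
  can be applied. The pieces describing functions on the image are the images of the cells that finite
  subfamilies of \<open>\<U>\<close> cut out of \<open>F\<close>.\<close>

lemma separable_complementation:
  fixes S :: "('v scat_quotient \<Rightarrow>\<^sub>C real) set"
  assumes zd: "(euclidean :: 'v topology) dim_le 0" and vc: "valdivia_compact (euclidean :: 'v topology)"
    and S: "separable_set S"
  shows "\<exists>G. S \<subseteq> G \<and> separable_set G \<and> k_complemented 1 G"
proof -
  obtain D where D: "countable D" "S \<subseteq> closure D" using separable_setD[OF S] by blast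
  define lift where "lift f = (\<lambda>x :: 'v. apply_bcontfun f (scat_class x))" for f :: "'v scat_quotient \<Rightarrow>\<^sub>C real"
  have cont_lift: "continuous_on UNIV (lift f)" for f
    unfolding lift_def by (rule continuous_on_compose2[OF continuous_on_apply_bcontfun[of UNIV f] continuous_scat_class]) simp
  have lift_D: "countable (lift ` D)" "\<forall>h\<in>lift ` D. continuous_on UNIV h" using D(1) cont_lift by auto
  obtain \<U> F where \<U>: "\<U> \<subseteq> clopen_initial_segments" "countable \<U>" and F: "closed F"
    and det: "\<forall>f\<in>lift ` D. \<forall>x y. f x \<noteq> f y \<longrightarrow> (\<exists>U\<in>\<U>. (x, y) \<in> split_set U)"
    and meets: "\<forall>U\<in>\<U>. \<forall>U'\<in>\<U>. U' - U \<noteq> {} \<longrightarrow> F \<inter> (U' - U) \<noteq> {}"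
    and sep: "\<forall>x\<in>F. \<forall>y\<in>F. x \<noteq> y \<longrightarrow> (\<exists>U\<in>\<U>. (x, y) \<in> split_set U)"
    using determining_segments_and_net[OF zd vc lift_D] by (elim exE conjE)
  obtain lo where lo: "\<forall>x::'v scat_quotient. lo \<le> x" using quotient.closed_has_least[of UNIV] by auto
  obtain hi where hi: "\<forall>x::'v scat_quotient. x \<le> hi" using quotient.closed_has_greatest[of UNIV] by auto
  define F' where "F' = {lo, hi} \<union> scat_class ` F"
  have "compact F" using compact_Int_closed[OF compact_line F] by simp
  then have "compact (scat_class ` F)"
    by (intro compact_continuous_image continuous_on_subset[OF continuous_scat_class]) auto
  moreover have "compact {lo, hi}" by (rule finite_imp_compact) simp
  ultimately have "compact F'" unfolding F'_def by (intro compact_Un)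
  then have closed_F': "closed F'" by (rule quotient.compact_imp_closed)
  define cell where "cell = (\<lambda>(\<V>, \<T>). scat_class ` {z\<in>F. \<forall>U\<in>\<V>. z \<in> U \<longleftrightarrow> U \<in> \<T>})"
  define fin where "fin = {\<V>. finite \<V> \<and> \<V> \<subseteq> \<U>}"
  define \<A> where "\<A> = {{lo}, {hi}} \<union> cell ` (fin \<times> fin)"
  have "countable fin" unfolding fin_def by (rule countable_Collect_finite_subset[OF \<U>(2)])
  then have "countable \<A>" by (auto simp: \<A>_def)
  show ?thesis
  proof (rule quotient.complemented_overspace[OF closed_F' _ _ \<open>countable \<A>\<close> _ D(2)])
    show "\<exists>p\<in>F'. p \<le> x" "\<exists>p\<in>F'. x \<le> p" for x using lo hi by (auto simp: F'_def)
    show "apply_bcontfun f x = f y" if f: "f \<in> D" and xy: "x < y" "{x<..<y} \<inter> F' = {}" for f x y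
    proof (rule constant_across_gap[OF \<U>(1) _ meets xy(1)])
      show "\<exists>U\<in>\<U>. (p, q) \<in> split_set U" if "f (scat_class p) \<noteq> f (scat_class q)" for p q
        using det f that by (auto simp: lift_def)
      show "{x<..<y} \<inter> scat_class ` F = {}" using xy(2) by (auto simp: F'_def)
    qed
    fix g :: "'v scat_quotient \<Rightarrow>\<^sub>C real" and e :: real
    assume e: "0 < e"
    obtain \<V> where \<V>: "\<V> \<subseteq> \<U>" "finite \<V>"
        "\<forall>x\<in>F. \<forall>y\<in>F. (\<forall>U\<in>\<V>. x \<in> U \<longleftrightarrow> y \<in> U) \<longrightarrow> \<bar>lift g x - lift g y\<bar> < e"
      using finite_cells[OF \<U>(1) F sep cont_lift[of g] e] by (elim exE conjE)
    define \<B> where "\<B> = {{lo}, {hi}} \<union> (\<lambda>\<T>. cell (\<V>, \<T>)) ` Pow \<V>"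
    have "\<T> \<in> fin" if "\<T> \<subseteq> \<V>" for \<T> using that \<V>(1,2) finite_subset by (auto simp: fin_def)
    then have "\<B> \<subseteq> \<A>" by (auto simp: \<B>_def \<A>_def)
    moreover have "finite \<B>" using \<V>(2) by (simp add: \<B>_def)
    moreover have "F' \<subseteq> \<Union>\<B>"
    proof
      fix k assume "k \<in> F'"
      then consider "k = lo" | "k = hi" | z where "z \<in> F" "k = scat_class z" by (auto simp: F'_def)
      then show "k \<in> \<Union>\<B>"
      proof cases
        case 3
        then have "k \<in> cell (\<V>, {U\<in>\<V>. z \<in> U})" by (auto simp: cell_def)
        moreover have "cell (\<V>, {U\<in>\<V>. z \<in> U}) \<in> \<B>"
          unfolding \<B>_def by (intro UnI2 imageI) simp
        ultimately show ?thesis by (rule UnionI[rotated])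
      qed (auto simp: \<B>_def)
    qed
    moreover have "\<forall>A\<in>\<B>. \<forall>x\<in>A \<inter> F'. \<forall>y\<in>A \<inter> F'. \<bar>g x - g y\<bar> < e"
    proof (intro ballI)
      fix A x y assume A: "A \<in> \<B>" and x: "x \<in> A \<inter> F'" and y: "y \<in> A \<inter> F'"
      consider "x = y" | \<T> where "A = cell (\<V>, \<T>)" using A x y by (auto simp: \<B>_def)
      then show "\<bar>g x - g y\<bar> < e"
      proof cases
        case 2
        then obtain p q where "p \<in> F" "x = scat_class p" "\<forall>U\<in>\<V>. p \<in> U \<longleftrightarrow> U \<in> \<T>"
            "q \<in> F" "y = scat_class q" "\<forall>U\<in>\<V>. q \<in> U \<longleftrightarrow> U \<in> \<T>"
          using x y by (auto simp: cell_def)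
        moreover from this have "\<forall>U\<in>\<V>. p \<in> U \<longleftrightarrow> q \<in> U" by blast
        ultimately show ?thesis using \<V>(3) by (auto simp: lift_def)
      qed (use e in simp)
    qed
    ultimately show "\<exists>\<V>\<subseteq>\<A>. finite \<V> \<and> F' \<subseteq> \<Union>\<V> \<and> (\<forall>A\<in>\<V>. \<forall>x\<in>A \<inter> F'. \<forall>y\<in>A \<inter> F'. \<bar>g x - g y\<bar> < e)"
      by (intro exI[of _ \<B>] conjI)
  qed
qed

end

section \<open>The collapsed universal Valdivia line\<close>

theorem theorem5p1:
  assumes Valdivia: "linearly_ordered_Valdivia (UNIV :: 'v::linorder_topology set) le_rel"
    and universal: "\<And>(A :: 'v set set) r. linearly_ordered_Valdivia A r \<Longrightarrow>
          \<exists>f :: 'v \<Rightarrow> 'v set. increasing_surjection UNIV le_rel A r f"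
    and zero_dimensional: "(euclidean :: 'v topology) dim_le 0"
    and dense_in_itself: "\<And>x :: 'v. \<not> open {x}"
    and weight: "has_weight TYPE('v) omega1"
    and clopen_intervals: "\<And>I :: 'v set. I \<noteq> {} \<Longrightarrow> open I \<Longrightarrow> closed I \<Longrightarrow>
          (\<forall>x\<in>I. \<forall>y\<in>I. {x..y} \<subseteq> I) \<Longrightarrow> \<exists>h :: 'v \<Rightarrow> 'v. strict_mono h \<and> range h = I"
    and omega1_copies: "\<And>U :: 'v set. open U \<Longrightarrow> U \<noteq> {} \<Longrightarrow>
          (\<exists>f :: nat set \<Rightarrow> 'v. f ` Field omega1 \<subseteq> U \<and>
             (\<forall>\<alpha> \<beta>. (\<alpha>, \<beta>) \<in> omega1 \<and> \<alpha> \<noteq> \<beta> \<longrightarrow> f \<alpha> < f \<beta>)) \<and>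
          (\<exists>f :: nat set \<Rightarrow> 'v. f ` Field omega1 \<subseteq> U \<and>
             (\<forall>\<alpha> \<beta>. (\<alpha>, \<beta>) \<in> omega1 \<and> \<alpha> \<noteq> \<beta> \<longrightarrow> f \<beta> < f \<alpha>))"
  shows "(connected (UNIV :: 'v scat_quotient set) \<and>
          compact (UNIV :: 'v scat_quotient set) \<and>
          (euclidean :: 'v scat_quotient topology) = order_topology_on UNIV le_rel \<and>
          has_weight TYPE('v scat_quotient) omega1)
       \<and> (\<exists>(A :: 'v set) r (f :: 'v \<Rightarrow> 'v scat_quotient).
            linearly_ordered_Valdivia A r \<and> increasing_surjection A r UNIV le_rel f \<and>
            (\<forall>k. finite {x \<in> A. f x = k} \<and> card {x \<in> A. f x = k} \<le> 2))
       \<and> (\<forall>S :: ('v scat_quotient \<Rightarrow>\<^sub>C real) set. subspace S \<and> separable_set S \<longrightarrow>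
            (\<exists>G. S \<subseteq> G \<and> separable_set G \<and> k_complemented 1 G))
       \<and> (\<nexists>\<C> :: ('v scat_quotient \<Rightarrow>\<^sub>C real) set set. skeleton \<C> \<and> (\<forall>C\<in>\<C>. complemented C))
       \<and> (one_Plichko TYPE('f::banach) \<longrightarrow>
            \<not> linearly_isomorphic TYPE('v scat_quotient \<Rightarrow>\<^sub>C real) TYPE('f))"
proof -
  have vc: "valdivia_compact (euclidean :: 'v topology)"
    using Valdivia by (simp add: linearly_ordered_Valdivia_def order_topology_on_UNIV)
  then have compact: "compact (UNIV :: 'v set)" by (simp add: valdivia_compact_def compact_space_def)
  interpret perfect_compact_line "TYPE('v)"
    by (unfold_locales) (rule dense_in_itself, rule compact)
  have copies: "\<exists>f :: nat set \<Rightarrow> 'v. f ` Field omega1 \<subseteq> U \<and> (\<forall>\<alpha> \<beta>. (\<alpha>, \<beta>) \<in> omega1 \<and> \<alpha> \<noteq> \<beta> \<longrightarrow> f \<alpha> < f \<beta>)"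
    if "open U" "U \<noteq> {}" for U :: "'v set"
    by (rule conjunct1[OF omega1_copies[OF that]])
  have nonseparable: "\<exists>x y. u < x \<and> x < y \<and> y < v \<and> {x<..<y} \<inter> N = {}"
    if "u < v" "countable N" for u v :: "'v scat_quotient" and N
    by (rule nonseparable_quotient[OF copies that]) assumption+
  obtain m n :: "'v scat_quotient" where mn: "m < n" using quotient_nontrivial by blast
  have a: "connected (UNIV :: 'v scat_quotient set) \<and> compact (UNIV :: 'v scat_quotient set) \<and>
      (euclidean :: 'v scat_quotient topology) = order_topology_on UNIV le_rel \<and>
      has_weight TYPE('v scat_quotient) omega1"
    by (intro conjI quotient.connected_UNIV quotient.compact_UNIV quotient.euclidean_eq_order_topology
        quotient_weight[OF weight nonseparable])
  have "increasing_surjection UNIV le_rel UNIV le_rel (scat_class :: 'v \<Rightarrow> 'v scat_quotient)"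
  proof -
    have "k \<in> range (scat_class :: 'v \<Rightarrow> _)" for k by (rule scat_class_cases[of k]) simp
    then have "range (scat_class :: 'v \<Rightarrow> 'v scat_quotient) = UNIV" by blast
    then show ?thesis
      unfolding increasing_surjection_def order_topology_on_UNIV quotient.euclidean_eq_order_topology[symmetric]
      using continuous_scat_class scat_class_mono by simp
  qed
  then have b: "\<exists>(A :: 'v set) r (f :: 'v \<Rightarrow> 'v scat_quotient).
      linearly_ordered_Valdivia A r \<and> increasing_surjection A r UNIV le_rel f \<and>
      (\<forall>k. finite {x \<in> A. f x = k} \<and> card {x \<in> A. f x = k} \<le> 2)"
    using Valdivia fibre_card
    by (intro exI[of _ UNIV] exI[of _ le_rel] exI[of _ "scat_class :: 'v \<Rightarrow> 'v scat_quotient"]) simp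
  have c: "\<forall>S :: ('v scat_quotient \<Rightarrow>\<^sub>C real) set. subspace S \<and> separable_set S \<longrightarrow>
      (\<exists>G. S \<subseteq> G \<and> separable_set G \<and> k_complemented 1 G)"
    using separable_complementation[OF zero_dimensional vc] by blast
  have d: "\<nexists>\<C> :: ('v scat_quotient \<Rightarrow>\<^sub>C real) set set. skeleton \<C> \<and> (\<forall>C\<in>\<C>. complemented C)"
  proof
    assume "\<exists>\<C> :: ('v scat_quotient \<Rightarrow>\<^sub>C real) set set. skeleton \<C> \<and> (\<forall>C\<in>\<C>. complemented C)"
    then obtain \<C> :: "('v scat_quotient \<Rightarrow>\<^sub>C real) set set"
      where sk: "skeleton \<C>" "\<forall>C\<in>\<C>. complemented C" by (elim exE conjE)
    show False
      by (rule quotient.no_skeleton_of_complemented_subspaces[OF nonseparable mn sk]) assumption+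
  qed
  have "\<not> linearly_isomorphic TYPE('v scat_quotient \<Rightarrow>\<^sub>C real) TYPE('f)" if plichko: "one_Plichko TYPE('f)"
  proof
    assume "linearly_isomorphic TYPE('v scat_quotient \<Rightarrow>\<^sub>C real) TYPE('f)"
    then obtain F :: "('v scat_quotient \<Rightarrow>\<^sub>C real) \<Rightarrow> 'f" and G
      where FG: "bounded_linear F" "bounded_linear G" "G \<circ> F = id" "F \<circ> G = id"
      unfolding linearly_isomorphic_def by (elim exE conjE)
    obtain P :: "nat set \<Rightarrow> 'f \<Rightarrow> 'f" where P: "projectional_resolution P"
      using plichko unfolding one_Plichko_def by (elim exE)
    show False using skeleton_of_projectional_resolution[OF P FG] d by (rule notE[rotated])
  qed
  then show ?thesis using a b c d by blast
qed

end
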